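(* Let $\overline M=M\cup\partial M$ be a smooth manifold with boundary and let $\nabla$ be a special torsion-free linear connection on $TM$ which is projectively pre-compact. Let $\sigma\in\Gamma(\mathcal E(1)|_M)$ be a non-zero section that is parallel for $\nabla$ and let $\mathsf P$ be the Schouten tensor of $\nabla$. Then the section $\sigma\mathsf P$ of $S^2T^*M(1)$ admits a smooth extension to the boundary, and its boundary value restricts on $T\partial M\times T\partial M$ to the canonical weighted second fundamental form $\Phi$. Moreover, the form $\Phi$ vanishes on $T\overline M|_{\partial M}\times T\partial M$ if and only if the boundary value of $\sigma\mathsf P$ has the same property.
   Context: Setting. $\overline M$ is a smooth manifold with boundary $\partial M$ and interior $M$, $\dim\overline M=n+1$. An object on $U\cap M$ ($U\subset\overline M$ open) "admits a smooth extension to the boundary" (is "smooth up to the boundary") if it is the restriction of a smooth object on $U$. A local defining function for $\partial M$ is a smooth $\rho:U\to\mathbb R$, $U\subset\overline M$ open, with $\rho^{-1}(0)=U\cap\partial M$ and $d\rho$ nowhere zero on $U\cap\partial M$. $\mathfrak X_\partial(U)\subset\mathfrak X(U)$ is the space of vector fields tangent to $\partial M$ along $U\cap\partial M$. Connections. A torsion-free linear connection on $TM$ is special if it preserves a (nowhere vanishing) volume density. For a one-form $\Upsilon$, $\nabla+\Upsilon$ denotes the connection $\nabla_\xi\eta+\Upsilon(\xi)\eta+\Upsilon(\eta)\xi$. Put $\nabla^\rho:=\nabla+\frac{d\rho}{\rho}$ on $U\cap M$. A special $\nabla$ is projectively pre-compact (of order $1$) if for each $U$ and each local defining function $\rho:U\to\mathbb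 R$: (i) $d\rho(\nabla^\rho_\xi\eta)$ is smooth up to the boundary for all $\xi,\eta\in\mathfrak X(U)$; (ii) $\rho\nabla^\rho_\xi\eta$ is smooth up to the boundary for all $\xi,\eta\in\mathfrak X(U)$; (iii) $\nabla^\rho_\xi\eta$ is smooth up to the boundary if at least one of $\xi,\eta\in\mathfrak X(U)$ lies in $\mathfrak X_\partial(U)$. With $\mathrm{Ric}(\xi,\eta)=\mathrm{tr}(\zeta\mapsto R(\zeta,\xi)\eta)$, the Schouten tensor of a special connection on $TM$ is $\mathsf P=\frac1n\mathrm{Ric}$ (symmetric). Densities and $\Phi$. $\mathcal E(w)$ is the oriented line bundle of projective densities of weight $w$, normalized so that $\mathcal E(-n-2)$ is the bundle of volume densities; $B(w):=B\otimes\mathcal E(w)$. A non-zero parallel density is understood to be nowhere vanishing on $M$. For any local defining function $\rho$, the section $\nabla^\rho\nabla^\rho\sigma$ of $S^2T^*M(1)$ is smooth up to the boundary; its boundary value evaluated on a pair of fields in $T\overline M|_{\partial M}$ at least one of which lies in $T\partial M$ is independent of $\rho$ and denoted by $\Phi$. Its restriction to $T\partial M\times T\partial M$ is the canonical weighted second fundamental form. (Here $\Phi$ is formed with the same $\sigma$ as in the claim.) *)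

theory Defs
  imports "HOL-Analysis.Analysis"
begin

section \<open>Smooth maps on subsets of a normed space\<close>

primrec Ck_on :: "nat \<Rightarrow> 'b::real_normed_vector set \<Rightarrow> ('b \<Rightarrow> 'c::real_normed_vector) \<Rightarrow> bool" where
  "Ck_on 0 S f \<longleftrightarrow> continuous_on S f"
| "Ck_on (Suc k) S f \<longleftrightarrow>
     (\<forall>x\<in>S. f differentiable at x) \<and> (\<forall>v. Ck_on k S (\<lambda>x. frechet_derivative f (at x) v))"

text \<open>On a set that is not open (here: relatively open in a half space), smooth means locally the
  restriction of a smooth map defined on an open subset of the ambient space.\<close>

definition smooth_on :: "'b::real_normed_vector set \<Rightarrow> ('b \<Rightarrow> 'c::real_normed_vector) \<Rightarrow> bool" where
  "smooth_on S f \<longleftrightarrow>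
     (\<forall>x\<in>S. \<exists>V g. open V \<and> x \<in> V \<and> (\<forall>k. Ck_on k V g) \<and> (\<forall>y\<in>S \<inter> V. f y = g y))"


section \<open>Manifolds with boundary\<close>

text \<open>The model space of dimension \<open>n + 1\<close> is \<open>real ^ ('n option)\<close> with \<open>n = CARD('n) \<ge> 1\<close>;
  the coordinate with index \<open>None\<close> is the one transversal to the boundary.\<close>

type_synonym 'n coords = "(real, 'n option) vec"

type_synonym ('a, 'n) chart = "'a set \<times> ('a \<Rightarrow> 'n coords)"

abbreviation cdom :: "('a, 'n) chart \<Rightarrow> 'a set" where "cdom \<equiv> fst"
abbreviation cmap :: "('a, 'n) chart \<Rightarrow> 'a \<Rightarrow> 'n coords" where "cmap \<equiv> snd"

definition cinv :: "('a, 'n) chart \<Rightarrow> 'n coords \<Rightarrow> 'a" where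
  "cinv c = inv_into (cdom c) (cmap c)"

definition half_space :: "'n::finite coords set" where
  "half_space = {x. 0 \<le> x $ None}"

definition is_chart :: "('a::topological_space, 'n::finite) chart \<Rightarrow> bool" where
  "is_chart c \<longleftrightarrow> open (cdom c) \<and> openin (top_of_set half_space) (cmap c ` cdom c) \<and>
     homeomorphism (cdom c) (cmap c ` cdom c) (cmap c) (cinv c)"

text \<open>The points of the manifold with boundary are all points of the type \<open>'a\<close>. The atlas need not
  be maximal.\<close>

definition smooth_manifold_with_boundary ::
    "('a::{t2_space, second_countable_topology}, 'n::finite) chart set \<Rightarrow> bool" where
  "smooth_manifold_with_boundary A \<longleftrightarrow>
     (\<Union>c\<in>A. cdom c) = UNIV \<and> (\<forall>c\<in>A. is_chart c) \<and>
     (\<forall>c\<in>A. \<forall>c'\<in>A. smooth_on (cmap c ` (cdom c \<inter> cdom c')) (cmap c' \<circ> cinv c))"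

definition mboundary :: "('a, 'n::finite) chart set \<Rightarrow> 'a set" where
  "mboundary A = {p. \<exists>c\<in>A. p \<in> cdom c \<and> cmap c p $ None = 0}"

definition minterior :: "('a, 'n::finite) chart set \<Rightarrow> 'a set" where
  "minterior A = - mboundary A"


section \<open>Tangent vectors, functions and vector fields\<close>

text \<open>For every point \<open>p\<close> a chart around \<open>p\<close> is selected, and the tangent space at \<open>p\<close> is identified
  with \<open>'n coords\<close> by means of the coordinate frame of that chart at \<open>p\<close>. A section of a tensor or
  density bundle is then a function on points whose value at \<open>p\<close> is expressed in that frame. The
  selected charts are in no way related for different points; smoothness and derivatives are always
  expressed through the components \<open>frame_coords A c\<close> of a section in a fixed chart \<open>c\<close>, so
  that no notion below depends on the selection.\<close>

definition chart_at :: "('a, 'n) chart set \<Rightarrow> 'a \<Rightarrow> ('a, 'n) chart" where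
  "chart_at A p = (SOME c. c \<in> A \<and> p \<in> cdom c)"

definition trans_deriv ::
    "('a, 'n::finite) chart \<Rightarrow> ('a, 'n) chart \<Rightarrow> 'a \<Rightarrow> 'n coords \<Rightarrow> 'n coords" where
  "trans_deriv c c' p =
     frechet_derivative (cmap c' \<circ> cinv c) (at (cmap c p) within cmap c ` (cdom c \<inter> cdom c'))"

text \<open>Components in the chart \<open>c\<close> of a tangent vector at \<open>p\<close>, and the tangent vector at \<open>p\<close> with
  given components in the chart \<open>c\<close>.\<close>

definition frame_coords ::
    "('a, 'n::finite) chart set \<Rightarrow> ('a, 'n) chart \<Rightarrow> 'a \<Rightarrow> 'n coords \<Rightarrow> 'n coords" where
  "frame_coords A c p v = trans_deriv (chart_at A p) c p v"

definition frame_vec ::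
    "('a, 'n::finite) chart set \<Rightarrow> ('a, 'n) chart \<Rightarrow> 'a \<Rightarrow> 'n coords \<Rightarrow> 'n coords" where
  "frame_vec A c p x = trans_deriv c (chart_at A p) p x"

definition coord_field ::
    "('a, 'n::finite) chart set \<Rightarrow> ('a, 'n) chart \<Rightarrow> 'n coords \<Rightarrow> 'a \<Rightarrow> 'n coords" where
  "coord_field A c u = (\<lambda>q. frame_vec A c q u)"

definition boundary_tangent :: "('a, 'n::finite) chart set \<Rightarrow> 'a \<Rightarrow> 'n coords set" where
  "boundary_tangent A p = {v. \<forall>c\<in>A. p \<in> cdom c \<longrightarrow> frame_coords A c p v $ None = 0}"

text \<open>The derivative, at the point \<open>p\<close> and in the direction of the tangent vector \<open>v\<close> at \<open>p\<close>, of a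
  function given in the coordinates of the chart selected at \<open>p\<close>.\<close>

definition coord_deriv ::
    "('a, 'n::finite) chart set \<Rightarrow> 'a \<Rightarrow> 'n coords \<Rightarrow> ('n coords \<Rightarrow> 'b::real_normed_vector) \<Rightarrow> 'b" where
  "coord_deriv A p v F =
     (let c = chart_at A p in frechet_derivative F (at (cmap c p) within cmap c ` cdom c) v)"

definition smooth_fun :: "('a, 'n::finite) chart set \<Rightarrow> 'a set \<Rightarrow> ('a \<Rightarrow> real) \<Rightarrow> bool" where
  "smooth_fun A W f \<longleftrightarrow> (\<forall>c\<in>A. smooth_on (cmap c ` (cdom c \<inter> W)) (f \<circ> cinv c))"

definition dfun :: "('a, 'n::finite) chart set \<Rightarrow> ('a \<Rightarrow> real) \<Rightarrow> 'a \<Rightarrow> 'n coords \<Rightarrow> real" where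
  "dfun A f p v = coord_deriv A p v (f \<circ> cinv (chart_at A p))"

definition vf_local ::
    "('a, 'n::finite) chart set \<Rightarrow> ('a, 'n) chart \<Rightarrow> ('a \<Rightarrow> 'n coords) \<Rightarrow> 'n coords \<Rightarrow> 'n coords" where
  "vf_local A c X x = frame_coords A c (cinv c x) (X (cinv c x))"

text \<open>\<open>vector_fields A W\<close> consists of the vector fields that are smooth on the open set \<open>W\<close> of the
  manifold with boundary; the values outside \<open>W\<close> are arbitrary.\<close>

definition vector_fields :: "('a, 'n::finite) chart set \<Rightarrow> 'a set \<Rightarrow> ('a \<Rightarrow> 'n coords) set" where
  "vector_fields A W = {X. \<forall>c\<in>A. smooth_on (cmap c ` (cdom c \<inter> W)) (vf_local A c X)}"

definition tangential_fields :: "('a, 'n::finite) chart set \<Rightarrow> 'a set \<Rightarrow> ('a \<Rightarrow> 'n coords) set" where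
  "tangential_fields A W =
     {X \<in> vector_fields A W. \<forall>p\<in>W \<inter> mboundary A. X p \<in> boundary_tangent A p}"

definition lie_bracket ::
    "('a, 'n::finite) chart set \<Rightarrow> ('a \<Rightarrow> 'n coords) \<Rightarrow> ('a \<Rightarrow> 'n coords) \<Rightarrow> 'a \<Rightarrow> 'n coords" where
  "lie_bracket A X Y p =
     coord_deriv A p (X p) (vf_local A (chart_at A p) Y)
     - coord_deriv A p (Y p) (vf_local A (chart_at A p) X)"

definition local_defining_function ::
    "('a::topological_space, 'n::finite) chart set \<Rightarrow> 'a set \<Rightarrow> ('a \<Rightarrow> real) \<Rightarrow> bool" where
  "local_defining_function A U \<rho> \<longleftrightarrow>
     open U \<and> smooth_fun A U \<rho> \<and> (\<forall>p\<in>U. \<rho> p = 0 \<longleftrightarrow> p \<in> mboundary A) \<and>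
     (\<forall>p\<in>U \<inter> mboundary A. \<exists>v. dfun A \<rho> p v \<noteq> 0)"


section \<open>Linear connections on the tangent bundle\<close>

text \<open>A connection is a map \<open>D\<close> for which \<open>D p v Y\<close> is the covariant derivative at \<open>p\<close> of the local
  vector field \<open>Y\<close> in the direction of the tangent vector \<open>v\<close> at \<open>p\<close>. It acts on vector fields
  defined near \<open>p\<close> only and depends only on their values near \<open>p\<close>, so restricting it to open
  subsets requires no further notation.\<close>

type_synonym ('a, 'n) conn = "'a \<Rightarrow> 'n coords \<Rightarrow> ('a \<Rightarrow> 'n coords) \<Rightarrow> 'n coords"

definition cov :: "('a, 'n) conn \<Rightarrow> ('a \<Rightarrow> 'n coords) \<Rightarrow> ('a \<Rightarrow> 'n coords) \<Rightarrow> 'a \<Rightarrow> 'n coords" where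
  "cov D X Y = (\<lambda>p. D p (X p) Y)"

definition linear_connection ::
    "('a::topological_space, 'n::finite) chart set \<Rightarrow> 'a set \<Rightarrow> ('a, 'n) conn \<Rightarrow> bool" where
  "linear_connection A M D \<longleftrightarrow>
     (\<forall>U. open U \<and> U \<subseteq> M \<longrightarrow>
        (\<forall>Y\<in>vector_fields A U.
           (\<forall>p\<in>U. linear (\<lambda>v. D p v Y)) \<and>
           (\<forall>Z\<in>vector_fields A U. \<forall>p\<in>U. \<forall>v. D p v (\<lambda>q. Y q + Z q) = D p v Y + D p v Z) \<and>
           (\<forall>f. smooth_fun A U f \<longrightarrow>
              (\<forall>p\<in>U. \<forall>v. D p v (\<lambda>q. f q *\<^sub>R Y q) = dfun A f p v *\<^sub>R Y p + f p *\<^sub>R D p v Y)) \<and>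
           (\<forall>Z. (\<forall>q\<in>U. Z q = Y q) \<longrightarrow> (\<forall>p\<in>U. \<forall>v. D p v Z = D p v Y)) \<and>
           (\<forall>X\<in>vector_fields A U. cov D X Y \<in> vector_fields A U)))"

definition torsion_free ::
    "('a::topological_space, 'n::finite) chart set \<Rightarrow> 'a set \<Rightarrow> ('a, 'n) conn \<Rightarrow> bool" where
  "torsion_free A M D \<longleftrightarrow>
     (\<forall>U. open U \<and> U \<subseteq> M \<longrightarrow>
        (\<forall>X\<in>vector_fields A U. \<forall>Y\<in>vector_fields A U. \<forall>p\<in>U.
           cov D X Y p - cov D Y X p = lie_bracket A X Y p))"

definition proj_change :: "('a, 'n) conn \<Rightarrow> ('a \<Rightarrow> 'n coords \<Rightarrow> real) \<Rightarrow> ('a, 'n::finite) conn" where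
  "proj_change D \<Upsilon> = (\<lambda>p v Y. D p v Y + \<Upsilon> p v *\<^sub>R Y p + \<Upsilon> p (Y p) *\<^sub>R v)"

definition conn_rho ::
    "('a, 'n::finite) chart set \<Rightarrow> ('a, 'n) conn \<Rightarrow> ('a \<Rightarrow> real) \<Rightarrow> ('a, 'n) conn" where
  "conn_rho A D \<rho> = proj_change D (\<lambda>p v. dfun A \<rho> p v / \<rho> p)"

definition curvature ::
    "('a, 'n::finite) chart set \<Rightarrow> ('a, 'n) conn \<Rightarrow>
     ('a \<Rightarrow> 'n coords) \<Rightarrow> ('a \<Rightarrow> 'n coords) \<Rightarrow> ('a \<Rightarrow> 'n coords) \<Rightarrow> 'a \<Rightarrow> 'n coords" where
  "curvature A D X Y Z = (\<lambda>p.
     cov D X (cov D Y Z) p - cov D Y (cov D X Z) p - cov D (lie_bracket A X Y) Z p)"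

text \<open>Curvature being tensorial, tangent vectors at \<open>p\<close> may be extended to coordinate fields.\<close>

definition Ric ::
    "('a, 'n::finite) chart set \<Rightarrow> ('a, 'n) conn \<Rightarrow> 'a \<Rightarrow> 'n coords \<Rightarrow> 'n coords \<Rightarrow> real" where
  "Ric A D p u v =
     (let c = chart_at A p in
      trace (matrix (\<lambda>z. curvature A D (coord_field A c z) (coord_field A c u) (coord_field A c v) p)))"

definition Schouten ::
    "('a, 'n::finite) chart set \<Rightarrow> ('a, 'n) conn \<Rightarrow> 'a \<Rightarrow> 'n coords \<Rightarrow> 'n coords \<Rightarrow> real" where
  "Schouten A D p u v = Ric A D p u v / real CARD('n)"


section \<open>Projective densities\<close>

text \<open>If \<open>x\<close> and \<open>y\<close> are the coordinates of \<open>c\<close> and of the chart selected at \<open>p\<close>, components of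
  volume densities satisfy \<open>\<nu>\<^sub>x = \<bar>det (\<partial>y/\<partial>x)\<bar> * \<nu>\<^sub>y\<close>; they have weight \<open>-(n + 2)\<close>, which
  determines the transformation for weight \<open>w\<close>. The positive coordinate volume density induces
  the positive trivialisation of the oriented bundle of densities of weight \<open>w\<close>.\<close>

definition density_factor ::
    "('a, 'n::finite) chart set \<Rightarrow> real \<Rightarrow> ('a, 'n) chart \<Rightarrow> 'a \<Rightarrow> real" where
  "density_factor A w c p =
     \<bar>det (matrix (trans_deriv c (chart_at A p) p))\<bar> powr (- w / (real CARD('n) + 2))"

definition density_local ::
    "('a, 'n::finite) chart set \<Rightarrow> real \<Rightarrow> ('a, 'n) chart \<Rightarrow> ('a \<Rightarrow> real) \<Rightarrow> 'n coords \<Rightarrow> real" where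
  "density_local A w c s x = density_factor A w c (cinv c x) * s (cinv c x)"

definition smooth_density ::
    "('a, 'n::finite) chart set \<Rightarrow> real \<Rightarrow> 'a set \<Rightarrow> ('a \<Rightarrow> real) \<Rightarrow> bool" where
  "smooth_density A w W s \<longleftrightarrow> (\<forall>c\<in>A. smooth_on (cmap c ` (cdom c \<inter> W)) (density_local A w c s))"

text \<open>The induced connection on densities of weight \<open>w\<close>: on volume densities it subtracts the trace
  of the connection form in the coordinate frame, and hence weight \<open>w\<close> contributes the factor
  \<open>w / (n + 2)\<close>. Consequently \<open>\<nabla> + \<Upsilon>\<close> differentiates \<open>s\<close> as \<open>\<nabla>s + w \<Upsilon> s\<close>.\<close>

definition cov_density ::
    "('a, 'n::finite) chart set \<Rightarrow> ('a, 'n) conn \<Rightarrow> real \<Rightarrow> 'a \<Rightarrow> 'n coords \<Rightarrow> ('a \<Rightarrow> real) \<Rightarrow> real" where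
  "cov_density A D w p v s =
     (let c = chart_at A p in
      coord_deriv A p v (density_local A w c s)
      + w / (real CARD('n) + 2) * trace (matrix (\<lambda>u. D p v (coord_field A c u))) * s p)"

definition parallel_density ::
    "('a, 'n::finite) chart set \<Rightarrow> 'a set \<Rightarrow> ('a, 'n) conn \<Rightarrow> real \<Rightarrow> ('a \<Rightarrow> real) \<Rightarrow> bool" where
  "parallel_density A M D w s \<longleftrightarrow> (\<forall>p\<in>M. \<forall>v. cov_density A D w p v s = 0)"

definition special_connection ::
    "('a::topological_space, 'n::finite) chart set \<Rightarrow> 'a set \<Rightarrow> ('a, 'n) conn \<Rightarrow> bool" where
  "special_connection A M D \<longleftrightarrow>
     linear_connection A M D \<and> torsion_free A M D \<and>
     (\<exists>\<nu>. smooth_density A (- (real CARD('n) + 2)) M \<nu> \<and> (\<forall>p\<in>M. \<nu> p \<noteq> 0) \<and>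
          parallel_density A M D (- (real CARD('n) + 2)) \<nu>)"

text \<open>\<open>(\<nabla>\<nabla>s)(u, v) = \<nabla>\<^sub>u (\<nabla>\<^sub>V s) - \<nabla>\<^bsub>\<nabla>\<^sub>u V\<^esub> s\<close>, where \<open>V\<close> extends the tangent vector \<open>v\<close>.\<close>

definition hess_density ::
    "('a, 'n::finite) chart set \<Rightarrow> ('a, 'n) conn \<Rightarrow> real \<Rightarrow> ('a \<Rightarrow> real) \<Rightarrow>
     'a \<Rightarrow> 'n coords \<Rightarrow> 'n coords \<Rightarrow> real" where
  "hess_density A D w s p u v =
     (let V = coord_field A (chart_at A p) v in
      cov_density A D w p u (\<lambda>q. cov_density A D w q (V q) s) - cov_density A D w p (D p u V) s)"

definition smooth_S2 ::
    "('a, 'n::finite) chart set \<Rightarrow> real \<Rightarrow> 'a set \<Rightarrow> ('a \<Rightarrow> 'n coords \<Rightarrow> 'n coords \<Rightarrow> real) \<Rightarrow> bool" where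
  "smooth_S2 A w W T \<longleftrightarrow>
     (\<forall>p\<in>W. bilinear (T p) \<and> (\<forall>u v. T p u v = T p v u)) \<and>
     (\<forall>c\<in>A. \<forall>a b. smooth_on (cmap c ` (cdom c \<inter> W))
        (density_local A w c (\<lambda>q. T q (coord_field A c a q) (coord_field A c b q))))"

definition smooth_S2_extension ::
    "('a, 'n::finite) chart set \<Rightarrow> real \<Rightarrow> 'a set \<Rightarrow> ('a \<Rightarrow> 'n coords \<Rightarrow> 'n coords \<Rightarrow> real) \<Rightarrow>
     ('a \<Rightarrow> 'n coords \<Rightarrow> 'n coords \<Rightarrow> real) \<Rightarrow> bool" where
  "smooth_S2_extension A w U T S \<longleftrightarrow>
     smooth_S2 A w U S \<and> (\<forall>p\<in>U \<inter> minterior A. \<forall>u v. S p u v = T p u v)"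


section \<open>Projective pre-compactness and the form \<open>\<Phi>\<close>\<close>

definition smooth_fun_to_boundary :: "('a, 'n::finite) chart set \<Rightarrow> 'a set \<Rightarrow> ('a \<Rightarrow> real) \<Rightarrow> bool" where
  "smooth_fun_to_boundary A U f \<longleftrightarrow>
     (\<exists>g. smooth_fun A U g \<and> (\<forall>p\<in>U \<inter> minterior A. g p = f p))"

definition smooth_vf_to_boundary ::
    "('a, 'n::finite) chart set \<Rightarrow> 'a set \<Rightarrow> ('a \<Rightarrow> 'n coords) \<Rightarrow> bool" where
  "smooth_vf_to_boundary A U X \<longleftrightarrow>
     (\<exists>Z\<in>vector_fields A U. \<forall>p\<in>U \<inter> minterior A. Z p = X p)"

definition projectively_pre_compact ::
    "('a::topological_space, 'n::finite) chart set \<Rightarrow> ('a, 'n) conn \<Rightarrow> bool" where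
  "projectively_pre_compact A D \<longleftrightarrow>
     (\<forall>U \<rho>. local_defining_function A U \<rho> \<longrightarrow>
        (\<forall>\<xi>\<in>vector_fields A U. \<forall>\<eta>\<in>vector_fields A U.
           smooth_fun_to_boundary A U (\<lambda>p. dfun A \<rho> p (cov (conn_rho A D \<rho>) \<xi> \<eta> p)) \<and>
           smooth_vf_to_boundary A U (\<lambda>p. \<rho> p *\<^sub>R cov (conn_rho A D \<rho>) \<xi> \<eta> p) \<and>
           (\<xi> \<in> tangential_fields A U \<or> \<eta> \<in> tangential_fields A U \<longrightarrow>
              smooth_vf_to_boundary A U (cov (conn_rho A D \<rho>) \<xi> \<eta>))))"

text \<open>The common boundary value at \<open>p\<close> of the Hessians of \<open>\<sigma>\<close> for all local defining functions near
  \<open>p\<close>. It is meaningful if at least one of \<open>u\<close>, \<open>v\<close> is tangent to the boundary.\<close>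

definition Phi ::
    "('a::topological_space, 'n::finite) chart set \<Rightarrow> ('a, 'n) conn \<Rightarrow> ('a \<Rightarrow> real) \<Rightarrow>
     'a \<Rightarrow> 'n coords \<Rightarrow> 'n coords \<Rightarrow> real" where
  "Phi A D \<sigma> p u v =
     (THE t. \<forall>U \<rho>. local_defining_function A U \<rho> \<and> p \<in> U \<longrightarrow>
        (\<exists>S. smooth_S2_extension A 1 U (hess_density A (conn_rho A D \<rho>) 1 \<sigma>) S \<and> S p u v = t))"

end

theory Submission
  imports Defs
begin

text \<open>Near a boundary point, the transversal coordinate \<open>x0\<close> of any chart is itself a local defining
  function, and everything can be read off from the Christoffel symbols \<open>K\<close> of \<open>\<nabla> + dx0 / x0\<close> in that
  chart. Pre-compactness for \<open>x0\<close> says that the transversal component \<open>K0\<close>, the product \<open>x0 K\<close>, and all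
  \<open>K(u, v)\<close> with \<open>u\<close> or \<open>v\<close> tangent to the boundary extend smoothly. So only the tangential components of
  \<open>K(e0, e0)\<close> can be singular, and at most like \<open>1 / x0\<close>. Write \<open>n + 1\<close> for the dimension.

  The density. The trace of \<open>K\<close> extends smoothly. As \<open>\<sigma> / x0\<close> is parallel for \<open>\<nabla> + dx0 / x0\<close>, it solves a
  linear ordinary differential equation along the lines in direction \<open>e0\<close> whose coefficient extends;
  hence \<open>\<sigma> / x0\<close> extends smoothly, with a boundary value \<open>t \<noteq> 0\<close> (\<open>rescaled_density_extends\<close>).

  The Schouten tensor. The projective change of the Ricci tensor gives
  \<open>x0 Ric(b, d) = x0 Ric\<^sub>K(b, d) - n K0(b, d)\<close>, and none of the quadratic terms of \<open>Ric\<^sub>K\<close> has two singular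
  factors. So \<open>\<sigma> P = (\<sigma> / x0) (x0 Ric) / n\<close> extends. If \<open>b\<close> is tangential, the boundary value of
  \<open>x0 Ric\<^sub>K(b, d)\<close> is a contraction of \<open>K0(b, w)\<close>, \<open>w\<close> tangential, with the boundary value of
  \<open>x0 K(e0, d)\<close>; it vanishes if \<open>d\<close> is tangential, and also if \<open>K0(b, w) = 0\<close> for all tangential \<open>w\<close>
  (\<open>x0_ric\<close>, \<open>ric_extends\<close>).

  The Hessian. An arbitrary defining function is \<open>\<rho> = x0 q\<close> with \<open>q\<close> smooth and nonzero
  (\<open>hadamard_boundary\<close>). Evaluated on \<open>(a, b)\<close>, the Hessian of \<open>\<sigma>\<close> for \<open>\<nabla> + d\<rho> / \<rho>\<close> is \<open>\<sigma> / x0\<close> times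
  \<open>x0 (\<partial>\<^sub>a \<partial>\<^sub>b q) / q - K0(a, b) - dq(x0 K(a, b)) / q - 2 x0 (\<partial>\<^sub>a q) (\<partial>\<^sub>b q) / q\<^sup>2\<close>.
  It extends, and if \<open>b\<close> is tangential, its boundary value \<open>- t K0(a, b)\<close> involves \<open>\<rho>\<close> no longer. This value
  is \<open>\<Phi>\<close> (\<open>hess_extends\<close>, \<open>Phi_boundary_value\<close>).

  So \<open>\<Phi>\<close> and the boundary value of \<open>\<sigma> P\<close> agree on tangential pairs. If one of them vanishes whenever one
  argument is tangential, then \<open>K0\<close> vanishes on tangential pairs because \<open>t \<noteq> 0\<close>; by the criterion for
  \<open>x0 Ric\<^sub>K\<close> above, \<open>\<Phi>\<close> and \<open>\<sigma> P\<close> then agree as soon as one argument is tangential, and both vanish.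

  What remains is to express the intrinsic objects, whose values at each point refer to the frame of a
  chart selected at that point, in one fixed chart (\<open>curvature_local\<close>, \<open>sig_derivative\<close>, \<open>hess_local\<close>),
  and to glue the local extensions (\<open>glue_S2_extension\<close>).\<close>

section \<open>Continuously differentiable maps\<close>

abbreviation fder :: "('b::real_normed_vector \<Rightarrow> 'c::real_normed_vector) \<Rightarrow> 'b \<Rightarrow> 'b \<Rightarrow> 'c" where
  "fder f x \<equiv> frechet_derivative f (at x)"

lemma Ck_on_cong:
  assumes "open V" "\<And>x. x \<in> V \<Longrightarrow> f x = g x" "Ck_on k V f"
  shows "Ck_on k V g"
  using assms(2,3)
proof (induction k arbitrary: f g)
  case 0
  then show ?case using continuous_on_cong by fastforce
next
  case (Suc k)
  have D: "(g has_derivative fder f x) (at x)" if "x \<in> V" for x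
    using has_derivative_transform_within_open[OF _ assms(1) that, of f _ UNIV g] Suc.prems that
    by (auto simp: frechet_derivative_works)
  moreover have "Ck_on k V (\<lambda>x. fder g x v)" for v
    by (rule Suc.IH[of "\<lambda>x. fder f x v"])
      (use frechet_derivative_at[OF D] Suc.prems in auto)
  ultimately show ?case by (auto simp: differentiable_def)
qed

lemma Ck_on_subset: "Ck_on k S f \<Longrightarrow> T \<subseteq> S \<Longrightarrow> Ck_on k T f"
  by (induction k arbitrary: f) (auto intro: continuous_on_subset)

lemma Ck_on_imp_continuous_on: "Ck_on k S f \<Longrightarrow> continuous_on S f"
  by (cases k) (auto intro!: continuous_at_imp_continuous_on differentiable_imp_continuous_within)

lemma Ck_on_SucD: "Ck_on (Suc k) S f \<Longrightarrow> Ck_on k S f"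
  by (induction k arbitrary: f) (auto intro!: continuous_at_imp_continuous_on differentiable_imp_continuous_within)

text \<open>The recursion of \<open>Ck_on\<close> asks for one directional derivative at a time, so closure properties follow
  by induction on the order once the derivative is written as a combination of maps of lower order.\<close>

lemma Ck_on_SucI:
  assumes "open V" "\<And>x. x \<in> V \<Longrightarrow> (f has_derivative f' x) (at x)" "\<And>v. Ck_on k V (\<lambda>x. f' x v)"
  shows "Ck_on (Suc k) V f"
proof -
  have "Ck_on k V (\<lambda>x. fder f x v)" for v
    by (rule Ck_on_cong[OF assms(1) _ assms(3)[of v]]) (simp add: frechet_derivative_at[OF assms(2), symmetric])
  then show ?thesis using assms(2) by (auto simp: differentiable_def)
qed

lemma Ck_on_has_derivative:
  "Ck_on (Suc k) S f \<Longrightarrow> x \<in> S \<Longrightarrow> (f has_derivative fder f x) (at x)"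
  by (auto simp: frechet_derivative_works)

lemma Ck_on_local:
  assumes "\<And>x. x \<in> V \<Longrightarrow> \<exists>U. open U \<and> x \<in> U \<and> Ck_on k (U \<inter> V) f" "open V"
  shows "Ck_on k V f"
  using assms(1)
proof (induction k arbitrary: f)
  case 0
  have "continuous (at x) f" if x: "x \<in> V" for x
  proof -
    obtain U where U: "open U" "x \<in> U" "continuous_on (U \<inter> V) f" using 0[OF x] by auto
    then show ?thesis using assms(2) x by (metis IntI continuous_on_eq_continuous_at open_Int)
  qed
  then show ?case by (simp add: continuous_at_imp_continuous_on)
next
  case (Suc k)
  have "f differentiable at x" if "x \<in> V" for x using Suc.prems[OF that] that by auto
  moreover have "Ck_on k V (\<lambda>x. fder f x v)" for v
    by (rule Suc.IH) (use Suc.prems in fastforce)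
  ultimately show ?case by simp
qed

lemma Ck_on_const: "Ck_on k S (\<lambda>x. c)"
  by (induction k arbitrary: c) (auto simp: frechet_derivative_const)

lemma Ck_on_bounded_linear: "bounded_linear f \<Longrightarrow> Ck_on k S f"
proof (induction k)
  case 0 then show ?case by (simp add: linear_continuous_on)
next
  case (Suc k)
  then have "fder f x = f" for x
    by (metis bounded_linear_imp_has_derivative frechet_derivative_at)
  then show ?case using Suc by (auto simp: Ck_on_const bounded_linear_imp_differentiable)
qed

lemma Ck_on_add:
  assumes "open V" "Ck_on k V f" "Ck_on k V g" shows "Ck_on k V (\<lambda>x. f x + g x)"
  using assms(2,3)
proof (induction k arbitrary: f g)
  case 0 then show ?case by (auto intro: continuous_on_add)
next
  case (Suc k)
  show ?case
    by (rule Ck_on_SucI[OF assms(1) has_derivative_add[OF Ck_on_has_derivative[OF Suc.prems(1)] Ck_on_has_derivative[OF Suc.prems(2)]]])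
      (use Suc in auto)
qed

lemma Ck_on_sum:
  assumes "open V" "\<And>i. i \<in> I \<Longrightarrow> Ck_on k V (f i)" shows "Ck_on k V (\<lambda>x. \<Sum>i\<in>I. f i x)"
  using assms(2)
  by (induction I rule: infinite_finite_induct) (auto intro!: Ck_on_const Ck_on_add[OF assms(1)])

lemma Ck_on_bilinear:
  assumes "bounded_bilinear prd" "open V" "Ck_on k V f" "Ck_on k V g"
  shows "Ck_on k V (\<lambda>x. prd (f x) (g x))"
  using assms(3,4)
proof (induction k arbitrary: f g)
  case 0 then show ?case by (auto intro: bounded_bilinear.continuous_on[OF assms(1)])
next
  case (Suc k)
  show ?case
    by (rule Ck_on_SucI[OF assms(2) bounded_bilinear.FDERIV[OF assms(1) Ck_on_has_derivative[OF Suc.prems(1)] Ck_on_has_derivative[OF Suc.prems(2)]]])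
      (use Suc Suc.prems[THEN Ck_on_SucD] in \<open>auto intro!: Ck_on_add assms(2)\<close>)
qed

text \<open>Expanding the outer derivative in the standard basis turns the chain rule into sums of products of a
  partial derivative composed with \<open>g\<close> and a component of a derivative of \<open>g\<close>.\<close>

lemma Ck_on_compose:
  fixes f :: "'b::euclidean_space \<Rightarrow> 'c::real_normed_vector"
  assumes "open S" "g ` S \<subseteq> T" "Ck_on k T f" "Ck_on k S g"
  shows "Ck_on k S (\<lambda>x. f (g x))"
  using assms(3,4)
proof (induction k arbitrary: f)
  case 0 then show ?case using assms(2) continuous_on_compose2 by auto
next
  case (Suc k)
  let ?g = "\<lambda>x. fder g x" and ?f = "\<lambda>x. fder f x"
  have D: "((\<lambda>x. f (g x)) has_derivative (\<lambda>v. \<Sum>b\<in>Basis. (?g x v \<bullet> b) *\<^sub>R ?f (g x) b)) (at x)"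
    if "x \<in> S" for x
  proof -
    have g: "(g has_derivative ?g x) (at x)" and f: "(f has_derivative ?f (g x)) (at (g x))"
      using that Suc.prems assms(2) by (auto simp: frechet_derivative_works)
    interpret F: bounded_linear "?f (g x)" using f by (rule has_derivative_bounded_linear)
    have *: "?f (g x) w = (\<Sum>b\<in>Basis. (w \<bullet> b) *\<^sub>R ?f (g x) b)" for w
      by (subst euclidean_representation[symmetric, of w]) (simp only: F.sum F.scale)
    show ?thesis
      by (rule has_derivative_eq_rhs[OF has_derivative_compose[OF g f]]) (rule ext, rule *)
  qed
  show ?case
  proof (rule Ck_on_SucI[OF assms(1) D])
    fix v
    have "Ck_on k S (\<lambda>x. ?f (g x) b)" for b
      by (rule Suc.IH[of "\<lambda>y. ?f y b"]) (use Suc.prems Ck_on_SucD in auto)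
    moreover have "Ck_on k S (\<lambda>x. ?g x v \<bullet> b)" for b
      by (rule Ck_on_bilinear[OF bounded_bilinear_inner assms(1)]) (use Suc.prems in \<open>auto intro: Ck_on_const\<close>)
    ultimately show "Ck_on k S (\<lambda>x. \<Sum>b\<in>Basis. (?g x v \<bullet> b) *\<^sub>R ?f (g x) b)"
      by (intro Ck_on_sum[OF assms(1)] Ck_on_bilinear[OF bounded_bilinear_scaleR assms(1)])
  qed
qed

lemma Ck_on_exp: "Ck_on k UNIV (exp :: real \<Rightarrow> real)"
proof (induction k)
  case 0 show ?case by (auto intro: continuous_intros)
next
  case (Suc k)
  show ?case
  proof (rule Ck_on_SucI)
    show "(exp has_derivative (\<lambda>v. v * exp x)) (at x)" for x :: real
      by (rule derivative_eq_intros refl | simp)+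
    show "Ck_on k UNIV (\<lambda>x::real. v * exp x)" for v :: real
      by (rule Ck_on_bilinear[OF bounded_bilinear_mult open_UNIV Ck_on_const Suc])
  qed auto
qed

lemma Ck_on_inverse: "Ck_on k (- {0}) (inverse :: real \<Rightarrow> real)"
proof (induction k)
  case 0 show ?case by (auto intro!: continuous_intros)
next
  case (Suc k)
  have o: "open (- {0::real})" by auto
  show ?case
  proof (rule Ck_on_SucI[OF o])
    show "(inverse has_derivative (\<lambda>v. (- v) * (inverse x * inverse x))) (at x)" if "x \<in> - {0}" for x :: real
      using has_derivative_inverse'[of x UNIV] that by (simp add: mult_ac)
    show "Ck_on k (- {0}) (\<lambda>x::real. (- v) * (inverse x * inverse x))" for v :: real
      by (intro Ck_on_bilinear[OF bounded_bilinear_mult o] Ck_on_const Suc)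
  qed
qed

lemma smooth_on_open:
  assumes "open V" shows "smooth_on V f \<longleftrightarrow> (\<forall>k. Ck_on k V f)"
proof
  assume L: "smooth_on V f"
  show "\<forall>k. Ck_on k V f"
  proof (intro allI Ck_on_local[OF _ assms])
    fix k x assume x: "x \<in> V"
    obtain U g where "open U" "x \<in> U" "\<forall>k. Ck_on k U g" "\<forall>y\<in>V \<inter> U. f y = g y"
      using L[unfolded smooth_on_def, THEN bspec, OF x] by auto
    then have "Ck_on k (U \<inter> V) f"
      using Ck_on_cong[of "U \<inter> V" g f k] Ck_on_subset[of k U g "U \<inter> V"] assms by auto
    then show "\<exists>U. open U \<and> x \<in> U \<and> Ck_on k (U \<inter> V) f"
      using \<open>open U\<close> \<open>x \<in> U\<close> by blast
  qed
next
  assume "\<forall>k. Ck_on k V f"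
  then show "smooth_on V f"
    unfolding smooth_on_def using assms by (intro ballI exI[of _ V] exI[of _ f]) simp
qed

lemma smooth_on_alt:
  "smooth_on S f \<longleftrightarrow> (\<forall>x\<in>S. \<exists>V g. open V \<and> x \<in> V \<and> smooth_on V g \<and> (\<forall>y\<in>S \<inter> V. f y = g y))"
  unfolding smooth_on_def[of S] by (simp add: smooth_on_open cong: conj_cong)

lemma smooth_on_cong: "smooth_on S f \<Longrightarrow> (\<And>x. x \<in> S \<Longrightarrow> f x = g x) \<Longrightarrow> smooth_on S g"
  unfolding smooth_on_def by simp

lemma smooth_onE:
  assumes "smooth_on S f" "x \<in> S"
  obtains V g where "open V" "x \<in> V" "smooth_on V g" "\<And>y. y \<in> S \<Longrightarrow> y \<in> V \<Longrightarrow> f y = g y"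
  using assms(1)[unfolded smooth_on_alt[of S], THEN bspec, OF assms(2)] that by auto

lemma smooth_onI:
  assumes "\<And>x. x \<in> S \<Longrightarrow> \<exists>V g. open V \<and> x \<in> V \<and> smooth_on V g \<and> (\<forall>y\<in>S \<inter> V. f y = g y)"
  shows "smooth_on S f"
  using assms smooth_on_alt[of S f] by simp

lemma smooth_on_subset:
  assumes "smooth_on S f" "T \<subseteq> S" shows "smooth_on T f"
proof (rule smooth_onI)
  fix x assume "x \<in> T"
  then have "x \<in> S" using assms(2) by auto
  then obtain V g where "open V" "x \<in> V" "smooth_on V g" "\<And>y. y \<in> S \<Longrightarrow> y \<in> V \<Longrightarrow> f y = g y"
    using smooth_onE[OF assms(1)] by blast
  then show "\<exists>V g. open V \<and> x \<in> V \<and> smooth_on V g \<and> (\<forall>y\<in>T \<inter> V. f y = g y)"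
    using assms(2) by (intro exI[of _ V] exI[of _ g]) auto
qed

lemma smooth_on_imp_continuous_on:
  assumes "smooth_on S f" shows "continuous_on S f"
proof (rule continuous_on_eq_continuous_within[THEN iffD2], rule)
  fix x assume x: "x \<in> S"
  obtain V g where V: "open V" "x \<in> V" "smooth_on V g" "\<And>y. y \<in> S \<Longrightarrow> y \<in> V \<Longrightarrow> f y = g y"
    using smooth_onE[OF assms x] by blast
  have "continuous_on V g" using V(1,3) smooth_on_open Ck_on_imp_continuous_on by blast
  then have g: "continuous (at x within S) g"
    using V continuous_at_imp_continuous_at_within continuous_on_eq_continuous_at by blast
  have "eventually (\<lambda>y. y \<in> V) (nhds x)" using V(1,2) by (simp add: eventually_nhds_in_open)
  then have e: "eventually (\<lambda>y. f y = g y) (at x within S)"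
    unfolding eventually_at_filter by eventually_elim (use V(4) in auto)
  show "continuous (at x within S) f"
    using g e V(2,4) x unfolding continuous_within by (metis tendsto_cong)
qed

lemma smooth_on_const[simp, intro]: "smooth_on S (\<lambda>x. c)"
  unfolding smooth_on_def by (intro ballI exI[of _ UNIV] exI[of _ "\<lambda>x. c"]) (simp add: Ck_on_const)

lemma smooth_on_bounded_linear: "bounded_linear f \<Longrightarrow> smooth_on S f"
  unfolding smooth_on_def by (intro ballI exI[of _ UNIV] exI[of _ f]) (simp add: Ck_on_bounded_linear)

section \<open>Smooth extension at a point\<close>

text \<open>The point \<open>x\<close> need not lie in \<open>W\<close>: in the application \<open>W\<close> is the interior part of a chart image and \<open>x\<close> a
  boundary point. Carrying the value \<open>l\<close> of the extension along makes each closure property also a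
  computation of boundary values.\<close>

definition extends_at :: "'b::real_normed_vector set \<Rightarrow> 'b \<Rightarrow> ('b \<Rightarrow> 'c::real_normed_vector) \<Rightarrow> 'c \<Rightarrow> bool" where
  "extends_at W x f l \<longleftrightarrow>
     (\<exists>V g. open V \<and> x \<in> V \<and> smooth_on V g \<and> (\<forall>y\<in>V \<inter> W. f y = g y) \<and> g x = l)"

lemma extends_atE:
  assumes "extends_at W x f l"
  obtains V g where "open V" "x \<in> V" "smooth_on V g" "\<And>y. y \<in> V \<Longrightarrow> y \<in> W \<Longrightarrow> f y = g y" "g x = l"
  using assms unfolding extends_at_def by auto

lemma extends_atI:
  "open V \<Longrightarrow> x \<in> V \<Longrightarrow> smooth_on V g \<Longrightarrow> (\<And>y. y \<in> V \<Longrightarrow> y \<in> W \<Longrightarrow> f y = g y) \<Longrightarrow> g x = l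
    \<Longrightarrow> extends_at W x f l"
  unfolding extends_at_def by auto

lemma extends_at_cong:
  assumes "extends_at W x f l" "\<And>y. y \<in> W \<Longrightarrow> f y = g y" shows "extends_at W x g l"
  using assms unfolding extends_at_def by fastforce

lemma extends_at_smooth:
  assumes "smooth_on S f" "x \<in> S" "W \<subseteq> S" shows "extends_at W x f (f x)"
proof -
  obtain V g where V: "open V" "x \<in> V" "smooth_on V g" "\<And>y. y \<in> S \<Longrightarrow> y \<in> V \<Longrightarrow> f y = g y"
    using smooth_onE[OF assms(1,2)] by blast
  show ?thesis by (rule extends_atI[OF V(1-3)]) (use V assms in auto)
qed

lemma extends_at_const: "extends_at W x (\<lambda>y. c) c"
  by (rule extends_at_smooth[of UNIV]) auto

lemma extends_at_linear: "bounded_linear L \<Longrightarrow> extends_at W x L (L x)"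
  by (rule extends_at_smooth[of UNIV]) (auto intro: smooth_on_bounded_linear)

lemma extends_at_add:
  assumes "extends_at W x f l" "extends_at W x g m" shows "extends_at W x (\<lambda>y. f y + g y) (l + m)"
proof -
  obtain U a where U: "open U" "x \<in> U" "smooth_on U a" "\<And>y. y \<in> U \<Longrightarrow> y \<in> W \<Longrightarrow> f y = a y" "a x = l"
    using extends_atE[OF assms(1)] by metis
  obtain V b where V: "open V" "x \<in> V" "smooth_on V b" "\<And>y. y \<in> V \<Longrightarrow> y \<in> W \<Longrightarrow> g y = b y" "b x = m"
    using extends_atE[OF assms(2)] by metis
  have "smooth_on (U \<inter> V) a" "smooth_on (U \<inter> V) b" using U V smooth_on_subset by blast+
  then have "smooth_on (U \<inter> V) (\<lambda>x. a x + b x)"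
    using U V by (simp add: smooth_on_open open_Int Ck_on_add)
  then show ?thesis by (rule extends_atI[rotated 2]) (use U V in auto)
qed

lemma extends_at_bilinear:
  assumes "bounded_bilinear prd" "extends_at W x f l" "extends_at W x g m"
  shows "extends_at W x (\<lambda>y. prd (f y) (g y)) (prd l m)"
proof -
  obtain U a where U: "open U" "x \<in> U" "smooth_on U a" "\<And>y. y \<in> U \<Longrightarrow> y \<in> W \<Longrightarrow> f y = a y" "a x = l"
    using extends_atE[OF assms(2)] by metis
  obtain V b where V: "open V" "x \<in> V" "smooth_on V b" "\<And>y. y \<in> V \<Longrightarrow> y \<in> W \<Longrightarrow> g y = b y" "b x = m"
    using extends_atE[OF assms(3)] by metis
  have "smooth_on (U \<inter> V) a" "smooth_on (U \<inter> V) b" using U V smooth_on_subset by blast+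
  then have "smooth_on (U \<inter> V) (\<lambda>x. prd (a x) (b x))"
    using U V by (simp add: smooth_on_open open_Int Ck_on_bilinear[OF assms(1)])
  then show ?thesis by (rule extends_atI[rotated 2]) (use U V in auto)
qed

lemmas extends_at_mult = extends_at_bilinear[OF bounded_bilinear_mult]

lemma extends_at_diff:
  fixes f g :: "'b::real_normed_vector \<Rightarrow> real"
  assumes "extends_at W x f l" "extends_at W x g m" shows "extends_at W x (\<lambda>y. f y - g y) (l - m)"
  using extends_at_add[OF assms(1) extends_at_mult[OF extends_at_const[of W x "-1"] assms(2)]] by simp

lemma extends_at_sum:
  "(\<And>i. i \<in> I \<Longrightarrow> extends_at W x (f i) (l i)) \<Longrightarrow> extends_at W x (\<lambda>y. \<Sum>i\<in>I. f i y) (\<Sum>i\<in>I. l i)"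
  by (induction I rule: infinite_finite_induct) (auto intro!: extends_at_add extends_at_const)

lemma extends_at_inverse:
  fixes f :: "'b::real_normed_vector \<Rightarrow> real"
  assumes "extends_at W x f l" "l \<noteq> 0" shows "extends_at W x (\<lambda>y. inverse (f y)) (inverse l)"
proof -
  obtain U a where U: "open U" "x \<in> U" "smooth_on U a" "\<And>y. y \<in> U \<Longrightarrow> y \<in> W \<Longrightarrow> f y = a y" "a x = l"
    using extends_atE[OF assms(1)] by metis
  let ?V = "a -` (- {0}) \<inter> U"
  have V: "open ?V"
    by (rule continuous_on_open_vimage[THEN iffD1, rule_format, OF U(1) smooth_on_imp_continuous_on[OF U(3)]]) auto
  have "smooth_on ?V a" using U(3) by (rule smooth_on_subset) auto
  moreover have "a ` ?V \<subseteq> - {0}" by auto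
  ultimately have s: "smooth_on ?V (\<lambda>y. inverse (a y))"
    using Ck_on_compose[OF V _ Ck_on_inverse, of a] by (simp add: smooth_on_open V)
  show ?thesis by (rule extends_atI[OF V _ s]) (use U assms(2) in auto)
qed

lemma extends_at_divide:
  fixes f :: "'b::real_normed_vector \<Rightarrow> real"
  assumes "extends_at W x f l" "extends_at W x g m" "m \<noteq> 0" shows "extends_at W x (\<lambda>y. f y / g y) (l / m)"
  using extends_at_mult[OF assms(1) extends_at_inverse[OF assms(2,3)]] by (simp add: divide_inverse)

lemma smooth_on_extends: "smooth_on S f \<Longrightarrow> x \<in> S \<Longrightarrow> extends_at S x f (f x)"
  by (rule extends_at_smooth) auto

text \<open>Smoothness on \<open>S\<close> is extendability from \<open>S\<close> at its own points, which reduces the closure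
  properties of \<open>smooth_on\<close> to those of \<open>extends_at\<close>.\<close>

lemma smooth_on_extendsI:
  assumes "\<And>x. x \<in> S \<Longrightarrow> extends_at S x f (f x)" shows "smooth_on S f"
proof (rule smooth_onI)
  fix x assume "x \<in> S"
  from assms[OF this] show "\<exists>V g. open V \<and> x \<in> V \<and> smooth_on V g \<and> (\<forall>y\<in>S \<inter> V. f y = g y)"
    unfolding extends_at_def by (elim exE) (rule exI, rule exI, auto)
qed

lemma smooth_on_bilinear:
  assumes "bounded_bilinear prd" "smooth_on S f" "smooth_on S g"
  shows "smooth_on S (\<lambda>x. prd (f x) (g x))"
  by (rule smooth_on_extendsI) (rule extends_at_bilinear[OF assms(1) smooth_on_extends[OF assms(2)] smooth_on_extends[OF assms(3)]])

lemma smooth_on_compose: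
  fixes f :: "'b::euclidean_space \<Rightarrow> 'c::real_normed_vector"
  assumes f: "smooth_on T f" and g: "smooth_on S g" and sub: "g ` S \<subseteq> T"
  shows "smooth_on S (\<lambda>x. f (g x))"
proof (rule smooth_onI)
  fix x assume x: "x \<in> S"
  obtain U a where U: "open U" "g x \<in> U" "smooth_on U a" "\<And>y. y \<in> T \<Longrightarrow> y \<in> U \<Longrightarrow> f y = a y"
    using smooth_onE[OF f, of "g x"] x sub by blast
  obtain V b where V: "open V" "x \<in> V" "smooth_on V b" "\<And>y. y \<in> S \<Longrightarrow> y \<in> V \<Longrightarrow> g y = b y"
    using smooth_onE[OF g x] by blast
  let ?W = "b -` U \<inter> V"
  have W: "open ?W"
    using V(1,3) U(1) smooth_on_imp_continuous_on continuous_on_open_vimage by blast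
  have "smooth_on ?W b" using V(3) by (rule smooth_on_subset) auto
  then have "smooth_on ?W (\<lambda>x. a (b x))"
    using U(3) by (simp add: smooth_on_open W U(1)) (blast intro: Ck_on_compose[OF W])
  then show "\<exists>V h. open V \<and> x \<in> V \<and> smooth_on V h \<and> (\<forall>y\<in>S \<inter> V. f (g y) = h y)"
    using W V U x sub by (intro exI[of _ ?W] exI[of _ "\<lambda>x. a (b x)"]) (auto simp: image_subset_iff)
qed

lemma smooth_on_linear_compose:
  assumes L: "bounded_linear L" and f: "smooth_on S f" shows "smooth_on S (\<lambda>x. L (f x))"
proof -
  have "bounded_bilinear (\<lambda>(r::real) y. r *\<^sub>R L y)"
    using bounded_bilinear.comp[OF bounded_bilinear_scaleR bounded_linear_ident L] by simp
  from smooth_on_bilinear[OF this smooth_on_const[of S 1] f] show ?thesis by simp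
qed

lemmas smooth_on_scaleR = smooth_on_bilinear[OF bounded_bilinear_scaleR]
lemmas smooth_on_mult = smooth_on_bilinear[OF bounded_bilinear_mult]
lemmas smooth_on_inner = smooth_on_bilinear[OF bounded_bilinear_inner]
lemmas smooth_on_vec_nth = smooth_on_linear_compose[OF bounded_linear_vec_nth]
lemmas smooth_on_minus = smooth_on_linear_compose[OF bounded_linear_minus[OF bounded_linear_ident]]

lemma smooth_on_add:
  assumes "smooth_on S f" "smooth_on S g" shows "smooth_on S (\<lambda>x. f x + g x)"
  by (rule smooth_on_extendsI) (rule extends_at_add[OF smooth_on_extends[OF assms(1)] smooth_on_extends[OF assms(2)]])

lemma smooth_on_diff:
  assumes "smooth_on S f" "smooth_on S g" shows "smooth_on S (\<lambda>x. f x - g x)"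
  using smooth_on_add[OF assms(1) smooth_on_minus[OF assms(2)]] by simp

lemma smooth_on_sum:
  "(\<And>i. i \<in> I \<Longrightarrow> smooth_on S (f i)) \<Longrightarrow> smooth_on S (\<lambda>x. \<Sum>i\<in>I. f i x)"
  by (induction I rule: infinite_finite_induct) (auto intro!: smooth_on_add)

lemma smooth_on_divide:
  fixes f :: "'b::real_normed_vector \<Rightarrow> real"
  assumes "smooth_on S f" "smooth_on S g" "\<And>x. x \<in> S \<Longrightarrow> g x \<noteq> 0" shows "smooth_on S (\<lambda>x. f x / g x)"
  by (rule smooth_on_extendsI) (rule extends_at_divide[OF smooth_on_extends[OF assms(1)] smooth_on_extends[OF assms(2)] assms(3)])

lemma smooth_on_exp:
  fixes f :: "'b::real_normed_vector \<Rightarrow> real"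
  assumes "smooth_on S f" shows "smooth_on S (\<lambda>x. exp (f x))"
  by (rule smooth_on_compose[where T = UNIV, OF _ assms]) (auto simp: smooth_on_open Ck_on_exp)

lemma smooth_on_has_derivative:
  assumes "open V" "smooth_on V f" "x \<in> V"
  shows "(f has_derivative fder f x) (at x)"
  using assms Ck_on_has_derivative[of 0 V f x] smooth_on_open[of V f] by blast

lemma smooth_on_derivative:
  assumes "open V" "smooth_on V f" shows "smooth_on V (\<lambda>x. fder f x v)"
  unfolding smooth_on_open[OF assms(1)]
proof
  fix k show "Ck_on k V (\<lambda>x. fder f x v)"
    using assms smooth_on_open[OF assms(1), of f] Ck_on.simps(2)[of k V f] by blast
qed

section \<open>The derivative of the determinant\<close>

text \<open>Differentiating the Leibniz formula at the identity leaves only the identity permutation, since every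
  other permutation moves at least two indices and so keeps a vanishing off-diagonal factor.\<close>

lemma has_derivative_det_at_identity:
  fixes M :: "'b::real_normed_vector \<Rightarrow> real ^ 'k ^ 'k::finite"
  assumes M: "(M has_derivative M') (at x within S)" and 1: "M x = mat 1"
  shows "((\<lambda>y. det (M y)) has_derivative (\<lambda>v. trace (M' v))) (at x within S)"
proof -
  let ?P = "{p. p permutes (UNIV :: 'k set)}"
  have c: "((\<lambda>y. M y $ i $ j) has_derivative (\<lambda>v. M' v $ i $ j)) (at x within S)" for i j
    using has_derivative_compose[OF M, of "\<lambda>m. m $ i $ j"] bounded_linear_imp_has_derivative
      bounded_linear_compose[OF bounded_linear_vec_nth bounded_linear_vec_nth]
    by (auto intro!: bounded_linear.has_derivative[OF bounded_linear_vec_nth] M)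
  have "((\<lambda>y. \<Sum>p\<in>?P. of_int (sign p) * (\<Prod>i\<in>UNIV. M y $ i $ p i)) has_derivative
      (\<lambda>v. \<Sum>p\<in>?P. of_int (sign p) * (\<Sum>i\<in>UNIV. M' v $ i $ p i * (\<Prod>j\<in>UNIV - {i}. M x $ j $ p j))))
     (at x within S)"
    by (intro has_derivative_sum has_derivative_mult_right has_derivative_prod c)
  moreover have "(\<Sum>p\<in>?P. of_int (sign p) * (\<Sum>i\<in>UNIV. M' v $ i $ p i * (\<Prod>j\<in>UNIV - {i}. M x $ j $ p j)))
      = trace (M' v)" (is "?L = _") for v
  proof -
    have z: "(\<Prod>j\<in>UNIV - {i}. M x $ j $ p j) = 0" if p: "p \<in> ?P" "p \<noteq> id" for p i
    proof -
      have "\<exists>j. j \<noteq> i \<and> p j \<noteq> j"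
      proof (rule ccontr)
        assume "\<not> ?thesis"
        then have *: "\<And>j. j \<noteq> i \<Longrightarrow> p j = j" by blast
        have "inj p" using p permutes_inj by auto
        then have "p i = i" using * by (metis injD)
        then show False using * p(2) by (metis eq_id_iff)
      qed
      then show ?thesis by (force simp: 1 mat_def prod_zero_iff)
    qed
    have "?L = (\<Sum>p\<in>?P. if p = id then trace (M' v) else 0)"
    proof (intro sum.cong refl)
      fix p assume p: "p \<in> ?P"
      show "of_int (sign p) * (\<Sum>i\<in>UNIV. M' v $ i $ p i * (\<Prod>j\<in>UNIV - {i}. M x $ j $ p j))
          = (if p = id then trace (M' v) else 0)"
      proof (cases "p = id")
        case True then show ?thesis by (simp add: trace_def 1 mat_def)
      next
        case False then show ?thesis by (simp add: z[OF p False])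
      qed
    qed
    also have "\<dots> = trace (M' v)" by (simp add: permutes_id)
    finally show ?thesis .
  qed
  ultimately show ?thesis unfolding det_def by simp
qed

lemma has_derivative_det:
  fixes M :: "'b::real_normed_vector \<Rightarrow> real ^ 'k ^ 'k::finite"
  assumes M: "(M has_derivative M') (at x within S)" and inv: "N ** M x = mat 1"
  shows "((\<lambda>y. det (M y)) has_derivative (\<lambda>v. det (M x) * trace (N ** M' v))) (at x within S)"
proof -
  have 1: "det (M x) * det N = 1" using inv by (metis det_I det_mul mult.commute)
  have bl: "bounded_linear (\<lambda>m. N ** m)"
    by (rule linear_conv_bounded_linear[THEN iffD1])
      (simp add: linear_iff matrix_add_ldistrib vec_eq_iff matrix_matrix_mult_def sum_distrib_left algebra_simps sum.distrib)
  have "((\<lambda>y. det (N ** M y)) has_derivative (\<lambda>v. trace (N ** M' v))) (at x within S)"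
    by (rule has_derivative_det_at_identity[OF bounded_linear.has_derivative[OF bl M] inv])
  from has_derivative_mult_right[OF this, of "det (M x)"]
  show ?thesis using 1 by (simp add: det_mul mult.assoc[symmetric])
qed

section \<open>Integrals along lines and symmetry of second derivatives\<close>

text \<open>For a unit vector \<open>e\<close> the point \<open>L s x\<close> moves from \<open>x\<close> to the hyperplane at height \<open>\<epsilon>\<close>. Its derivative in direction \<open>v\<close> is
  \<open>v - s (v \<bullet> e) e\<close>, so differentiating under the integral gives two integrals of the same kind, one of
  them with the power of \<open>s\<close> raised by one. This is why the weight \<open>s ^ m\<close> is part of the induction.\<close>

lemma Ck_on_integral_along_line:
  fixes G :: "'b::euclidean_space \<Rightarrow> real" and e :: 'b and \<epsilon> :: real
  defines "L \<equiv> \<lambda>s x. x + (s * (\<epsilon> - x \<bullet> e)) *\<^sub>R e"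
  assumes V: "open V" and L: "\<And>s x. x \<in> V \<Longrightarrow> s \<in> {0..1} \<Longrightarrow> L s x \<in> V"
    and G: "Ck_on k V G"
  shows "Ck_on k V (\<lambda>x. integral {0..1} (\<lambda>s. s ^ m * G (L s x)))"
  using G
proof (induction k arbitrary: G m)
  have cont: "continuous_on (V \<times> cbox 0 1) (\<lambda>(x, s). s ^ m * H (L s x))"
    if "continuous_on V H" for H :: "'b \<Rightarrow> real" and m
  proof -
    have "continuous_on (V \<times> cbox 0 1) (\<lambda>p. H (L (snd p) (fst p)))"
      by (rule continuous_on_compose2[OF that]) (auto simp: L_def intro!: continuous_intros L[unfolded L_def])
    then show ?thesis unfolding case_prod_unfold by (intro continuous_intros)
  qed
  { case 0
    then show ?case
      using integral_continuous_on_param[OF cont[of G m]] by simp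
  next
    case (Suc k)
    let ?D = "\<lambda>x. fder G x"
    define F where "F x s = Blinfun (\<lambda>v. s ^ m * ?D (L s x) (v + (s * (- (v \<bullet> e))) *\<^sub>R e))" for x s
    have D: "(G has_derivative ?D y) (at y)" if "y \<in> V" for y
      using Ck_on_has_derivative[OF Suc.prems that] .
    have bl: "bounded_linear (?D y)" if "y \<in> V" for y by (rule has_derivative_bounded_linear[OF D[OF that]])
    have blL: "bounded_linear (\<lambda>v. v + (s * (- (v \<bullet> e))) *\<^sub>R e)" for s
      by (intro bounded_linear_add bounded_linear_ident bounded_linear_scaleR_const
          bounded_linear_const_mult bounded_linear_minus bounded_linear_inner_left)
    have F: "blinfun_apply (F x s) = (\<lambda>v. s ^ m * ?D (L s x) (v + (s * (- (v \<bullet> e))) *\<^sub>R e))"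
      if "x \<in> V" "s \<in> {0..1}" for x s
      unfolding F_def
      by (intro bounded_linear_Blinfun_apply bounded_linear_const_mult
          bounded_linear_compose[OF bl[OF L[OF that]] blL])
    have F': "blinfun_apply (F x s) v = s ^ m * ?D (L s x) v - (v \<bullet> e) * (s ^ Suc m * ?D (L s x) e)"
      if "x \<in> V" "s \<in> {0..1}" for x s v
    proof -
      interpret bounded_linear "?D (L s x)" by (rule bl[OF L[OF that]])
      show ?thesis by (simp add: F[OF that] add scaleR diff neg algebra_simps)
    qed
    have cD: "continuous_on V (\<lambda>y. ?D y v)" for v
      by (rule Ck_on_imp_continuous_on[where k = k]) (use Suc.prems in simp)
    have cF: "continuous_on (V \<times> cbox 0 1) (\<lambda>(x, s). F x s)"
    proof (rule continuous_on_blinfun_componentwise)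
      fix i :: 'b
      have "continuous_on (V \<times> cbox 0 1) (\<lambda>p. (\<lambda>(x, s). s ^ m * ?D (L s x) i) p
          - (i \<bullet> e) * (\<lambda>(x, s). s ^ Suc m * ?D (L s x) e) p)"
        by (intro continuous_intros cont cD)
      then show "continuous_on (V \<times> cbox 0 1) (\<lambda>p. blinfun_apply (case p of (x, s) \<Rightarrow> F x s) i)"
        by (rule continuous_on_cong[THEN iffD1, rotated -1]) (auto simp: F')
    qed
    have cont1: "continuous_on {0..1} (\<lambda>s. s ^ m * H (L s x))"
      if "continuous_on V H" "x \<in> V" for H :: "'b \<Rightarrow> real" and m x
    proof -
      have "continuous_on {0..1} (\<lambda>s. (\<lambda>(x, s). s ^ m * H (L s x)) (x, s))"
        by (rule continuous_on_compose2[OF cont[OF that(1)]]) (use that(2) in \<open>auto intro!: continuous_intros\<close>)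
      then show ?thesis by simp
    qed
    have cG: "continuous_on V G" using Suc.prems by (rule Ck_on_imp_continuous_on)
    have der: "((\<lambda>x. integral {0..1} (\<lambda>s. s ^ m * G (L s x))) has_derivative
       (\<lambda>v. integral {0..1} (\<lambda>s. s ^ m * ?D (L s x) v) - (v \<bullet> e) * integral {0..1} (\<lambda>s. s ^ Suc m * ?D (L s x) e))) (at x)"
      if x: "x \<in> V" for x
    proof -
      obtain r where r: "0 < r" "ball x r \<subseteq> V" using V x openE by blast
      have "((\<lambda>x. integral (cbox 0 1) (\<lambda>s. s ^ m * G (L s x))) has_derivative integral (cbox 0 1) (F x)) (at x within ball x r)"
      proof (rule leibniz_rule)
        fix y s assume "y \<in> ball x r" and s: "s \<in> cbox 0 (1::real)"
        then have y: "y \<in> V" using r by auto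
        have "(L s has_derivative (\<lambda>v. v + (s * (- (v \<bullet> e))) *\<^sub>R e)) (at y)"
          unfolding L_def by (auto intro!: derivative_eq_intros)
        from has_derivative_mult_right[OF has_derivative_compose[OF this D[OF L[OF y]]], of "s ^ m"]
        show "((\<lambda>y. s ^ m * G (L s y)) has_derivative blinfun_apply (F y s)) (at y within ball x r)"
          using s y by (simp add: F has_derivative_at_withinI)
      next
        show "(\<lambda>s. s ^ m * G (L s y)) integrable_on cbox 0 1" if "y \<in> ball x r" for y
          using r that by (intro integrable_continuous) (auto intro!: cont1 cG)
        show "continuous_on (ball x r \<times> cbox 0 1) (\<lambda>(x, s). F x s)"
          using cF by (rule continuous_on_subset) (use r in auto)
      qed (use r in auto)
      then have 1: "((\<lambda>x. integral {0..1} (\<lambda>s. s ^ m * G (L s x))) has_derivative integral {0..1} (F x)) (at x)"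
        using r by (simp add: at_within_ball)
      have "continuous_on {0..1} (\<lambda>s. (\<lambda>(x, s). F x s) (x, s))"
        by (rule continuous_on_compose2[OF cF]) (use x in \<open>auto intro!: continuous_intros\<close>)
      then have "F x integrable_on cbox 0 1" by (intro integrable_continuous) simp
      then have "integral {0..1} (F x) v = integral {0..1} (\<lambda>s. F x s v)" for v
        by (simp add: blinfun_apply_integral)
      moreover have "integral {0..1} (\<lambda>s. F x s v)
         = integral {0..1} (\<lambda>s. s ^ m * ?D (L s x) v - (v \<bullet> e) * (s ^ Suc m * ?D (L s x) e))" for v
        by (rule integral_cong) (rule F'[OF x])
      moreover have "integral {0..1} (\<lambda>s. s ^ m * ?D (L s x) v - (v \<bullet> e) * (s ^ Suc m * ?D (L s x) e))
         = integral {0..1} (\<lambda>s. s ^ m * ?D (L s x) v) - (v \<bullet> e) * integral {0..1} (\<lambda>s. s ^ Suc m * ?D (L s x) e)" for v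
        by (subst integral_diff)
          (auto intro!: integrable_continuous_interval continuous_on_mult_left cont1[OF cD x] simp del: power_Suc)
      ultimately have "blinfun_apply (integral {0..1} (F x)) = (\<lambda>v. integral {0..1} (\<lambda>s. s ^ m * ?D (L s x) v)
          - (v \<bullet> e) * integral {0..1} (\<lambda>s. s ^ Suc m * ?D (L s x) e))"
        by presburger
      then show ?thesis by (rule has_derivative_eq_rhs[OF 1])
    qed
    have k: "Ck_on k V (\<lambda>y. ?D y v)" for v using Suc.prems by simp
    have kc: "Ck_on k V (\<lambda>x. integral {0..1} (\<lambda>s. s ^ m * ?D (L s x) v)
          + (- (v \<bullet> e)) * integral {0..1} (\<lambda>s. s ^ Suc m * ?D (L s x) e))" for v
      by (intro Ck_on_add[OF V] Ck_on_bilinear[OF bounded_bilinear_mult V] Ck_on_const Suc.IH k)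
    show ?case
    proof (rule Ck_on_SucI[OF V der])
      show "Ck_on k V (\<lambda>x. integral {0..1} (\<lambda>s. s ^ m * ?D (L s x) v)
          - (v \<bullet> e) * integral {0..1} (\<lambda>s. s ^ Suc m * ?D (L s x) e))" for v
        using kc[of v] by (simp del: power_Suc)
    qed
  }
qed

lemma smooth_on_integral_along_line:
  fixes G :: "'b::euclidean_space \<Rightarrow> real" and e :: 'b and \<epsilon> :: real
  assumes "open V" "\<And>s x. x \<in> V \<Longrightarrow> s \<in> {0..1} \<Longrightarrow> x + (s * (\<epsilon> - x \<bullet> e)) *\<^sub>R e \<in> V" "smooth_on V G"
  shows "smooth_on V (\<lambda>x. integral {0..1} (\<lambda>s. G (x + (s * (\<epsilon> - x \<bullet> e)) *\<^sub>R e)))"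
proof -
  have "Ck_on k V (\<lambda>x. integral {0..1} (\<lambda>s. s ^ 0 * G (x + (s * (\<epsilon> - x \<bullet> e)) *\<^sub>R e)))" for k
    by (rule Ck_on_integral_along_line[OF assms(1,2)]) (use assms(3) smooth_on_open[OF assms(1), of G] in auto)
  then show ?thesis using assms(1) smooth_on_open by auto
qed

text \<open>Two applications of the mean value theorem. The left hand side is symmetric in \<open>u\<close> and \<open>v\<close>; shrinking
  \<open>h\<close> yields the symmetry of the second derivative.\<close>

lemma second_difference_mean_value:
  fixes f :: "'b::euclidean_space \<Rightarrow> real"
  assumes V: "smooth_on V f" "open V" and h: "0 < h" and sub: "ball x r \<subseteq> V" and r: "h * (norm u + norm v) < r"
  shows "\<exists>y\<in>cball x (h * (norm u + norm v)).
     f (x + h *\<^sub>R u + h *\<^sub>R v) - f (x + h *\<^sub>R u) - f (x + h *\<^sub>R v) + f x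
     = h\<^sup>2 * fder (\<lambda>z. fder f z u) y v"
proof -
  let ?D = "\<lambda>z. fder f z"
  have inb: "dist x (x + s *\<^sub>R u + t *\<^sub>R v) \<le> h * (norm u + norm v)"
    if "0 \<le> s" "s \<le> h" "0 \<le> t" "t \<le> h" for s t
  proof -
    have "dist x (x + s *\<^sub>R u + t *\<^sub>R v) \<le> norm (s *\<^sub>R u) + norm (t *\<^sub>R v)"
      by (subst dist_commute) (simp add: dist_norm add.assoc norm_triangle_ineq del: norm_scaleR)
    also have "\<dots> \<le> h * norm u + h * norm v" using that by (auto intro!: add_mono mult_right_mono)
    finally show ?thesis by (simp add: algebra_simps)
  qed
  have inV: "x + s *\<^sub>R u + t *\<^sub>R v \<in> V" if "0 \<le> s" "s \<le> h" "0 \<le> t" "t \<le> h" for s t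
    using inb[OF that] r sub by auto
  have d: "((\<lambda>s. F (x + s *\<^sub>R u + t *\<^sub>R v)) has_derivative (\<lambda>a. a * fder F (x + s *\<^sub>R u + t *\<^sub>R v) u)) (at s within X)"
     "((\<lambda>t. F (x + s *\<^sub>R u + t *\<^sub>R v)) has_derivative (\<lambda>a. a * fder F (x + s *\<^sub>R u + t *\<^sub>R v) v)) (at t within X)"
    if F: "smooth_on V F" and st: "0 \<le> s" "s \<le> h" "0 \<le> t" "t \<le> h" for F :: "'b \<Rightarrow> real" and s t X
  proof -
    note D = smooth_on_has_derivative[OF V(2) F inV[OF st]]
    interpret bounded_linear "fder F (x + s *\<^sub>R u + t *\<^sub>R v)"
      using D by (rule has_derivative_bounded_linear)
    have 1: "((\<lambda>s. x + s *\<^sub>R u + t *\<^sub>R v) has_derivative (\<lambda>a. a *\<^sub>R u)) (at s within X)"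
      by (auto intro!: derivative_eq_intros)
    have 2: "((\<lambda>t. x + s *\<^sub>R u + t *\<^sub>R v) has_derivative (\<lambda>a. a *\<^sub>R v)) (at t within X)"
      by (auto intro!: derivative_eq_intros)
    show "((\<lambda>s. F (x + s *\<^sub>R u + t *\<^sub>R v)) has_derivative (\<lambda>a. a * fder F (x + s *\<^sub>R u + t *\<^sub>R v) u)) (at s within X)"
      using has_derivative_compose[OF 1 D] by (simp add: scaleR)
    show "((\<lambda>t. F (x + s *\<^sub>R u + t *\<^sub>R v)) has_derivative (\<lambda>a. a * fder F (x + s *\<^sub>R u + t *\<^sub>R v) v)) (at t within X)"
      using has_derivative_compose[OF 2 D] by (simp add: scaleR)
  qed
  have "\<exists>s\<in>{0<..<h}. (f (x + h *\<^sub>R u + h *\<^sub>R v) - f (x + h *\<^sub>R u + 0 *\<^sub>R v)) - (f (x + 0 *\<^sub>R u + h *\<^sub>R v) - f (x + 0 *\<^sub>R u + 0 *\<^sub>R v))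
     = (h - 0) * ?D (x + s *\<^sub>R u + h *\<^sub>R v) u - (h - 0) * ?D (x + s *\<^sub>R u + 0 *\<^sub>R v) u"
    by (rule mvt_simple[OF h, of "\<lambda>s. f (x + s *\<^sub>R u + h *\<^sub>R v) - f (x + s *\<^sub>R u + 0 *\<^sub>R v)"])
      (use h in \<open>intro has_derivative_diff d V(1); simp\<close>)
  then obtain s where s: "0 < s" "s < h" and 1: "f (x + h *\<^sub>R u + h *\<^sub>R v) - f (x + h *\<^sub>R u) - f (x + h *\<^sub>R v) + f x
     = h * (?D (x + s *\<^sub>R u + h *\<^sub>R v) u - ?D (x + s *\<^sub>R u + 0 *\<^sub>R v) u)"
    by (auto simp: algebra_simps)
  have "\<exists>t\<in>{0<..<h}. ?D (x + s *\<^sub>R u + h *\<^sub>R v) u - ?D (x + s *\<^sub>R u + 0 *\<^sub>R v) u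
     = (h - 0) * fder (\<lambda>z. ?D z u) (x + s *\<^sub>R u + t *\<^sub>R v) v"
    by (rule mvt_simple[OF h, of "\<lambda>t. ?D (x + s *\<^sub>R u + t *\<^sub>R v) u"])
      (use s in \<open>intro d smooth_on_derivative V; simp\<close>)
  then obtain t where t: "0 < t" "t < h" and 2: "?D (x + s *\<^sub>R u + h *\<^sub>R v) u - ?D (x + s *\<^sub>R u + 0 *\<^sub>R v) u
     = h * fder (\<lambda>z. ?D z u) (x + s *\<^sub>R u + t *\<^sub>R v) v"
    by auto
  show ?thesis
    using 1 inb[of s t] s t by (intro bexI[of _ "x + s *\<^sub>R u + t *\<^sub>R v"]) (use 2 in \<open>auto simp: power2_eq_square\<close>)
qed

lemma second_derivative_symmetric:
  fixes f :: "'b::euclidean_space \<Rightarrow> real"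
  assumes V: "smooth_on V f" "open V" "x \<in> V"
  shows "fder (\<lambda>z. fder f z u) x v
       = fder (\<lambda>z. fder f z v) x u"
proof -
  define F G where "F y = fder (\<lambda>z. fder f z u) y v"
    and "G y = fder (\<lambda>z. fder f z v) y u" for y
  have "continuous_on V F" "continuous_on V G"
    unfolding F_def G_def by (intro smooth_on_imp_continuous_on smooth_on_derivative V)+
  then have c: "isCont F x" "isCont G x" using V continuous_on_eq_continuous_at by blast+
  have "\<bar>F x - G x\<bar> \<le> 0 + e" if e: "0 < e" for e
  proof -
    obtain d1 where d1: "0 < d1" "\<And>y. dist y x < d1 \<Longrightarrow> dist (F y) (F x) < e/2"
      using c(1) e unfolding continuous_at_eps_delta by (metis half_gt_zero)
    obtain d2 where d2: "0 < d2" "\<And>y. dist y x < d2 \<Longrightarrow> dist (G y) (G x) < e/2"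
      using c(2) e unfolding continuous_at_eps_delta by (metis half_gt_zero)
    obtain r where r: "0 < r" "ball x r \<subseteq> V" using V openE by blast
    \<comment> \<open>The scale \<open>h\<close> keeps both mean value points within distance \<open>m\<close> of \<open>x\<close>.\<close>
    define m where "m = min r (min d1 d2)"
    define h where "h = m / (2 * (norm u + norm v + 1))"
    have m: "0 < m" using d1 d2 r by (simp add: m_def)
    have n: "0 < norm u + norm v + 1" by (smt (verit) norm_ge_zero)
    have h: "0 < h" using m n by (simp add: h_def)
    have "h * (norm u + norm v) \<le> h * (norm u + norm v + 1)" using h by (simp add: algebra_simps)
    also have "\<dots> = m / 2" using n by (simp add: h_def field_simps)
    also have "\<dots> < m" using m by simp
    finally have hm: "h * (norm u + norm v) < m" .
    obtain y where y: "y \<in> cball x (h * (norm u + norm v))" "f (x + h *\<^sub>R u + h *\<^sub>R v) - f (x + h *\<^sub>R u) - f (x + h *\<^sub>R v) + f x = h\<^sup>2 * F y"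
      using second_difference_mean_value[OF V(1,2) h r(2), of u v] hm unfolding F_def m_def by auto
    obtain z where z: "z \<in> cball x (h * (norm v + norm u))" "f (x + h *\<^sub>R v + h *\<^sub>R u) - f (x + h *\<^sub>R v) - f (x + h *\<^sub>R u) + f x = h\<^sup>2 * G z"
      using second_difference_mean_value[OF V(1,2) h r(2), of v u] hm unfolding G_def m_def by (auto simp: add.commute)
    have "f (x + h *\<^sub>R v + h *\<^sub>R u) = f (x + h *\<^sub>R u + h *\<^sub>R v)" by (simp add: algebra_simps)
    then have "h\<^sup>2 * F y = h\<^sup>2 * G z" using y(2) z(2) by linarith
    then have "F y = G z" using h by simp
    moreover have "dist (F y) (F x) < e/2" using d1(2)[of y] y(1) hm by (simp add: m_def dist_commute)
    moreover have "dist (G z) (G x) < e/2" using d2(2)[of z] z(1) hm by (simp add: m_def dist_commute add.commute)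
    ultimately show ?thesis unfolding dist_real_def by linarith
  qed
  then have "\<bar>F x - G x\<bar> \<le> 0" by (rule field_le_epsilon)
  then show ?thesis by (simp add: F_def G_def)
qed

section \<open>Derivatives on a half space\<close>

abbreviation hopen :: "'n::finite coords set \<Rightarrow> bool" where
  "hopen S \<equiv> openin (top_of_set half_space) S"

abbreviation hderiv :: "('n::finite coords \<Rightarrow> 'b::real_normed_vector) \<Rightarrow> 'n coords \<Rightarrow> 'n coords \<Rightarrow> 'b" where
  "hderiv f x \<equiv> frechet_derivative f (at x within half_space)"

lemma hopen_subset: "hopen S \<Longrightarrow> x \<in> S \<Longrightarrow> x \<in> half_space"
  using openin_subset by fastforce

text \<open>Relatively open subsets of the half space all have the same filter at a common point, so that all
  derivatives relative to chart images can be taken relative to the half space.\<close>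

lemma at_within_hopen:
  assumes "hopen S" "x \<in> S" shows "at x within S = at x within half_space"
proof -
  obtain T where "open T" "S = half_space \<inter> T" using assms(1) openin_open by blast
  then show ?thesis using assms(2) by (intro at_within_nhd[of x T]) auto
qed

lemma at_within_half_space_interior:
  fixes x :: "'n::finite coords"
  assumes "0 < x $ None" shows "at x within half_space = at x"
proof -
  have o: "open {y::'n coords. 0 < y $ None}"
    by (intro open_Collect_less continuous_intros)
  show ?thesis by (rule at_within_nhd[OF _ o]) (use assms in \<open>auto simp: half_space_def\<close>)
qed

text \<open>From every point of the half space one can move a little in each positive coordinate direction, which
  is enough to determine the derivative also at the boundary.\<close>

lemma half_space_derivative_unique:
  fixes x :: "'n::finite coords"
  assumes "(f has_derivative f') (at x within half_space)" "(f has_derivative f'') (at x within half_space)"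
    "x \<in> half_space"
  shows "f' = f''"
proof (rule frechet_derivative_unique_within[OF assms(1,2)])
  fix i :: "'n coords" and e :: real
  assume i: "i \<in> Basis" and e: "0 < e"
  have "0 \<le> i $ None" using i by (auto simp: Basis_vec_def axis_def)
  then show "\<exists>d. 0 < \<bar>d\<bar> \<and> \<bar>d\<bar> < e \<and> x + d *\<^sub>R i \<in> half_space"
    using e assms(3) by (intro exI[of _ "e / 2"]) (auto simp: half_space_def)
qed

lemma hderiv_eqI:
  assumes "(f has_derivative f') (at x within half_space)" "x \<in> half_space"
  shows "hderiv f x = f'"
proof -
  have "f differentiable (at x within half_space)" using assms(1) by (auto simp: differentiable_def)
  then have "(f has_derivative hderiv f x) (at x within half_space)" by (simp add: frechet_derivative_works)
  then show ?thesis by (rule half_space_derivative_unique[OF _ assms])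
qed

lemma hderiv_local:
  assumes "hopen S" "x \<in> S" "\<And>y. y \<in> S \<Longrightarrow> f y = g y"
    "(g has_derivative g') (at x within half_space)"
  shows "(f has_derivative g') (at x within half_space)" "hderiv f x = g'"
proof -
  have "(f has_derivative g') (at x within S)"
    by (rule has_derivative_transform[OF assms(2,3)]) (simp_all add: at_within_hopen[OF assms(1,2)] assms(4))
  then show D: "(f has_derivative g') (at x within half_space)"
    by (simp add: at_within_hopen[OF assms(1,2)])
  show "hderiv f x = g'" by (rule hderiv_eqI[OF D hopen_subset[OF assms(1,2)]])
qed

lemma smooth_on_local_hderiv:
  assumes "hopen S" "open V" "smooth_on V g" "\<And>y. y \<in> S \<Longrightarrow> y \<in> V \<Longrightarrow> f y = g y" "x \<in> S" "x \<in> V"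
  shows "(f has_derivative fder g x) (at x within half_space)"
    "hderiv f x = fder g x"
proof -
  have "hopen (S \<inter> V)" using assms by (simp add: openin_Int_open)
  note * = hderiv_local[OF this _ _ has_derivative_at_withinI[OF smooth_on_has_derivative[OF assms(2,3,6)]]]
  show "(f has_derivative fder g x) (at x within half_space)"
    by (rule *(1)) (use assms in auto)
  show "hderiv f x = fder g x"
    by (rule *(2)) (use assms in auto)
qed

lemma smooth_on_hderiv:
  assumes "hopen S" "smooth_on S f" "x \<in> S"
  shows "(f has_derivative hderiv f x) (at x within half_space)"
proof -
  obtain V g where V: "open V" "x \<in> V" "smooth_on V g" "\<And>y. y \<in> S \<Longrightarrow> y \<in> V \<Longrightarrow> f y = g y"
    using smooth_onE[OF assms(2,3)] by blast
  from smooth_on_local_hderiv[OF assms(1) V(1,3,4) assms(3) V(2)] show ?thesis by simp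
qed

lemma smooth_on_hderiv_smooth:
  assumes "hopen S" "smooth_on S f" shows "smooth_on S (\<lambda>x. hderiv f x v)"
proof (rule smooth_onI)
  fix x assume x: "x \<in> S"
  obtain V g where V: "open V" "x \<in> V" "smooth_on V g" "\<And>y. y \<in> S \<Longrightarrow> y \<in> V \<Longrightarrow> f y = g y"
    using smooth_onE[OF assms(2) x] by blast
  have "\<forall>y\<in>S \<inter> V. hderiv f y v = fder g y v"
    using smooth_on_local_hderiv(2)[OF assms(1) V(1,3,4)] by simp
  then show "\<exists>V h. open V \<and> x \<in> V \<and> smooth_on V h \<and> (\<forall>y\<in>S \<inter> V. hderiv f y v = h y)"
    using V smooth_on_derivative[OF V(1,3)]
    by (intro exI[of _ V] exI[of _ "\<lambda>y. fder g y v"]) simp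
qed

lemma hderiv_chain:
  assumes "hopen S" "x \<in> S" "f ` S \<subseteq> T" "T \<subseteq> half_space"
    "(f has_derivative f') (at x within half_space)"
    "(g has_derivative g') (at (f x) within half_space)"
  shows "((\<lambda>y. g (f y)) has_derivative (\<lambda>v. g' (f' v))) (at x within half_space)"
proof -
  have "(g has_derivative g') (at (f x) within f ` S)"
    by (rule has_derivative_subset[OF assms(6)]) (use assms in auto)
  then have "((\<lambda>y. g (f y)) has_derivative (\<lambda>v. g' (f' v))) (at x within S)"
    using has_derivative_in_compose[of f f' x S g g'] assms(5) at_within_hopen[OF assms(1,2)] by simp
  then show ?thesis using at_within_hopen[OF assms(1,2)] by simp
qed

section \<open>Charts, tangent frames and the boundary\<close>

locale mfd =
  fixes A :: "('a::{t2_space, second_countable_topology}, 'n::finite) chart set"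
  assumes mfd: "smooth_manifold_with_boundary A"
begin

lemma is_chart: "c \<in> A \<Longrightarrow> is_chart c"
  using mfd by (auto simp: smooth_manifold_with_boundary_def)

lemma open_cdom: "c \<in> A \<Longrightarrow> open (cdom c)"
  using is_chart by (auto simp: is_chart_def)

lemma cinv_cmap [simp]: "c \<in> A \<Longrightarrow> p \<in> cdom c \<Longrightarrow> cinv c (cmap c p) = p"
  using is_chart[of c] by (auto simp: is_chart_def homeomorphism_def)

lemma hopen_image:
  assumes "c \<in> A" "open U" shows "hopen (cmap c ` (cdom c \<inter> U))"
proof -
  have h: "homeomorphism (cdom c) (cmap c ` cdom c) (cmap c) (cinv c)" and o: "hopen (cmap c ` cdom c)"
    using is_chart[OF assms(1)] by (auto simp: is_chart_def)
  have "openin (top_of_set (cmap c ` cdom c)) (cmap c ` (cdom c \<inter> U))"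
    by (rule homeomorphism_imp_open_map[OF h]) (use assms(2) in auto)
  then show ?thesis using o openin_trans by blast
qed

lemma smooth_transition:
  "c \<in> A \<Longrightarrow> c' \<in> A \<Longrightarrow> smooth_on (cmap c ` (cdom c \<inter> cdom c')) (cmap c' \<circ> cinv c)"
  using mfd by (auto simp: smooth_manifold_with_boundary_def)

lemma chart_at: "chart_at A p \<in> A" "p \<in> cdom (chart_at A p)"
proof -
  have "p \<in> (\<Union>c\<in>A. cdom c)" using mfd unfolding smooth_manifold_with_boundary_def by blast
  then have "\<exists>c. c \<in> A \<and> p \<in> cdom c" by blast
  from someI_ex[OF this] show "chart_at A p \<in> A" "p \<in> cdom (chart_at A p)" by (auto simp: chart_at_def)
qed

lemma cmap_half_space: "c \<in> A \<Longrightarrow> p \<in> cdom c \<Longrightarrow> cmap c p \<in> half_space"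
  using hopen_subset[OF hopen_image[of c UNIV]] by auto

lemma coord_deriv_hderiv:
  "coord_deriv A p v F = hderiv F (cmap (chart_at A p) p) v"
  using at_within_hopen[OF hopen_image[of "chart_at A p" UNIV]] chart_at[of p]
  by (simp add: coord_deriv_def Let_def)

lemma trans_deriv_hderiv:
  "c \<in> A \<Longrightarrow> c' \<in> A \<Longrightarrow> p \<in> cdom c \<Longrightarrow> p \<in> cdom c' \<Longrightarrow>
    trans_deriv c c' p = hderiv (cmap c' \<circ> cinv c) (cmap c p)"
  using at_within_hopen[OF hopen_image[of c "cdom c'"]] open_cdom by (simp add: trans_deriv_def)

lemma trans_has_derivative:
  assumes "c \<in> A" "c' \<in> A" "p \<in> cdom c" "p \<in> cdom c'"
  shows "((\<lambda>x. cmap c' (cinv c x)) has_derivative trans_deriv c c' p) (at (cmap c p) within half_space)"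
  using smooth_on_hderiv[OF hopen_image[OF assms(1) open_cdom[OF assms(2)]] smooth_transition[OF assms(1,2)], of "cmap c p"]
    assms by (simp add: trans_deriv_hderiv o_def)

lemma linear_trans_deriv:
  assumes "c \<in> A" "c' \<in> A" "p \<in> cdom c" "p \<in> cdom c'" shows "linear (trans_deriv c c' p)"
  using trans_has_derivative[OF assms] has_derivative_bounded_linear bounded_linear.linear by blast

lemma derivative_in_other_chart:
  assumes "c \<in> A" "c' \<in> A" "p \<in> cdom c" "p \<in> cdom c'"
    and "(F has_derivative F') (at (cmap c' p) within half_space)"
  shows "((\<lambda>x. F (cmap c' (cinv c x))) has_derivative (\<lambda>v. F' (trans_deriv c c' p v))) (at (cmap c p) within half_space)"
proof (rule hderiv_chain[OF hopen_image[OF assms(1) open_cdom[OF assms(2)]] _ _ _ trans_has_derivative[OF assms(1-4)]])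
  show "(\<lambda>x. cmap c' (cinv c x)) ` cmap c ` (cdom c \<inter> cdom c') \<subseteq> half_space"
    using assms cmap_half_space[OF assms(2)] by auto
qed (use assms in auto)

lemma trans_deriv_trans:
  assumes "c \<in> A" "c' \<in> A" "c'' \<in> A" "p \<in> cdom c" "p \<in> cdom c'" "p \<in> cdom c''"
  shows "trans_deriv c' c'' p (trans_deriv c c' p v) = trans_deriv c c'' p v"
proof -
  have D: "((\<lambda>x. cmap c'' (cinv c' (cmap c' (cinv c x)))) has_derivative (\<lambda>v. trans_deriv c' c'' p (trans_deriv c c' p v)))
     (at (cmap c p) within half_space)"
    by (rule derivative_in_other_chart[OF assms(1,2,4,5) trans_has_derivative[OF assms(2,3,5,6)]])
  have "hderiv (cmap c'' \<circ> cinv c) (cmap c p) = (\<lambda>v. trans_deriv c' c'' p (trans_deriv c c' p v))"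
    by (rule hderiv_local(2)[OF hopen_image[of c "cdom c'"] _ _ D]) (use assms open_cdom in auto)
  then show ?thesis using trans_deriv_hderiv[of c c'' p] assms by simp
qed

lemma trans_deriv_self:
  assumes "c \<in> A" "p \<in> cdom c" shows "trans_deriv c c p v = v"
proof -
  have "hderiv (cmap c \<circ> cinv c) (cmap c p) = (\<lambda>v. v)"
    by (rule hderiv_local(2)[OF hopen_image[of c UNIV] _ _ has_derivative_ident]) (use assms in auto)
  then show ?thesis using trans_deriv_hderiv[of c c p] assms by simp
qed

lemma smooth_on_trans_deriv:
  assumes "c \<in> A" "c' \<in> A"
  shows "smooth_on (cmap c ` (cdom c \<inter> cdom c')) (\<lambda>x. trans_deriv c c' (cinv c x) v)"
proof -
  have "smooth_on (cmap c ` (cdom c \<inter> cdom c')) (\<lambda>x. hderiv (cmap c' \<circ> cinv c) x v)"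
    by (rule smooth_on_hderiv_smooth[OF hopen_image[OF assms(1) open_cdom[OF assms(2)]] smooth_transition[OF assms]])
  then show ?thesis by (rule smooth_on_cong) (use assms in \<open>auto simp: trans_deriv_hderiv\<close>)
qed

lemma frame_coords_frame_vec [simp]:
  "c \<in> A \<Longrightarrow> p \<in> cdom c \<Longrightarrow> frame_coords A c p (frame_vec A c p x) = x"
  by (simp add: frame_coords_def frame_vec_def trans_deriv_trans trans_deriv_self chart_at)

lemma frame_vec_frame_coords [simp]:
  "c \<in> A \<Longrightarrow> p \<in> cdom c \<Longrightarrow> frame_vec A c p (frame_coords A c p v) = v"
  by (simp add: frame_coords_def frame_vec_def trans_deriv_trans trans_deriv_self chart_at)

lemma frame_coords_frame_vec_other:
  "c \<in> A \<Longrightarrow> c' \<in> A \<Longrightarrow> p \<in> cdom c \<Longrightarrow> p \<in> cdom c' \<Longrightarrow> frame_coords A c' p (frame_vec A c p x) = trans_deriv c c' p x"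
  by (simp add: frame_coords_def frame_vec_def trans_deriv_trans chart_at)

lemma linear_frame_coords: "c \<in> A \<Longrightarrow> p \<in> cdom c \<Longrightarrow> linear (frame_coords A c p)"
  unfolding frame_coords_def by (rule linear_trans_deriv) (auto simp: chart_at)

lemma linear_frame_vec: "c \<in> A \<Longrightarrow> p \<in> cdom c \<Longrightarrow> linear (frame_vec A c p)"
  unfolding frame_vec_def by (rule linear_trans_deriv) (auto simp: chart_at)

lemma frame_vec_chart_at [simp]: "frame_vec A (chart_at A p) p v = v"
  by (simp add: frame_vec_def trans_deriv_self chart_at)

lemma frame_coords_chart_at [simp]: "frame_coords A (chart_at A p) p v = v"
  by (simp add: frame_coords_def trans_deriv_self chart_at)

text \<open>If a point were on the boundary in \<open>c\<close> but not in \<open>c'\<close>, then the transversal coordinate of \<open>c\<close>, viewed in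
  \<open>c'\<close>, would have an interior minimum there; its differential would vanish, but the transition map is
  invertible.\<close>

lemma boundary_invariance:
  assumes "c \<in> A" "c' \<in> A" "p \<in> cdom c" "p \<in> cdom c'" "cmap c p $ None = 0"
  shows "cmap c' p $ None = 0"
proof (rule ccontr)
  assume "cmap c' p $ None \<noteq> 0"
  then have pos: "0 < cmap c' p $ None" using cmap_half_space[OF assms(2,4)] by (simp add: half_space_def)
  obtain T where T: "open T" "cmap c' ` (cdom c' \<inter> cdom c) = half_space \<inter> T"
    using hopen_image[OF assms(2) open_cdom[OF assms(1)]] openin_open by blast
  let ?N = "T \<inter> {y. 0 < y $ None}"
  have N: "open ?N" using T(1) by (intro open_Int open_Collect_less continuous_intros)
  have D: "((\<lambda>x. cmap c (cinv c' x) $ None) has_derivative (\<lambda>v. trans_deriv c' c p v $ None)) (at (cmap c' p))"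
    using bounded_linear.has_derivative[OF bounded_linear_vec_nth trans_has_derivative[OF assms(2,1,4,3)]]
      at_within_half_space_interior[OF pos] by simp
  have sub: "?N \<subseteq> cmap c' ` (cdom c' \<inter> cdom c)" using T(2) by (auto simp: half_space_def)
  have min: "\<forall>y\<in>?N. cmap c (cinv c' (cmap c' p)) $ None \<le> cmap c (cinv c' y) $ None"
  proof
    fix y assume "y \<in> ?N"
    then obtain q where "q \<in> cdom c'" "q \<in> cdom c" "y = cmap c' q" using sub by blast
    then show "cmap c (cinv c' (cmap c' p)) $ None \<le> cmap c (cinv c' y) $ None"
      using assms cmap_half_space by (auto simp: half_space_def)
  qed
  have "cmap c' p \<in> half_space \<inter> T" using T(2) assms by blast
  then have "cmap c' p \<in> ?N" using pos by auto
  then have "(\<lambda>v. trans_deriv c' c p v $ None) = (\<lambda>v. 0)"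
    using differential_zero_maxmin[OF _ N D] min by blast
  then have "trans_deriv c' c p (trans_deriv c c' p (axis None 1)) $ None = 0" by metis
  then show False using assms by (simp add: trans_deriv_trans trans_deriv_self axis_def)
qed

lemma mboundary_iff: "c \<in> A \<Longrightarrow> p \<in> cdom c \<Longrightarrow> p \<in> mboundary A \<longleftrightarrow> cmap c p $ None = 0"
  unfolding mboundary_def using boundary_invariance by blast

lemma minterior_iff: "c \<in> A \<Longrightarrow> p \<in> cdom c \<Longrightarrow> p \<in> minterior A \<longleftrightarrow> 0 < cmap c p $ None"
  using mboundary_iff[of c p] cmap_half_space[of c p] by (auto simp: minterior_def half_space_def)

lemma continuous_on_cmap: "c \<in> A \<Longrightarrow> continuous_on (cdom c) (cmap c)"
  using is_chart[of c] by (auto simp: is_chart_def homeomorphism_def)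

lemma open_minterior: "open (minterior A)"
proof (subst open_subopen, rule)
  fix p assume p: "p \<in> minterior A"
  let ?c = "chart_at A p"
  have "open (cmap ?c -` {y. 0 < y $ None} \<inter> cdom ?c)"
    by (rule continuous_on_open_vimage[THEN iffD1, rule_format, OF open_cdom continuous_on_cmap])
      (auto simp: chart_at intro!: open_Collect_less continuous_intros)
  then show "\<exists>T. open T \<and> p \<in> T \<and> T \<subseteq> minterior A"
    by (intro exI[of _ "cmap ?c -` {y. 0 < y $ None} \<inter> cdom ?c"])
      (use p chart_at[of p] minterior_iff[of ?c] in auto)
qed

text \<open>Along a boundary line through the point in direction \<open>v\<close>, the transversal coordinate of the other chart
  is constantly zero by \<open>boundary_invariance\<close>.\<close>

lemma tangent_trans:
  assumes "c \<in> A" "c' \<in> A" "p \<in> cdom c" "p \<in> cdom c'" "p \<in> mboundary A" "v $ None = 0"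
  shows "trans_deriv c c' p v $ None = 0"
proof -
  have x0: "cmap c p $ None = 0" using mboundary_iff assms by blast
  obtain T where T: "open T" "cmap c ` (cdom c \<inter> cdom c') = half_space \<inter> T"
    using hopen_image[OF assms(1) open_cdom[OF assms(2)]] openin_open by blast
  have xT: "cmap c p \<in> T" using T(2) assms by blast
  let ?L = "\<lambda>t. cmap c p + t *\<^sub>R v"
  let ?N = "?L -` T"
  have N: "open ?N" by (rule open_vimage[OF T(1)]) (intro continuous_intros)
  have zero: "cmap c' (cinv c (?L t)) $ None = 0" if t: "t \<in> ?N" for t
  proof -
    have "?L t \<in> half_space \<inter> T" using t x0 assms(6) by (auto simp: half_space_def)
    then obtain q where q: "q \<in> cdom c" "q \<in> cdom c'" "?L t = cmap c q" using T(2) by blast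
    then have "cmap c q $ None = 0" using x0 assms(6) by (metis add_cancel_left_right mult_zero_right real_scaleR_def vector_add_component vector_scaleR_component)
    then show ?thesis using q assms boundary_invariance[of c c' q] by simp
  qed
  have sub: "?L ` ?N \<subseteq> half_space" using x0 assms(6) by (auto simp: half_space_def)
  have 1: "((\<lambda>x. cmap c' (cinv c x) $ None) has_derivative (\<lambda>v. trans_deriv c c' p v $ None)) (at (?L 0) within ?L ` ?N)"
    using has_derivative_subset[OF bounded_linear.has_derivative[OF bounded_linear_vec_nth[of None] trans_has_derivative[OF assms(1-4)]] sub] by simp
  have 2: "(?L has_derivative (\<lambda>t. t *\<^sub>R v)) (at 0 within ?N)" by (auto intro!: derivative_eq_intros)
  have 3: "((\<lambda>t. cmap c' (cinv c (?L t)) $ None) has_derivative (\<lambda>t. trans_deriv c c' p (t *\<^sub>R v) $ None)) (at 0 within ?N)"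
    by (rule has_derivative_in_compose[OF 2 1])
  have 0: "0 \<in> ?N" using xT by simp
  have "((\<lambda>t. 0) has_derivative (\<lambda>t. trans_deriv c c' p (t *\<^sub>R v) $ None)) (at 0 within ?N)"
    by (rule has_derivative_transform[OF 0 zero[symmetric] 3])
  then have "((\<lambda>t. 0) has_derivative (\<lambda>t. trans_deriv c c' p (t *\<^sub>R v) $ None)) (at 0)"
    by (simp only: at_within_open[OF 0 N])
  from has_derivative_unique[OF this has_derivative_const]
  have "trans_deriv c c' p (1 *\<^sub>R v) $ None = 0" by meson
  then show ?thesis by simp
qed

lemma boundary_tangent_iff:
  assumes "c \<in> A" "p \<in> cdom c" "p \<in> mboundary A"
  shows "v \<in> boundary_tangent A p \<longleftrightarrow> frame_coords A c p v $ None = 0"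
proof
  assume *: "frame_coords A c p v $ None = 0"
  show "v \<in> boundary_tangent A p"
    unfolding boundary_tangent_def
  proof (intro CollectI ballI impI)
    fix c' assume c': "c' \<in> A" "p \<in> cdom c'"
    have "frame_coords A c' p v = trans_deriv c c' p (frame_coords A c p v)"
      using assms c' by (simp add: frame_coords_def trans_deriv_trans chart_at)
    then show "frame_coords A c' p v $ None = 0" using tangent_trans[OF assms(1) c'(1) assms(2) c'(2) assms(3) *] by simp
  qed
qed (use assms in \<open>auto simp: boundary_tangent_def\<close>)

end

section \<open>Expansion in the coordinate axes\<close>

lemma vec_axis_expansion: "(\<Sum>i\<in>UNIV. v $ i *\<^sub>R axis i (1::real)) = (v :: real ^ 'k::finite)"
  using basis_expansion[of v] by (simp add: scalar_mult_eq_scaleR)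

lemma linear_axis_expansion:
  fixes L :: "real ^ 'k::finite \<Rightarrow> 'c::real_vector"
  assumes "linear L" shows "L v = (\<Sum>i\<in>UNIV. v $ i *\<^sub>R L (axis i 1))"
  by (subst vec_axis_expansion[symmetric, of v]) (simp add: linear_sum[OF assms] linear_cmul[OF assms])

lemma sum_axis_component: "(\<Sum>i\<in>UNIV. axis i (1::real) $ j * f i) = f (j :: 'k::finite)"
proof -
  have "(\<Sum>i\<in>UNIV. axis i (1::real) $ j * f i) = (\<Sum>i\<in>UNIV. if j = i then f i else 0)"
    by (intro sum.cong) (auto simp: axis_def)
  then show ?thesis by simp
qed

lemma bilinear_symI:
  assumes "\<And>u v. B u v = B v u" "\<And>v. linear (\<lambda>u. B u v)" shows "bilinear B"
proof -
  have "B u = (\<lambda>v. B v u)" for u by (rule ext) (rule assms(1))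
  then have "linear (B u)" for u using assms(2)[of u] by metis
  then show ?thesis unfolding bilinear_def using assms(2) by (intro conjI allI)
qed

text \<open>The product rule for the evaluation of a linear map at a vector, both depending on \<open>y\<close>. It lets
  expressions such as \<open>\<Gamma>(y)(X y)\<close> and \<open>dZ(y)(Y y)\<close> be differentiated without expanding them in
  components; only pointwise differentiability of the linear family is asked for.\<close>

lemma has_derivative_linear_family:
  fixes T :: "'b::real_normed_vector \<Rightarrow> (real ^ 'k::finite) \<Rightarrow> 'c::real_normed_vector"
  assumes W: "open W" "x \<in> W" and lin: "\<And>y. y \<in> W \<Longrightarrow> linear (T y)"
    and T: "\<And>v. ((\<lambda>y. T y v) has_derivative (\<lambda>u. T' u v)) (at x)"
    and Y: "(Y has_derivative Y') (at x)"
  shows "((\<lambda>y. T y (Y y)) has_derivative (\<lambda>u. T' u (Y x) + T x (Y' u))) (at x)"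
proof -
  have ex: "T y v = (\<Sum>i\<in>UNIV. v $ i *\<^sub>R T y (axis i 1))" if "y \<in> W" for y v
    by (rule linear_axis_expansion[OF lin[OF that]])
  have c: "((\<lambda>y. Y y $ i) has_derivative (\<lambda>u. Y' u $ i)) (at x)" for i
    by (rule bounded_linear.has_derivative[OF bounded_linear_vec_nth Y])
  have D1: "((\<lambda>y. \<Sum>i\<in>UNIV. Y y $ i *\<^sub>R T y (axis i 1)) has_derivative
      (\<lambda>u. \<Sum>i\<in>UNIV. Y x $ i *\<^sub>R T' u (axis i 1) + Y' u $ i *\<^sub>R T x (axis i 1))) (at x)"
    by (intro has_derivative_sum has_derivative_scaleR c T)
  have D2: "((\<lambda>y. \<Sum>i\<in>UNIV. Y x $ i *\<^sub>R T y (axis i 1)) has_derivative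
      (\<lambda>u. \<Sum>i\<in>UNIV. Y x $ i *\<^sub>R T' u (axis i 1))) (at x)"
    by (intro has_derivative_sum has_derivative_scaleR_right T)
  have "((\<lambda>y. T y (Y x)) has_derivative (\<lambda>u. \<Sum>i\<in>UNIV. Y x $ i *\<^sub>R T' u (axis i 1))) (at x)"
    by (rule has_derivative_transform_within_open[OF D2 W]) (simp add: ex[symmetric])
  from has_derivative_unique[OF T this]
  have T': "T' u (Y x) = (\<Sum>i\<in>UNIV. Y x $ i *\<^sub>R T' u (axis i 1))" for u by meson
  have "((\<lambda>y. T y (Y y)) has_derivative
      (\<lambda>u. \<Sum>i\<in>UNIV. Y x $ i *\<^sub>R T' u (axis i 1) + Y' u $ i *\<^sub>R T x (axis i 1))) (at x)"
    by (rule has_derivative_transform_within_open[OF D1 W]) (simp add: ex[symmetric])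
  then show ?thesis by (simp add: T' sum.distrib ex[OF W(2), of "Y' u" for u])
qed

lemma second_derivative_symmetric_vec:
  fixes f :: "'b::euclidean_space \<Rightarrow> real ^ 'k::finite"
  assumes V: "smooth_on V f" "open V" "x \<in> V"
  shows "fder (\<lambda>z. fder f z u) x v
       = fder (\<lambda>z. fder f z v) x u"
proof (subst vec_eq_iff, rule)
  fix i
  let ?f = "\<lambda>z. f z $ i"
  have s: "smooth_on V ?f" by (rule smooth_on_vec_nth[OF V(1)])
  have c: "fder h z a = fder g z a $ i"
    if "smooth_on V g" "h = (\<lambda>z. g z $ i)" "z \<in> V" for g :: "'b \<Rightarrow> real ^ 'k" and h z a
    using frechet_derivative_at[OF bounded_linear.has_derivative[OF bounded_linear_vec_nth[of i] smooth_on_has_derivative[OF V(2) that(1,3)]]]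
      that(2) by metis
  have d: "fder (\<lambda>z. fder ?f z a) x b
      = fder (\<lambda>z. fder f z a) x b $ i" for a b
  proof -
    have D: "((\<lambda>z. fder f z a $ i) has_derivative
        (\<lambda>b. fder (\<lambda>z. fder f z a) x b $ i)) (at x)"
      by (rule bounded_linear.has_derivative[OF bounded_linear_vec_nth
            smooth_on_has_derivative[OF V(2) smooth_on_derivative[OF V(2,1)] V(3)]])
    have "((\<lambda>z. fder ?f z a) has_derivative
        (\<lambda>b. fder (\<lambda>z. fder f z a) x b $ i)) (at x)"
      by (rule has_derivative_transform_within_open[OF D V(2,3)]) (rule c[OF V(1) refl, symmetric])
    from frechet_derivative_at[OF this] show ?thesis by metis
  qed
  show "fder (\<lambda>z. fder f z u) x v $ i
       = fder (\<lambda>z. fder f z v) x u $ i"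
    using second_derivative_symmetric[OF s V(2,3), of u v] by (simp add: d)
qed

section \<open>Functions and vector fields in a chart\<close>

context mfd begin

abbreviation img :: "('a, 'n) chart \<Rightarrow> 'a set \<Rightarrow> 'n coords set" where
  "img c U \<equiv> cmap c ` (cdom c \<inter> U)"

lemma smooth_transition_on:
  assumes "c \<in> A" "c' \<in> A" shows "smooth_on (img c' (cdom c)) (\<lambda>y. cmap c (cinv c' y))"
  using smooth_transition[OF assms(2,1)] by (simp add: o_def)

lemma smooth_on_change_chart:
  assumes "c \<in> A" "c' \<in> A" "U \<subseteq> cdom c" "smooth_on (img c U) F"
  shows "smooth_on (img c' U) (\<lambda>y. F (cmap c (cinv c' y)))"
  by (rule smooth_on_compose[OF assms(4) smooth_on_subset[OF smooth_transition_on[OF assms(1,2)]]])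
    (use assms in auto)

lemma smooth_funI:
  assumes "c \<in> A" "U \<subseteq> cdom c" "smooth_on (img c U) (f \<circ> cinv c)"
  shows "smooth_fun A U f"
  unfolding smooth_fun_def
proof
  fix c' assume c': "c' \<in> A"
  show "smooth_on (img c' U) (f \<circ> cinv c')"
    by (rule smooth_on_cong[OF smooth_on_change_chart[OF assms(1) c' assms(2,3)]]) (use assms c' in auto)
qed

lemma vf_local_change:
  assumes "c \<in> A" "c' \<in> A" "p \<in> cdom c" "p \<in> cdom c'"
  shows "vf_local A c' X (cmap c' p) = trans_deriv c c' p (vf_local A c X (cmap c p))"
  using assms by (simp add: vf_local_def frame_coords_def trans_deriv_trans chart_at)

text \<open>In another chart the components are the Jacobian of the transition map applied to those in \<open>c\<close>, and that
  Jacobian is smooth.\<close>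

lemma vector_fieldsI:
  assumes c: "c \<in> A" and U: "U \<subseteq> cdom c" and X: "smooth_on (img c U) (vf_local A c X)"
  shows "X \<in> vector_fields A U"
  unfolding vector_fields_def
proof (intro CollectI ballI)
  fix c' assume c': "c' \<in> A"
  have t: "smooth_on (img c' U) (\<lambda>y. trans_deriv c c' (cinv c (cmap c (cinv c' y))) v)" for v
  proof -
    have "smooth_on (img c' (U \<inter> cdom c')) (\<lambda>y. trans_deriv c c' (cinv c (cmap c (cinv c' y))) v)"
      by (rule smooth_on_change_chart[OF c c' _ smooth_on_subset[OF smooth_on_trans_deriv[OF c c', of v]]])
        (use U in auto)
    moreover have "img c' (U \<inter> cdom c') = img c' U" by blast
    ultimately show ?thesis by simp
  qed
  show "smooth_on (img c' U) (vf_local A c' X)"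
  proof -
    have "img c U = img c U" ..
    have s: "smooth_on (img c' U) (\<lambda>y. \<Sum>i\<in>UNIV. (vf_local A c X (cmap c (cinv c' y)) $ i) *\<^sub>R
        trans_deriv c c' (cinv c (cmap c (cinv c' y))) (axis i 1))"
      by (intro smooth_on_sum smooth_on_scaleR smooth_on_vec_nth smooth_on_change_chart[OF c c' U X])
        (rule t)
    show ?thesis
    proof (rule smooth_on_cong[OF s])
      fix y assume "y \<in> img c' U"
      then obtain q where q: "q \<in> cdom c'" "q \<in> U" "y = cmap c' q" by blast
      have qc: "q \<in> cdom c" using q U by blast
      note lin = linear_trans_deriv[OF c c' qc q(1)]
      show "(\<Sum>i\<in>UNIV. (vf_local A c X (cmap c (cinv c' y)) $ i) *\<^sub>R
        trans_deriv c c' (cinv c (cmap c (cinv c' y))) (axis i 1)) = vf_local A c' X y"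
        using q qc c c' vf_local_change[OF c c' qc q(1)]
        by (simp add: linear_axis_expansion[OF lin, symmetric])
    qed
  qed
qed

lemma vf_local_coord_field [simp]: "c \<in> A \<Longrightarrow> p \<in> cdom c \<Longrightarrow> vf_local A c (coord_field A c u) (cmap c p) = u"
  by (simp add: vf_local_def coord_field_def)

lemma coord_field_vector_field:
  assumes "c \<in> A" "U \<subseteq> cdom c" shows "coord_field A c u \<in> vector_fields A U"
  by (rule vector_fieldsI[OF assms smooth_on_cong[OF smooth_on_const[of _ u]]])
    (use assms in auto)

lemma smooth_on_vf_local: "c \<in> A \<Longrightarrow> X \<in> vector_fields A U \<Longrightarrow> smooth_on (img c U) (vf_local A c X)"
  by (auto simp: vector_fields_def)

lemma smooth_on_fun_local: "c \<in> A \<Longrightarrow> smooth_fun A U f \<Longrightarrow> smooth_on (img c U) (\<lambda>x. f (cinv c x))"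
  by (auto simp: smooth_fun_def o_def)

lemma vector_fields_scale:
  assumes "X \<in> vector_fields A U" "smooth_fun A U f" shows "(\<lambda>q. f q *\<^sub>R X q) \<in> vector_fields A U"
  unfolding vector_fields_def
proof (intro CollectI ballI)
  fix c assume c: "c \<in> A"
  have "smooth_on (img c U) (\<lambda>x. f (cinv c x) *\<^sub>R vf_local A c X x)"
    by (intro smooth_on_scaleR smooth_on_vf_local smooth_on_fun_local c assms)
  then show "smooth_on (img c U) (vf_local A c (\<lambda>q. f q *\<^sub>R X q))"
    by (rule smooth_on_cong) (use c in \<open>auto simp: vf_local_def linear_cmul[OF linear_frame_coords]\<close>)
qed

lemma vector_fields_add:
  assumes "X \<in> vector_fields A U" "Y \<in> vector_fields A U" shows "(\<lambda>q. X q + Y q) \<in> vector_fields A U"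
  unfolding vector_fields_def
proof (intro CollectI ballI)
  fix c assume c: "c \<in> A"
  have "smooth_on (img c U) (\<lambda>x. vf_local A c X x + vf_local A c Y x)"
    by (intro smooth_on_add smooth_on_vf_local c assms)
  then show "smooth_on (img c U) (vf_local A c (\<lambda>q. X q + Y q))"
    by (rule smooth_on_cong) (use c in \<open>auto simp: vf_local_def linear_add[OF linear_frame_coords]\<close>)
qed

lemma dfun_chart:
  assumes "c \<in> A" "p \<in> cdom c"
    "((\<lambda>x. f (cinv c x)) has_derivative F') (at (cmap c p) within half_space)"
  shows "dfun A f p v = F' (frame_coords A c p v)"
proof -
  let ?c = "chart_at A p"
  note ca = chart_at[of p]
  have "hderiv (f \<circ> cinv ?c) (cmap ?c p) = (\<lambda>v. F' (trans_deriv ?c c p v))"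
    by (rule hderiv_local(2)[OF hopen_image[OF ca(1) open_cdom[OF assms(1)]] _ _
          derivative_in_other_chart[OF ca(1) assms(1) ca(2) assms(2,3)]])
      (use assms ca in auto)
  then show ?thesis by (simp add: dfun_def coord_deriv_hderiv frame_coords_def)
qed

lemma dfun_smooth:
  assumes "c \<in> A" "open U" "smooth_fun A U f" "p \<in> U" "p \<in> cdom c"
  shows "dfun A f p v = hderiv (\<lambda>x. f (cinv c x)) (cmap c p) (frame_coords A c p v)"
  by (rule dfun_chart[OF assms(1,5)])
    (use smooth_on_hderiv[OF hopen_image[OF assms(1,2)] smooth_on_fun_local[OF assms(1,3)]] assms in auto)

lemma open_image_interior:
  assumes "c \<in> A" "open U" shows "open (img c (U \<inter> minterior A))"
proof -
  obtain T where T: "open T" "img c U = half_space \<inter> T"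
    using hopen_image[OF assms] openin_open by blast
  have "img c (U \<inter> minterior A) = T \<inter> {y. 0 < y $ None}"
  proof
    show "img c (U \<inter> minterior A) \<subseteq> T \<inter> {y. 0 < y $ None}"
      using T(2) minterior_iff[OF assms(1)] by blast
    show "T \<inter> {y. 0 < y $ None} \<subseteq> img c (U \<inter> minterior A)"
    proof
      fix y assume y: "y \<in> T \<inter> {y. 0 < y $ None}"
      then have "y \<in> img c U" using T(2) by (auto simp: half_space_def)
      then show "y \<in> img c (U \<inter> minterior A)" using y minterior_iff[OF assms(1)] by blast
    qed
  qed
  then show ?thesis using T(1) by (auto intro!: open_Int open_Collect_less continuous_intros)
qed

lemma hderiv_interior: "c \<in> A \<Longrightarrow> p \<in> cdom c \<Longrightarrow> p \<in> minterior A \<Longrightarrow>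
    at (cmap c p) within half_space = at (cmap c p)"
  using at_within_half_space_interior minterior_iff by blast

text \<open>In the chart selected at \<open>p\<close> the bracket is the antisymmetric part of the second derivative of the
  transition map from \<open>c\<close>.\<close>

lemma lie_bracket_coord_fields:
  assumes c: "c \<in> A" "p \<in> cdom c" and p: "p \<in> minterior A"
  shows "lie_bracket A (coord_field A c u) (coord_field A c w) p = 0"
proof -
  let ?c = "chart_at A p"
  note ca = chart_at[of p]
  let ?S = "img c (cdom ?c)"
  let ?W = "img c (cdom ?c \<inter> minterior A)"
  have W: "open ?W" "cmap c p \<in> ?W" using open_image_interior[OF c(1) open_cdom[OF ca(1)]] c p ca by auto
  let ?\<phi> = "\<lambda>x. cmap ?c (cinv c x)"
  have S: "smooth_on ?W ?\<phi>"
    by (rule smooth_on_subset[OF smooth_transition_on[OF ca(1) c(1)]]) auto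
  have t: "trans_deriv c ?c (cinv c x) a = frechet_derivative ?\<phi> (at x) a" if "x \<in> ?W" for x a
    using that c ca minterior_iff[OF c(1)] by (auto simp: trans_deriv_hderiv at_within_half_space_interior o_def)
  have *: "coord_deriv A p (coord_field A c a p) (vf_local A ?c (coord_field A c b))
      = fder (\<lambda>x. frechet_derivative ?\<phi> (at x) b) (cmap c p) a" for a b
  proof -
    have 1: "((\<lambda>x. frechet_derivative ?\<phi> (at x) b) has_derivative
        fder (\<lambda>x. frechet_derivative ?\<phi> (at x) b) (cmap c p)) (at (cmap c p))"
      by (rule smooth_on_has_derivative[OF W(1) smooth_on_derivative[OF W(1) S] W(2)])
    have "((\<lambda>x. trans_deriv c ?c (cinv c x) b) has_derivative
        fder (\<lambda>x. frechet_derivative ?\<phi> (at x) b) (cmap c p)) (at (cmap c p) within half_space)"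
      by (rule has_derivative_at_withinI[OF has_derivative_transform_within_open[OF 1 W]]) (simp add: t)
    note D = derivative_in_other_chart[OF ca(1) c(1) ca(2) c(2) this]
    have "hderiv (vf_local A ?c (coord_field A c b)) (cmap ?c p)
       = (\<lambda>v. fder (\<lambda>x. frechet_derivative ?\<phi> (at x) b) (cmap c p) (trans_deriv ?c c p v))"
      by (rule hderiv_local(2)[OF hopen_image[OF ca(1) open_cdom[OF c(1)]] _ _ D])
        (use c ca in \<open>auto simp: vf_local_def coord_field_def frame_coords_frame_vec_other\<close>)
    then show ?thesis
      using c by (simp add: coord_deriv_hderiv coord_field_def frame_coords_def[symmetric])
  qed
  show ?thesis
    unfolding lie_bracket_def * using second_derivative_symmetric_vec[OF S W] by simp
qed

end

section \<open>Connections in a chart\<close>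

locale conn = mfd A for A :: "('a::{t2_space, second_countable_topology}, 'n::finite) chart set" +
  fixes D :: "('a, 'n) conn"
  assumes linear_connection: "linear_connection A (minterior A) D"
    and torsion_free: "torsion_free A (minterior A) D"
begin

abbreviation M :: "'a set" where "M \<equiv> minterior A"

context
  fixes U assumes U: "open U" "U \<subseteq> M"
begin

lemmas connD = mp[OF spec[OF linear_connection[unfolded linear_connection_def], of U], OF conjI[OF U]]

lemma conn_linear: "Y \<in> vector_fields A U \<Longrightarrow> p \<in> U \<Longrightarrow> linear (\<lambda>v. D p v Y)"
  using bspec[OF conjunct1[OF bspec[OF connD]]] .

lemma conn_add: "Y \<in> vector_fields A U \<Longrightarrow> Z \<in> vector_fields A U \<Longrightarrow> p \<in> U \<Longrightarrow>
    D p v (\<lambda>q. Y q + Z q) = D p v Y + D p v Z"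
  using bspec[OF bspec[OF conjunct1[OF conjunct2[OF bspec[OF connD]]]], THEN spec] .

lemma conn_scale: "Y \<in> vector_fields A U \<Longrightarrow> smooth_fun A U f \<Longrightarrow> p \<in> U \<Longrightarrow>
    D p v (\<lambda>q. f q *\<^sub>R Y q) = dfun A f p v *\<^sub>R Y p + f p *\<^sub>R D p v Y"
  using bspec[OF mp[OF spec[OF conjunct1[OF conjunct2[OF conjunct2[OF bspec[OF connD]]]]]], THEN spec] .

lemma conn_cong:
  assumes "Y \<in> vector_fields A U" "\<And>q. q \<in> U \<Longrightarrow> Z q = Y q" "p \<in> U" shows "D p v Z = D p v Y"
  by (rule bspec[OF mp[OF spec[OF conjunct1[OF conjunct2[OF conjunct2[OF conjunct2[OF bspec[OF connD assms(1)]]]]]]], THEN spec])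
    (use assms(2,3) in auto)

lemma conn_smooth: "X \<in> vector_fields A U \<Longrightarrow> Y \<in> vector_fields A U \<Longrightarrow> cov D X Y \<in> vector_fields A U"
  using bspec[OF conjunct2[OF conjunct2[OF conjunct2[OF conjunct2[OF bspec[OF connD]]]]]] .

lemma torsion_freeD: "X \<in> vector_fields A U \<Longrightarrow> Y \<in> vector_fields A U \<Longrightarrow> p \<in> U \<Longrightarrow>
    cov D X Y p - cov D Y X p = lie_bracket A X Y p"
  using bspec[OF bspec[OF bspec[OF mp[OF spec[OF torsion_free[unfolded torsion_free_def], of U], OF conjI[OF U]]]]] .

lemma conn_sum:
  assumes "finite I" "\<And>i. i \<in> I \<Longrightarrow> smooth_fun A U (f i)" "\<And>i. i \<in> I \<Longrightarrow> Y i \<in> vector_fields A U"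
    "(\<lambda>q. 0) \<in> vector_fields A U" "p \<in> U"
  shows "(\<lambda>q. \<Sum>i\<in>I. f i q *\<^sub>R Y i q) \<in> vector_fields A U \<and>
    D p v (\<lambda>q. \<Sum>i\<in>I. f i q *\<^sub>R Y i q) = (\<Sum>i\<in>I. dfun A (f i) p v *\<^sub>R Y i p + f i p *\<^sub>R D p v (Y i))"
  using assms(1-3)
proof (induction I rule: finite_induct)
  case empty
  have "D p v (\<lambda>q. 0 + 0) = D p v (\<lambda>q. 0) + D p v (\<lambda>q. 0)" by (rule conn_add[OF assms(4,4,5)])
  then show ?case using assms by simp
next
  case (insert i I)
  have 1: "(\<lambda>q. f i q *\<^sub>R Y i q) \<in> vector_fields A U" by (rule vector_fields_scale) (use insert in auto)
  have 2: "(\<lambda>q. \<Sum>i\<in>I. f i q *\<^sub>R Y i q) \<in> vector_fields A U"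
    and 3: "D p v (\<lambda>q. \<Sum>i\<in>I. f i q *\<^sub>R Y i q) = (\<Sum>i\<in>I. dfun A (f i) p v *\<^sub>R Y i p + f i p *\<^sub>R D p v (Y i))"
    using insert by auto
  have 4: "D p v (\<lambda>q. f i q *\<^sub>R Y i q) = dfun A (f i) p v *\<^sub>R Y i p + f i p *\<^sub>R D p v (Y i)"
    by (rule conn_scale) (use insert assms(5) in auto)
  show ?case using vector_fields_add[OF 1 2] conn_add[OF 1 2 assms(5), of v] insert(1,2) by (simp add: 3 4)
qed

end

text \<open>The Christoffel symbols in the chart \<open>c\<close>, as a bilinear map of the constant vectors \<open>u\<close> and \<open>w\<close>.\<close>

definition Gam :: "('a, 'n) chart \<Rightarrow> 'n coords \<Rightarrow> 'n coords \<Rightarrow> 'n coords \<Rightarrow> 'n coords" where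
  "Gam c x u w = frame_coords A c (cinv c x) (D (cinv c x) (frame_vec A c (cinv c x) u) (coord_field A c w))"

definition dGam :: "('a, 'n) chart \<Rightarrow> 'n coords \<Rightarrow> 'n coords \<Rightarrow> 'n coords \<Rightarrow> 'n coords \<Rightarrow> 'n coords" where
  "dGam c x u v w = fder (\<lambda>y. Gam c y v w) x u"

text \<open>The classical coordinate formula for the curvature.\<close>

definition curv_coords :: "('a, 'n) chart \<Rightarrow> 'n coords \<Rightarrow> 'n coords \<Rightarrow> 'n coords \<Rightarrow> 'n coords \<Rightarrow> 'n coords" where
  "curv_coords c x u v w = dGam c x u v w - dGam c x v u w + Gam c x u (Gam c x v w) - Gam c x v (Gam c x u w)"

context
  fixes c assumes c: "c \<in> A"
begin

lemma open_dom_interior: "open (cdom c \<inter> M)"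
  using open_cdom[OF c] open_minterior by auto

lemma open_img_interior: "open (img c M)"
  using open_image_interior[OF c open_UNIV] by simp

lemma coord_field_interior: "coord_field A c u \<in> vector_fields A (cdom c \<inter> M)"
  by (rule coord_field_vector_field[OF c]) auto

lemma Gam_smooth: "smooth_on (img c M) (\<lambda>x. Gam c x u w)"
proof -
  have "cov D (coord_field A c u) (coord_field A c w) \<in> vector_fields A (cdom c \<inter> M)"
    by (rule conn_smooth[OF open_dom_interior]) (auto intro: coord_field_interior)
  from smooth_on_vf_local[OF c this]
  have "smooth_on (img c M) (vf_local A c (cov D (coord_field A c u) (coord_field A c w)))" by simp
  then show ?thesis
    by (rule smooth_on_cong) (simp add: vf_local_def Gam_def cov_def coord_field_def)
qed

lemma Gam_linear1: assumes "x \<in> img c M" shows "linear (\<lambda>u. Gam c x u w)"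
proof -
  obtain p where p: "p \<in> cdom c" "p \<in> M" "x = cmap c p" using assms by blast
  have 1: "linear (\<lambda>v. D p v (coord_field A c w))"
    by (rule conn_linear[OF open_dom_interior _ coord_field_interior]) (use p in auto)
  have "linear (frame_coords A c p \<circ> (\<lambda>v. D p v (coord_field A c w)) \<circ> frame_vec A c p)"
    by (intro linear_compose linear_frame_coords linear_frame_vec c p 1)
  then show ?thesis using p c by (simp add: Gam_def o_def)
qed

lemma Gam_linear2: assumes "x \<in> img c M" shows "linear (Gam c x u)"
proof -
  obtain p where p: "p \<in> cdom c" "p \<in> M" "x = cmap c p" using assms by blast
  let ?U = "cdom c \<inter> M"
  have U: "open ?U" "?U \<subseteq> M" "p \<in> ?U" using open_dom_interior p by auto
  have cf: "coord_field A c (a + b) q = coord_field A c a q + coord_field A c b q"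
      "coord_field A c (r *\<^sub>R a) q = r *\<^sub>R coord_field A c a q" if "q \<in> ?U" for a b r q
    using that linear_frame_vec[OF c, of q] by (auto simp: coord_field_def linear_add linear_cmul)
  have k: "smooth_fun A ?U (\<lambda>q. r)" for r by (simp add: smooth_fun_def o_def)
  have d0: "dfun A (\<lambda>q. r) p v = 0" for r v
    by (rule dfun_chart[OF c p(1) has_derivative_const])
  have "D p v (coord_field A c (a + b)) = D p v (coord_field A c a) + D p v (coord_field A c b)" for a b v
    using conn_cong[OF U(1,2) vector_fields_add[OF coord_field_interior coord_field_interior] _ U(3), where Z = "coord_field A c (a + b)"]
      conn_add[OF U(1,2) coord_field_interior coord_field_interior U(3)] cf by simp
  moreover have "D p v (coord_field A c (r *\<^sub>R a)) = r *\<^sub>R D p v (coord_field A c a)" for a r v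
    using conn_cong[OF U(1,2) vector_fields_scale[OF coord_field_interior k] _ U(3), where Z = "coord_field A c (r *\<^sub>R a)"]
      conn_scale[OF U(1,2) coord_field_interior k U(3)] cf d0 by simp
  ultimately show ?thesis
    using p c by (intro linearI) (simp_all add: Gam_def linear_add[OF linear_frame_coords] linear_cmul[OF linear_frame_coords])
qed

text \<open>Write \<open>Y\<close> as a combination of coordinate fields with smooth coefficients and apply the Leibniz rule;
  the coefficients contribute the derivative of the components of \<open>Y\<close>.\<close>

lemma cov_local:
  assumes U: "open U" "U \<subseteq> cdom c \<inter> M" and Y: "Y \<in> vector_fields A U" and p: "p \<in> U"
  shows "frame_coords A c p (D p v Y) = fder (vf_local A c Y) (cmap c p) (frame_coords A c p v)
     + Gam c (cmap c p) (frame_coords A c p v) (vf_local A c Y (cmap c p))"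
proof -
  have pc: "p \<in> cdom c" "p \<in> M" and UM: "U \<subseteq> M" and x: "cmap c p \<in> img c M" using p U by auto
  have W: "open (img c U)" "cmap c p \<in> img c U"
    using open_image_interior[OF c U(1)] U(2) p by (auto simp: Int_absorb2)
  define f where "f i q = vf_local A c Y (cmap c q) $ i" for i q
  define E where "E i = coord_field A c (axis i (1::real))" for i
  have sY: "smooth_on (img c U) (vf_local A c Y)" by (rule smooth_on_vf_local[OF c Y])
  have f: "smooth_fun A U (f i)" for i
    by (rule smooth_funI[OF c _ smooth_on_cong[OF smooth_on_vec_nth[OF sY, of i]]]) (use U c in \<open>auto simp: f_def\<close>)
  have E: "E i \<in> vector_fields A U" for i
    unfolding E_def by (rule coord_field_vector_field[OF c]) (use U in auto)
  have 0: "(\<lambda>q. 0) \<in> vector_fields A U"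
    using vector_fields_scale[OF Y, of "\<lambda>q. 0"] by (simp add: smooth_fun_def o_def)
  have ex: "Y q = (\<Sum>i\<in>UNIV. f i q *\<^sub>R E i q)" if "q \<in> U" for q
  proof -
    have q: "q \<in> cdom c" using that U by auto
    have "Y q = frame_vec A c q (vf_local A c Y (cmap c q))" using c q by (simp add: vf_local_def)
    also have "\<dots> = (\<Sum>i\<in>UNIV. f i q *\<^sub>R E i q)"
      by (subst linear_axis_expansion[OF linear_frame_vec[OF c q]]) (simp add: f_def E_def coord_field_def)
    finally show ?thesis .
  qed
  have S: "(\<lambda>q. \<Sum>i\<in>UNIV. f i q *\<^sub>R E i q) \<in> vector_fields A U \<and>
    D p v (\<lambda>q. \<Sum>i\<in>UNIV. f i q *\<^sub>R E i q) = (\<Sum>i\<in>UNIV. dfun A (f i) p v *\<^sub>R E i p + f i p *\<^sub>R D p v (E i))"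
    by (rule conn_sum[OF U(1) UM _ f E 0 p]) simp
  have "D p v Y = D p v (\<lambda>q. \<Sum>i\<in>UNIV. f i q *\<^sub>R E i q)"
    using S by (intro conn_cong[OF U(1) UM _ _ p]) (auto simp: ex)
  also have "\<dots> = (\<Sum>i\<in>UNIV. dfun A (f i) p v *\<^sub>R E i p + f i p *\<^sub>R D p v (E i))"
    using S by blast
  finally have D: "D p v Y = \<dots>" .
  note lin = linear_frame_coords[OF c pc(1)]
  let ?v = "frame_coords A c p v" and ?x = "cmap c p"
  have df: "dfun A (f i) p v = fder (vf_local A c Y) ?x ?v $ i" for i
  proof (rule dfun_chart[OF c pc(1), where F' = "\<lambda>a. fder (vf_local A c Y) ?x a $ i"])
    have "((\<lambda>x. vf_local A c Y x $ i) has_derivative (\<lambda>a. fder (vf_local A c Y) ?x a $ i)) (at ?x)"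
      by (rule bounded_linear.has_derivative[OF bounded_linear_vec_nth smooth_on_has_derivative[OF W(1) sY W(2)]])
    then have "((\<lambda>x. f i (cinv c x)) has_derivative (\<lambda>a. fder (vf_local A c Y) ?x a $ i)) (at ?x)"
      by (rule has_derivative_transform_within_open[OF _ W]) (use U(2) c in \<open>auto simp: f_def subset_iff\<close>)
    then show "((\<lambda>x. f i (cinv c x)) has_derivative (\<lambda>a. fder (vf_local A c Y) ?x a $ i)) (at ?x within half_space)"
      by (rule has_derivative_at_withinI)
  qed
  have e1: "frame_coords A c p (E i p) = axis i 1" for i using c pc by (simp add: E_def coord_field_def)
  have e2: "frame_coords A c p (D p v (E i)) = Gam c ?x ?v (axis i 1)" for i
    using c pc by (simp add: Gam_def E_def)
  have "frame_coords A c p (D p v Y) = (\<Sum>i\<in>UNIV. fder (vf_local A c Y) ?x ?v $ i *\<^sub>R axis i 1)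
     + (\<Sum>i\<in>UNIV. vf_local A c Y ?x $ i *\<^sub>R Gam c ?x ?v (axis i 1))"
    by (simp add: D linear_sum[OF lin] linear_add[OF lin] linear_cmul[OF lin] e1 e2 df sum.distrib f_def)
  then show ?thesis
    by (simp add: vec_axis_expansion linear_axis_expansion[OF Gam_linear2[OF x], symmetric])
qed

lemma cov_vf_local:
  assumes U: "open U" "U \<subseteq> cdom c \<inter> M" and Y: "Y \<in> vector_fields A U" and x: "x \<in> img c U"
  shows "vf_local A c (cov D X Y) x = fder (vf_local A c Y) x (vf_local A c X x)
     + Gam c x (vf_local A c X x) (vf_local A c Y x)"
proof -
  obtain p where "p \<in> cdom c" "p \<in> U" "x = cmap c p" using x by blast
  then show ?thesis using cov_local[OF U Y, of p "X p"] c by (simp add: vf_local_def cov_def)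
qed

lemma Gam_sym: assumes "x \<in> img c M" shows "Gam c x u w = Gam c x w u"
proof -
  obtain p where p: "p \<in> cdom c" "p \<in> M" "x = cmap c p" using assms by blast
  have "cov D (coord_field A c u) (coord_field A c w) p - cov D (coord_field A c w) (coord_field A c u) p = 0"
    using torsion_freeD[OF open_dom_interior _ coord_field_interior coord_field_interior, of p u w]
      lie_bracket_coord_fields[OF c p(1,2), of u w] p by auto
  then show ?thesis using p c by (simp add: Gam_def cov_def coord_field_def)
qed

lemma Gam_has_derivative: "x \<in> img c M \<Longrightarrow> ((\<lambda>y. Gam c y v w) has_derivative (\<lambda>u. dGam c x u v w)) (at x)"
  unfolding dGam_def by (rule smooth_on_has_derivative[OF open_img_interior Gam_smooth])

lemma dGam_linear1: assumes x: "x \<in> img c M" shows "linear (\<lambda>u. dGam c x u v w)"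
  using has_derivative_bounded_linear[OF Gam_has_derivative[OF x]] bounded_linear.linear by blast

lemma dGam_linear2: assumes x: "x \<in> img c M" shows "linear (\<lambda>v. dGam c x u v w)"
proof -
  have a: "((\<lambda>y. Gam c y (a + b) w) has_derivative (\<lambda>u. dGam c x u a w + dGam c x u b w)) (at x)" for a b
    by (rule has_derivative_transform_within_open[OF has_derivative_add[OF Gam_has_derivative[OF x] Gam_has_derivative[OF x]] open_img_interior x])
      (simp add: linear_add[OF Gam_linear1])
  have b: "((\<lambda>y. Gam c y (r *\<^sub>R a) w) has_derivative (\<lambda>u. r *\<^sub>R dGam c x u a w)) (at x)" for a r
    by (rule has_derivative_transform_within_open[OF has_derivative_scaleR_right[OF Gam_has_derivative[OF x]] open_img_interior x])
      (simp add: linear_cmul[OF Gam_linear1])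
  show ?thesis
    using has_derivative_unique[OF a Gam_has_derivative[OF x]] has_derivative_unique[OF b Gam_has_derivative[OF x]]
    by (intro linearI) (metis)+
qed

lemma Gam_fields_has_derivative:
  assumes x: "x \<in> img c M" and X: "(X has_derivative X') (at x)" and Y: "(Y has_derivative Y') (at x)"
  shows "((\<lambda>y. Gam c y (X y) (Y y)) has_derivative
     (\<lambda>u. dGam c x u (X x) (Y x) + Gam c x (X' u) (Y x) + Gam c x (X x) (Y' u))) (at x)"
proof -
  have 1: "((\<lambda>y. Gam c y (X y) w) has_derivative (\<lambda>u. dGam c x u (X x) w + Gam c x (X' u) w)) (at x)" for w
    by (rule has_derivative_linear_family[OF open_img_interior x Gam_linear1 Gam_has_derivative[OF x] X])
  show ?thesis
    by (rule has_derivative_linear_family[OF open_img_interior x Gam_linear2 1 Y])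
qed

text \<open>The value at \<open>p\<close> depends only on the values of the fields at \<open>p\<close>, so this contains the tensoriality of
  curvature. It is needed because the Ricci tensor at \<open>p\<close> is defined with the coordinate fields of the
  chart selected at \<open>p\<close>, which in \<open>c\<close> are not constant. Torsion-freeness is used to express the Lie
  bracket in \<open>c\<close>.\<close>

lemma curvature_local:
  assumes U: "open U" "U \<subseteq> cdom c \<inter> M" and XYZ: "X \<in> vector_fields A U" "Y \<in> vector_fields A U" "Z \<in> vector_fields A U"
    and p: "p \<in> U"
  shows "frame_coords A c p (curvature A D X Y Z p) = curv_coords c (cmap c p) (frame_coords A c p (X p)) (frame_coords A c p (Y p)) (frame_coords A c p (Z p))"
proof -
  have pc: "p \<in> cdom c" "p \<in> M" and UM: "U \<subseteq> M" using p U by auto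
  let ?x = "cmap c p"
  have W: "open (img c U)" "?x \<in> img c U" and xM: "?x \<in> img c M"
    using open_image_interior[OF c U(1)] U(2) p by (auto simp: Int_absorb2)
  let ?l = "vf_local A c" and ?d = "\<lambda>Y y. fder (vf_local A c Y) y"
  note lin = linear_frame_coords[OF c pc(1)]
  have s: "smooth_on (img c U) (?l V)" if "V \<in> vector_fields A U" for V by (rule smooth_on_vf_local[OF c that])
  have dl: "linear (?d V y)" if "V \<in> vector_fields A U" "y \<in> img c U" for V y
    using has_derivative_bounded_linear[OF smooth_on_has_derivative[OF W(1) s[OF that(1)] that(2)]]
      bounded_linear.linear by blast
  have l: "?l V ?x = frame_coords A c p (V p)" for V using c pc by (simp add: vf_local_def)
  \<comment> \<open>Exchanging \<open>V1\<close> and \<open>V2\<close> and subtracting leaves the terms with \<open>dGam\<close> and the last one, up to the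
    bracket: the second derivative of \<open>V3\<close> is symmetric, the terms with a derivative of \<open>V2\<close> cancel
    against the bracket, and the two remaining ones are exchanged.\<close>
  have nn: "frame_coords A c p (cov D V1 (cov D V2 V3) p) =
      fder (\<lambda>y. ?d V3 y (?l V2 ?x)) ?x (?l V1 ?x) + ?d V3 ?x (?d V2 ?x (?l V1 ?x))
      + dGam c ?x (?l V1 ?x) (?l V2 ?x) (?l V3 ?x) + Gam c ?x (?d V2 ?x (?l V1 ?x)) (?l V3 ?x)
      + Gam c ?x (?l V2 ?x) (?d V3 ?x (?l V1 ?x))
      + Gam c ?x (?l V1 ?x) (?d V3 ?x (?l V2 ?x)) + Gam c ?x (?l V1 ?x) (Gam c ?x (?l V2 ?x) (?l V3 ?x))"
    if V: "V1 \<in> vector_fields A U" "V2 \<in> vector_fields A U" "V3 \<in> vector_fields A U" for V1 V2 V3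
  proof -
    have c23: "cov D V2 V3 \<in> vector_fields A U" by (rule conn_smooth[OF U(1) UM V(2,3)])
    have D1: "((\<lambda>y. ?d V3 y (?l V2 y)) has_derivative
       (\<lambda>u. fder (\<lambda>y. ?d V3 y (?l V2 ?x)) ?x u + ?d V3 ?x (?d V2 ?x u))) (at ?x)"
      using has_derivative_linear_family[OF W dl[OF V(3)]
        smooth_on_has_derivative[OF W(1) smooth_on_derivative[OF W(1) s[OF V(3)]] W(2)]
        smooth_on_has_derivative[OF W(1) s[OF V(2)] W(2)]] by simp
    have D2: "((\<lambda>y. Gam c y (?l V2 y) (?l V3 y)) has_derivative
      (\<lambda>u. dGam c ?x u (?l V2 ?x) (?l V3 ?x) + Gam c ?x (?d V2 ?x u) (?l V3 ?x) + Gam c ?x (?l V2 ?x) (?d V3 ?x u))) (at ?x)"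
      by (rule Gam_fields_has_derivative[OF xM smooth_on_has_derivative[OF W(1) s[OF V(2)] W(2)]
            smooth_on_has_derivative[OF W(1) s[OF V(3)] W(2)]])
    have "(?l (cov D V2 V3) has_derivative
      (\<lambda>u. (fder (\<lambda>y. ?d V3 y (?l V2 ?x)) ?x u + ?d V3 ?x (?d V2 ?x u))
       + (dGam c ?x u (?l V2 ?x) (?l V3 ?x) + Gam c ?x (?d V2 ?x u) (?l V3 ?x) + Gam c ?x (?l V2 ?x) (?d V3 ?x u)))) (at ?x)"
      by (rule has_derivative_transform_within_open[OF has_derivative_add[OF D1 D2] W])
        (simp add: cov_vf_local[OF U V(3)])
    then have d: "?d (cov D V2 V3) ?x = (\<lambda>u. (fder (\<lambda>y. ?d V3 y (?l V2 ?x)) ?x u + ?d V3 ?x (?d V2 ?x u))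
       + (dGam c ?x u (?l V2 ?x) (?l V3 ?x) + Gam c ?x (?d V2 ?x u) (?l V3 ?x) + Gam c ?x (?l V2 ?x) (?d V3 ?x u)))"
      by (rule frechet_derivative_at[symmetric])
    show ?thesis
      unfolding l[symmetric] cov_vf_local[OF U c23 W(2)] d
      by (simp add: cov_vf_local[OF U V(3) W(2)] linear_add[OF Gam_linear2[OF xM]] algebra_simps)
  qed
  have L: "frame_coords A c p (lie_bracket A X Y p) = ?d Y ?x (?l X ?x) - ?d X ?x (?l Y ?x)"
    unfolding torsion_freeD[OF U(1) UM XYZ(1,2) p, symmetric] linear_diff[OF lin] l[symmetric]
    using cov_vf_local[OF U XYZ(2) W(2), of X] cov_vf_local[OF U XYZ(1) W(2), of Y]
      Gam_sym[OF xM, of "?l X ?x" "?l Y ?x"] by simp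
  have sy: "fder (\<lambda>y. ?d Z y a) ?x b = fder (\<lambda>y. ?d Z y b) ?x a" for a b
    by (rule second_derivative_symmetric_vec[OF s[OF XYZ(3)] W])
  have E3: "frame_coords A c p (cov D (lie_bracket A X Y) Z p) =
     ?d Z ?x (?d Y ?x (?l X ?x)) - ?d Z ?x (?d X ?x (?l Y ?x)) + Gam c ?x (?d Y ?x (?l X ?x)) (?l Z ?x) - Gam c ?x (?d X ?x (?l Y ?x)) (?l Z ?x)"
    using cov_local[OF U XYZ(3) p, of "lie_bracket A X Y p"]
    by (simp add: cov_def L linear_diff[OF dl[OF XYZ(3) W(2)]] linear_diff[OF Gam_linear1[OF xM]])
  show ?thesis
    unfolding curvature_def linear_diff[OF lin] nn[OF XYZ] nn[OF XYZ(2,1,3)] E3 l curv_coords_def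
    using sy[of "?l X ?x" "?l Y ?x", unfolded l] by (simp add: algebra_simps)
qed

lemma Ric_local:
  assumes p: "p \<in> cdom c" "p \<in> M"
  shows "Ric A D p u v = (\<Sum>i\<in>UNIV. curv_coords c (cmap c p) (axis i 1) (frame_coords A c p u) (frame_coords A c p v) $ i)"
proof -
  let ?c = "chart_at A p"
  note ca = chart_at[of p]
  let ?U = "cdom c \<inter> cdom ?c \<inter> M"
  have U: "open ?U" "?U \<subseteq> cdom c \<inter> M" "p \<in> ?U" using open_Int[OF open_Int[OF open_cdom[OF c] open_cdom[OF ca(1)]] open_minterior] p ca by auto
  have cf: "coord_field A ?c w \<in> vector_fields A ?U" for w
    by (rule coord_field_vector_field[OF ca(1)]) auto
  let ?F = "frame_coords A c p" and ?V = "frame_vec A c p"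
  let ?R = "\<lambda>z. curvature A D (coord_field A ?c z) (coord_field A ?c u) (coord_field A ?c v) p"
  let ?Q = "\<lambda>z. curv_coords c (cmap c p) z (?F u) (?F v)"
  have R: "?F (?R z) = ?Q (?F z)" for z
    using curvature_local[OF U(1,2) cf cf cf U(3)] by (simp add: coord_field_def)
  have xM: "cmap c p \<in> img c M" using p by auto
  have linQ: "linear ?Q"
  proof -
    show ?thesis
      unfolding curv_coords_def using linear_compose[OF Gam_linear1[OF xM] Gam_linear2[OF xM], unfolded o_def]
      by (intro linear_compose_add linear_compose_sub Gam_linear1[OF xM] dGam_linear1[OF xM] dGam_linear2[OF xM]) auto
  qed
  note linF = linear_frame_coords[OF c p(1)] and linV = linear_frame_vec[OF c p(1)]
  have "?R z = ?V (?Q (?F z))" for z using R[of z] c p frame_vec_frame_coords by metis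
  then have "matrix ?R = matrix (?V \<circ> (?Q \<circ> ?F))" by (simp add: o_def)
  also have "\<dots> = matrix ?V ** (matrix ?Q ** matrix ?F)"
    by (simp add: matrix_compose linF linV linQ linear_compose)
  finally have "trace (matrix ?R) = trace ((matrix ?Q ** matrix ?F) ** matrix ?V)"
    using trace_mul_sym[of "matrix ?V" "matrix ?Q ** matrix ?F"] by simp
  also have "(matrix ?Q ** matrix ?F) ** matrix ?V = matrix ?Q ** (matrix ?F ** matrix ?V)"
    by (simp add: matrix_mul_assoc)
  also have "matrix ?F ** matrix ?V = mat 1"
  proof -
    have "?F \<circ> ?V = id" using c p by (simp add: fun_eq_iff)
    then show ?thesis using matrix_compose[OF linV linF] matrix_id_mat_1 by metis
  qed
  finally have "trace (matrix ?R) = trace (matrix ?Q)" by simp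
  then show ?thesis by (simp add: Ric_def trace_def matrix_def)
qed

end

end

section \<open>Parallel densities in a chart\<close>

lemma has_derivative_abs_powr:
  fixes d :: "'b::real_normed_vector \<Rightarrow> real"
  assumes d: "(d has_derivative d') (at x)" and 0: "d x \<noteq> 0"
  shows "((\<lambda>y. \<bar>d y\<bar> powr \<alpha>) has_derivative (\<lambda>v. \<bar>d x\<bar> powr \<alpha> * (\<alpha> * (d' v / d x)))) (at x)"
proof -
  have eq: "(d y * d y) powr (\<alpha> / 2) = \<bar>d y\<bar> powr \<alpha>" for y
  proof (cases "d y = 0")
    case False
    have "ln (d y * d y) = 2 * ln \<bar>d y\<bar>" using False ln_mult[of "\<bar>d y\<bar>" "\<bar>d y\<bar>"] by simp
    then show ?thesis using False by (simp add: powr_def)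
  qed simp
  have "0 < d x * d x" using 0 by (metis not_real_square_gt_zero)
  then have "((\<lambda>y. (d y * d y) powr (\<alpha> / 2)) has_derivative
      (\<lambda>v. ((d x * d x) powr (\<alpha> / 2)) * (0 * ln (d x * d x) + (d x * d' v + d' v * d x) * (\<alpha> / 2) / (d x * d x)))) (at x)"
    by (intro has_derivative_powr has_derivative_mult d has_derivative_const) auto
  then show ?thesis unfolding eq using 0 by (simp add: field_simps)
qed

lemma has_derivative_matrix:
  fixes B :: "'b::real_normed_vector \<Rightarrow> real ^ 'k::finite \<Rightarrow> real ^ 'm::finite"
  assumes "\<And>u. ((\<lambda>y. B y u) has_derivative (\<lambda>v. B' v u)) (at x within S)"
  shows "((\<lambda>y. matrix (B y)) has_derivative (\<lambda>v. matrix (B' v))) (at x within S)"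
proof (subst has_derivative_componentwise_within, rule)
  fix b :: "real ^ 'k ^ 'm" assume "b \<in> Basis"
  then obtain i j where b: "b = axis i (axis j 1)" by (auto simp: Basis_vec_def)
  have "((\<lambda>y. B y (axis j 1) $ i) has_derivative (\<lambda>v. B' v (axis j 1) $ i)) (at x within S)"
    by (rule bounded_linear.has_derivative[OF bounded_linear_vec_nth assms])
  then show "((\<lambda>y. matrix (B y) \<bullet> b) has_derivative (\<lambda>v. matrix (B' v) \<bullet> b)) (at x within S)"
    by (simp add: b inner_axis matrix_def)
qed

context mfd begin

lemma density_factor_chart_at [simp]: "density_factor A w (chart_at A p) p = 1"
proof -
  have "trans_deriv (chart_at A p) (chart_at A p) p = id"
    using trans_deriv_self[OF chart_at] by auto
  then show ?thesis by (simp add: density_factor_def matrix_id_mat_1)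
qed

lemma det_trans_deriv:
  assumes "c \<in> A" "c' \<in> A" "c'' \<in> A" "p \<in> cdom c" "p \<in> cdom c'" "p \<in> cdom c''"
  shows "det (matrix (trans_deriv c c'' p)) = det (matrix (trans_deriv c' c'' p)) * det (matrix (trans_deriv c c' p))"
proof -
  have "trans_deriv c c'' p = trans_deriv c' c'' p \<circ> trans_deriv c c' p"
    using assms by (auto simp: trans_deriv_trans)
  then show ?thesis
    using matrix_compose[OF linear_trans_deriv[OF assms(1,2,4,5)] linear_trans_deriv[OF assms(2,3,5,6)]]
    by (simp add: det_mul)
qed

lemma det_trans_deriv_nonzero:
  assumes "c \<in> A" "c' \<in> A" "p \<in> cdom c" "p \<in> cdom c'"
  shows "det (matrix (trans_deriv c c' p)) \<noteq> 0"
proof -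
  have "trans_deriv c c p = id" using trans_deriv_self[OF assms(1,3)] by auto
  then show ?thesis using det_trans_deriv[of c c' c p] assms by (auto simp: matrix_id_mat_1)
qed

lemma density_factor_change:
  assumes "c \<in> A" "c' \<in> A" "p \<in> cdom c" "p \<in> cdom c'"
  shows "density_factor A w c p = \<bar>det (matrix (trans_deriv c c' p))\<bar> powr (- w / (real CARD('n) + 2)) * density_factor A w c' p"
  using assms by (simp add: density_factor_def det_trans_deriv[of c c' "chart_at A p"] chart_at abs_mult powr_mult mult.commute)

lemma density_factor_nonzero: "c \<in> A \<Longrightarrow> p \<in> cdom c \<Longrightarrow> density_factor A w c p \<noteq> 0"
  using det_trans_deriv_nonzero[of c "chart_at A p" p] chart_at[of p] by (simp add: density_factor_def)

end

text \<open>The density \<open>\<sigma>\<close> of weight one is nowhere zero and parallel on the interior; its existence is what makes the trace of the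
  Christoffel symbols a logarithmic derivative, and hence the Ricci tensor symmetric.\<close>

locale parallel_density_conn = conn +
  fixes \<sigma> :: "'a \<Rightarrow> real"
  assumes smooth: "smooth_density A 1 (minterior A) \<sigma>"
    and nonzero: "\<And>p. p \<in> minterior A \<Longrightarrow> \<sigma> p \<noteq> 0"
    and parallel: "parallel_density A (minterior A) D 1 \<sigma>"
begin

abbreviation sig :: "('a, 'b) chart \<Rightarrow> 'b coords \<Rightarrow> real" where
  "sig c \<equiv> density_local A 1 c \<sigma>"

definition trG :: "('a, 'b) chart \<Rightarrow> 'b coords \<Rightarrow> 'b coords \<Rightarrow> real" where
  "trG c x v = trace (matrix (Gam c x v))"

lemma sig_smooth: "c \<in> A \<Longrightarrow> smooth_on (img c M) (sig c)"
  using smooth by (auto simp: smooth_density_def)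

lemma sig_nonzero: "c \<in> A \<Longrightarrow> x \<in> img c M \<Longrightarrow> sig c x \<noteq> 0"
  using nonzero density_factor_nonzero[of c] by (auto simp: density_local_def)

text \<open>Parallelism is stated at each point in the chart selected there. Passing to the fixed chart \<open>c\<close>, the
  derivative of the density factor \<open>\<bar>det J\<bar> powr \<alpha>\<close> produces the trace of the logarithmic derivative of the
  Jacobian, and so does the transformation of the Christoffel symbols; the two contributions cancel.\<close>

lemma sig_derivative:
  assumes c: "c \<in> A" and x: "x \<in> img c M"
  shows "fder (sig c) x v = - 1 / (real CARD('b) + 2) * trG c x v * sig c x"
proof -
  obtain p where p: "p \<in> cdom c" "p \<in> M" and xp: "x = cmap c p" using x by blast
  let ?c = "chart_at A p" and ?N = "real CARD('b) + 2"
  define \<alpha> where "\<alpha> = - 1 / ?N"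
  note ca = chart_at[of p]
  let ?y = "cmap ?c p"
  let ?W = "img ?c (cdom c \<inter> M)"
  have W: "open ?W" "?y \<in> ?W" using open_image_interior[OF ca(1) open_cdom[OF c]] p ca by auto
  \<comment> \<open>The vector whose components in \<open>c\<close> are \<open>v\<close>, as seen in the chart selected at \<open>p\<close>.\<close>
  define v0 where "v0 = frame_vec A c p v"
  let ?B = "\<lambda>y. trans_deriv ?c c (cinv ?c y)"
  have By: "?B ?y = frame_coords A c p" using ca by (auto simp: frame_coords_def)
  define dB where "dB w u = fder (\<lambda>y. ?B y u) ?y w" for w u
  have sB: "smooth_on ?W (\<lambda>y. ?B y u)" for u
    by (rule smooth_on_subset[OF smooth_on_trans_deriv[OF ca(1) c]]) auto
  have dB: "((\<lambda>y. ?B y u) has_derivative (\<lambda>w. dB w u)) (at ?y)" for u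
    unfolding dB_def by (rule smooth_on_has_derivative[OF W(1) sB W(2)])
  note linF = linear_frame_coords[OF c p(1)] and linV = linear_frame_vec[OF c p(1)]
  let ?F = "frame_coords A c p" and ?V = "frame_vec A c p"
  have VF: "?V \<circ> ?F = id" and FV: "?F \<circ> ?V = id" using c p by (auto simp: fun_eq_iff)
  have NM: "matrix ?V ** matrix ?F = mat 1" and MN: "matrix ?F ** matrix ?V = mat 1"
    using matrix_compose[OF linF linV] matrix_compose[OF linV linF] VF FV by (metis matrix_id_mat_1)+
  let ?d = "\<lambda>y. det (matrix (?B y))"
  have d0: "?d ?y \<noteq> 0" using det_trans_deriv_nonzero[OF ca(1) c ca(2) p(1)] ca by simp
  have Dd: "(?d has_derivative (\<lambda>w. ?d ?y * trace (matrix ?V ** matrix (dB w)))) (at ?y)"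
    by (rule has_derivative_det[OF has_derivative_matrix[OF dB]]) (simp add: By NM)
  have Da: "((\<lambda>y. \<bar>?d y\<bar> powr \<alpha>) has_derivative
     (\<lambda>w. \<bar>?d ?y\<bar> powr \<alpha> * (\<alpha> * trace (matrix ?V ** matrix (dB w))))) (at ?y)"
    using has_derivative_abs_powr[OF Dd d0, of \<alpha>] d0 by simp
  have Ds: "(sig c has_derivative fder (sig c) x) (at x)"
    by (rule smooth_on_has_derivative[OF open_img_interior[OF c] sig_smooth[OF c] x])
  have i1: "at ?y within half_space = at ?y" by (rule hderiv_interior[OF ca p(2)])
  have "((\<lambda>y. sig c (cmap c (cinv ?c y))) has_derivative (\<lambda>w. fder (sig c) x (?F w))) (at ?y)"
    using derivative_in_other_chart[OF ca(1) c ca(2) p(1) has_derivative_at_withinI[OF Ds[unfolded xp]]]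
    unfolding i1 xp frame_coords_def .
  from has_derivative_mult[OF Da this]
  have Dp: "((\<lambda>y. \<bar>?d y\<bar> powr \<alpha> * sig c (cmap c (cinv ?c y))) has_derivative
     (\<lambda>w. \<bar>?d ?y\<bar> powr \<alpha> * fder (sig c) x (?F w)
        + \<bar>?d ?y\<bar> powr \<alpha> * (\<alpha> * trace (matrix ?V ** matrix (dB w))) * sig c x)) (at ?y)"
    using ca xp by simp
  have se: "\<bar>?d y\<bar> powr \<alpha> * sig c (cmap c (cinv ?c y)) = sig ?c y" if "y \<in> ?W" for y
    using that c ca density_factor_change[OF ca(1) c, of _ 1] by (auto simp: density_local_def \<alpha>_def)
  have "(sig ?c has_derivative
     (\<lambda>w. \<bar>?d ?y\<bar> powr \<alpha> * fder (sig c) x (?F w)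
        + \<bar>?d ?y\<bar> powr \<alpha> * (\<alpha> * trace (matrix ?V ** matrix (dB w))) * sig c x)) (at ?y)"
    by (rule has_derivative_transform_within_open[OF Dp W se])
  then have cd: "coord_deriv A p v0 (sig ?c) = \<bar>?d ?y\<bar> powr \<alpha> * fder (sig c) x v
        + \<bar>?d ?y\<bar> powr \<alpha> * (\<alpha> * trace (matrix ?V ** matrix (dB v0))) * sig c x"
    unfolding coord_deriv_hderiv i1 using c p by (simp add: frechet_derivative_at[symmetric] v0_def)
  let ?U = "cdom c \<inter> cdom ?c \<inter> M"
  have U: "open ?U" "?U \<subseteq> cdom c \<inter> M" "p \<in> ?U"
    using open_Int[OF open_Int[OF open_cdom[OF c] open_cdom[OF ca(1)]] open_minterior] p ca by auto
  have cf: "coord_field A ?c u \<in> vector_fields A ?U" for u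
    by (rule coord_field_vector_field[OF ca(1)]) auto
  have x': "cmap c p \<in> img c ?U" "open (img c ?U)" using p ca open_image_interior[OF c open_cdom[OF ca(1)]]
    by (auto simp: Int_assoc)
  have fd: "fder (vf_local A c (coord_field A ?c u)) x v = dB v0 u" for u
  proof -
    have 1: "(vf_local A c (coord_field A ?c u) has_derivative fder (vf_local A c (coord_field A ?c u)) x) (at x)"
      unfolding xp by (rule smooth_on_has_derivative[OF x'(2) smooth_on_vf_local[OF c cf] x'(1)])
    have "((\<lambda>y. vf_local A c (coord_field A ?c u) (cmap c (cinv ?c y))) has_derivative
       (\<lambda>w. fder (vf_local A c (coord_field A ?c u)) x (?F w))) (at ?y)"
      using derivative_in_other_chart[OF ca(1) c ca(2) p(1) has_derivative_at_withinI[OF 1[unfolded xp]]]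
      unfolding i1 xp frame_coords_def .
    then have "((\<lambda>y. ?B y u) has_derivative
       (\<lambda>w. fder (vf_local A c (coord_field A ?c u)) x (?F w))) (at ?y)"
      by (rule has_derivative_transform_within_open[OF _ W])
        (use c ca in \<open>auto simp: vf_local_def coord_field_def frame_coords_frame_vec_other\<close>)
    from has_derivative_unique[OF this dB] have "fder (vf_local A c (coord_field A ?c u)) x (?F v0) = dB v0 u"
      by meson
    then show ?thesis using c p by (simp add: v0_def)
  qed
  have DF: "D p v0 (coord_field A ?c u) = ?V (dB v0 u) + ?V (Gam c x v (?F u))" for u
  proof -
    have "?F (D p v0 (coord_field A ?c u)) = dB v0 u + Gam c x v (?F u)"
      using cov_local[OF c U(1,2) cf U(3), of v0 u] c p fd[of u]
      by (simp add: v0_def xp vf_local_def coord_field_def)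
    then have "D p v0 (coord_field A ?c u) = ?V (dB v0 u + Gam c x v (?F u))"
      using c p frame_vec_frame_coords by metis
    then show ?thesis by (simp add: linear_add[OF linV])
  qed
  have linG: "linear (Gam c x v)" by (rule Gam_linear2[OF c x])
  have linB: "linear (dB v0)"
  proof -
    have ln: "linear (?B y)" if "y \<in> ?W" for y
      using that linear_trans_deriv[OF ca(1) c] ca by auto
    have a: "((\<lambda>y. ?B y (a + b)) has_derivative (\<lambda>w. dB w a + dB w b)) (at ?y)" for a b
      by (rule has_derivative_transform_within_open[OF has_derivative_add[OF dB dB] W]) (simp add: linear_add[OF ln])
    have b: "((\<lambda>y. ?B y (r *\<^sub>R a)) has_derivative (\<lambda>w. r *\<^sub>R dB w a)) (at ?y)" for a r
      by (rule has_derivative_transform_within_open[OF has_derivative_scaleR_right[OF dB] W]) (simp add: linear_cmul[OF ln])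
    show ?thesis
      using has_derivative_unique[OF a dB] has_derivative_unique[OF b dB] by (intro linearI) (metis)+
  qed
  have "matrix (\<lambda>u. D p v0 (coord_field A ?c u)) = matrix (?V \<circ> dB v0) + matrix (?V \<circ> (Gam c x v \<circ> ?F))"
    by (simp add: DF matrix_def vec_eq_iff)
  also have "\<dots> = matrix ?V ** matrix (dB v0) + matrix ?V ** (matrix (Gam c x v) ** matrix ?F)"
    by (simp add: matrix_compose linV linB linG linF linear_compose)
  finally have "trace (matrix (\<lambda>u. D p v0 (coord_field A ?c u))) = trace (matrix ?V ** matrix (dB v0)) + trG c x v"
    using trace_mul_sym[of "matrix ?V" "matrix (Gam c x v) ** matrix ?F"]
    by (simp add: trace_add trG_def matrix_mul_assoc[symmetric] MN)
  moreover have "cov_density A D 1 p v0 \<sigma> = 0" using parallel p by (simp add: parallel_density_def)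
  moreover have "\<sigma> p = \<bar>?d ?y\<bar> powr \<alpha> * sig c x"
    using se[OF W(2)] ca c p xp by (simp add: density_local_def)
  ultimately have "\<bar>?d ?y\<bar> powr \<alpha> * (fder (sig c) x v - \<alpha> * trG c x v * sig c x) = 0"
    unfolding cov_density_def Let_def cd by (simp add: \<alpha>_def algebra_simps)
  then show ?thesis using d0 by (simp add: \<alpha>_def)
qed

end

section \<open>The Hessian of a parallel density in a chart\<close>

context mfd begin

lemma local_defining_functionD:
  assumes "local_defining_function A U \<rho>"
  shows "open U" "smooth_fun A U \<rho>" "\<And>p. p \<in> U \<Longrightarrow> p \<in> minterior A \<Longrightarrow> \<rho> p \<noteq> 0"
    "\<And>p. p \<in> U \<Longrightarrow> p \<in> mboundary A \<Longrightarrow> \<rho> p = 0"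
  using assms by (auto simp: local_defining_function_def minterior_def)

end

context parallel_density_conn begin

abbreviation hess :: "('a \<Rightarrow> real) \<Rightarrow> 'a \<Rightarrow> 'b coords \<Rightarrow> 'b coords \<Rightarrow> real" where
  "hess \<rho> \<equiv> hess_density A (conn_rho A D \<rho>) 1 \<sigma>"

text \<open>The factor by which \<open>\<sigma>\<close> is multiplied in its Hessian for the connection \<open>\<nabla> + \<Upsilon>\<close>, \<open>\<Upsilon> = dr / r\<close>: since
  \<open>\<nabla>\<sigma> = 0\<close>, it is \<open>(\<nabla>\<Upsilon>)(a, b) - \<Upsilon>(a) \<Upsilon>(b)\<close>.\<close>

definition hess_coords :: "('a, 'b) chart \<Rightarrow> ('b coords \<Rightarrow> real) \<Rightarrow> 'b coords \<Rightarrow> 'b coords \<Rightarrow> 'b coords \<Rightarrow> real" where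
  "hess_coords c r x a b =
     (fder (\<lambda>y. fder r y b) x a - fder r x (Gam c x a b)) / r x
     - 2 * fder r x a * fder r x b / (r x)\<^sup>2"

text \<open>The symmetric change by \<open>\<Upsilon>\<close> adds \<open>\<Upsilon>(v)\<close> times the identity, of trace \<open>n + 1\<close>, and a map of rank one with
  trace \<open>\<Upsilon>(v)\<close>; the weight normalisation \<open>1 / (n + 2)\<close> turns the sum into \<open>\<Upsilon>(v)\<close>.\<close>

lemma cov_density_rho:
  assumes p: "p \<in> M" and lin: "linear (dfun A \<rho> p)"
  shows "cov_density A (conn_rho A D \<rho>) 1 p v s = cov_density A D 1 p v s + dfun A \<rho> p v / \<rho> p * s p"
proof -
  let ?c = "chart_at A p"
  let ?Y = "\<lambda>v. dfun A \<rho> p v / \<rho> p"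
  have cf: "coord_field A ?c u p = u" for u by (simp add: coord_field_def)
  have "matrix (\<lambda>u. conn_rho A D \<rho> p v (coord_field A ?c u))
      = matrix (\<lambda>u. D p v (coord_field A ?c u)) + matrix (\<lambda>u. ?Y v *\<^sub>R u) + matrix (\<lambda>u. ?Y u *\<^sub>R v)"
    by (simp add: conn_rho_def proj_change_def matrix_def vec_eq_iff cf)
  moreover have "trace (matrix (\<lambda>u::'b coords. ?Y v *\<^sub>R u)) = (real CARD('b) + 1) * ?Y v"
    by (simp add: trace_def matrix_def)
  moreover have "trace (matrix (\<lambda>u. ?Y u *\<^sub>R v)) = ?Y v"
  proof -
    have "trace (matrix (\<lambda>u. ?Y u *\<^sub>R v)) = (\<Sum>i\<in>UNIV. v $ i *\<^sub>R dfun A \<rho> p (axis i 1)) / \<rho> p"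
      by (simp add: trace_def matrix_def sum_divide_distrib mult.commute)
    also have "(\<Sum>i\<in>UNIV. v $ i *\<^sub>R dfun A \<rho> p (axis i 1)) = dfun A \<rho> p v"
      by (rule linear_axis_expansion[OF lin, symmetric])
    finally show ?thesis .
  qed
  ultimately have "trace (matrix (\<lambda>u. conn_rho A D \<rho> p v (coord_field A ?c u)))
     = trace (matrix (\<lambda>u. D p v (coord_field A ?c u))) + (real CARD('b) + 2) * ?Y v"
    by (simp add: trace_add add_divide_distrib algebra_simps)
  then show ?thesis by (simp add: cov_density_def Let_def field_simps)
qed

text \<open>For the parallel density the covariant derivative is \<open>\<Upsilon>\<close> times \<open>\<sigma>\<close> in every frame. So the Hessian needs
  no change of charts for densities, only the derivative of the function \<open>\<Upsilon>(V)\<close>, which is computed in \<open>c\<close>.\<close>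

lemma hess_local:
  assumes \<rho>: "local_defining_function A U \<rho>" and c: "c \<in> A" and p: "p \<in> U" "p \<in> cdom c" "p \<in> M"
  shows "hess \<rho> p u v
     = \<sigma> p * hess_coords c (\<lambda>x. \<rho> (cinv c x)) (cmap c p) (frame_coords A c p u) (frame_coords A c p v)"
proof -
  note \<rho>D = local_defining_functionD[OF \<rho>]
  let ?c = "chart_at A p"
  note ca = chart_at[of p]
  let ?r = "\<lambda>x. \<rho> (cinv c x)" and ?x = "cmap c p" and ?y = "cmap ?c p"
  let ?U = "U \<inter> cdom c \<inter> cdom ?c \<inter> M"
  have U: "open ?U" "?U \<subseteq> cdom c \<inter> M" "p \<in> ?U"
    using open_Int[OF open_Int[OF open_Int[OF \<rho>D(1) open_cdom[OF c]] open_cdom[OF ca(1)]] open_minterior] p ca by auto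
  have W: "open (img c ?U)" "?x \<in> img c ?U" and xM: "?x \<in> img c M"
    using p ca open_image_interior[OF c U(1)] by (auto simp: Int_absorb2)
  have W': "open (img ?c ?U)" "?y \<in> img ?c ?U"
    using p ca open_image_interior[OF ca(1) U(1)] by (auto simp: Int_assoc)
  have sr: "smooth_on (img c ?U) ?r"
    by (rule smooth_on_subset[OF smooth_on_fun_local[OF c \<rho>D(2)]]) auto
  have hd: "hderiv ?r (cmap c q) = fder ?r (cmap c q)" if "q \<in> ?U" for q
    using hderiv_interior[OF c, of q] that by simp
  have df: "dfun A \<rho> q w = fder ?r (cmap c q) (frame_coords A c q w)" if "q \<in> ?U" for q w
    using dfun_smooth[OF c \<rho>D(1,2), of q w] hd[OF that] that by simp
  have linr: "linear (fder ?r x)" if "x \<in> img c ?U" for x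
    using has_derivative_bounded_linear[OF smooth_on_has_derivative[OF W(1) sr that]] bounded_linear.linear by blast
  have lin: "linear (dfun A \<rho> q)" if "q \<in> ?U" for q
  proof -
    have "linear (fder ?r (cmap c q) \<circ> frame_coords A c q)"
      using that by (intro linear_compose linear_frame_coords c linr) auto
    moreover have "dfun A \<rho> q = fder ?r (cmap c q) \<circ> frame_coords A c q"
      using df[OF that] by auto
    ultimately show ?thesis by simp
  qed
  have cs: "cov_density A (conn_rho A D \<rho>) 1 q w \<sigma> = dfun A \<rho> q w / \<rho> q * \<sigma> q" if "q \<in> ?U" for q w
    using cov_density_rho[OF _ lin[OF that], of w \<sigma>] parallel that by (simp add: parallel_density_def)
  define V where "V = coord_field A ?c v"
  have V: "V \<in> vector_fields A ?U" unfolding V_def by (rule coord_field_vector_field[OF ca(1)]) auto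
  have Vp: "V p = v" by (simp add: V_def coord_field_def)
  let ?l = "vf_local A c V"
  let ?a = "frame_coords A c p u" and ?b = "frame_coords A c p v"
  have lx: "?l ?x = ?b" using c p by (simp add: vf_local_def Vp)
  let ?dr = "frechet_derivative ?r"
  let ?dl = "fder ?l ?x"
  let ?g = "\<lambda>x. ?dr (at x) (?l x) / ?r x"
  have rx: "?r ?x \<noteq> 0" using \<rho>D(3) c p by simp
  have D1: "((\<lambda>x. ?dr (at x) (?l x)) has_derivative
     (\<lambda>w. fder (\<lambda>y. ?dr (at y) ?b) ?x w + ?dr (at ?x) (?dl w))) (at ?x)"
    using has_derivative_linear_family[OF W linr smooth_on_has_derivative[OF W(1) smooth_on_derivative[OF W(1) sr] W(2)]
        smooth_on_has_derivative[OF W(1) smooth_on_vf_local[OF c V] W(2)]] by (simp add: lx)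
  have Dr: "(?r has_derivative ?dr (at ?x)) (at ?x)" by (rule smooth_on_has_derivative[OF W(1) sr W(2)])
  note Dg = has_derivative_divide'[OF D1 Dr rx]
  define g' where "g' w = ((fder (\<lambda>y. ?dr (at y) ?b) ?x w + ?dr (at ?x) (?dl w)) * ?r ?x
      - ?dr (at ?x) (?l ?x) * ?dr (at ?x) w) / (?r ?x * ?r ?x)" for w
  have Dg: "(?g has_derivative g') (at ?x)"
    using Dg unfolding g'_def .
  have i1: "at ?y within half_space = at ?y" by (rule hderiv_interior[OF ca p(3)])
  have Dg': "((\<lambda>y. ?g (cmap c (cinv ?c y))) has_derivative (\<lambda>w. g' (frame_coords A c p w))) (at ?y)"
    using derivative_in_other_chart[OF ca(1) c ca(2) p(2) has_derivative_at_withinI[OF Dg]]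
    unfolding i1 frame_coords_def .
  have Ds: "(sig ?c has_derivative fder (sig ?c) ?y) (at ?y)"
    by (rule smooth_on_has_derivative[OF open_img_interior[OF ca(1)] sig_smooth[OF ca(1)]]) (use p ca in auto)
  let ?f = "\<lambda>q. cov_density A (conn_rho A D \<rho>) 1 q (V q) \<sigma>"
  have fq: "?f q = ?g (cmap c q) * \<sigma> q" if "q \<in> ?U" for q
    using that c by (simp add: cs[OF that] df[OF that] vf_local_def)
  have sp: "sig ?c ?y = \<sigma> p" using ca by (simp add: density_local_def)
  have "((\<lambda>y. ?g (cmap c (cinv ?c y)) * sig ?c y) has_derivative
     (\<lambda>w. ?g ?x * fder (sig ?c) ?y w + g' (frame_coords A c p w) * \<sigma> p)) (at ?y)"
    using has_derivative_mult[OF Dg' Ds] ca sp by simp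
  then have "(density_local A 1 ?c ?f has_derivative
     (\<lambda>w. ?g ?x * fder (sig ?c) ?y w + g' (frame_coords A c p w) * \<sigma> p)) (at ?y)"
  proof (rule has_derivative_transform_within_open[OF _ W'])
    fix y assume "y \<in> img ?c ?U"
    then obtain q where q: "q \<in> ?U" "y = cmap ?c q" by blast
    then show "?g (cmap c (cinv ?c y)) * sig ?c y = density_local A 1 ?c ?f y"
      using fq[OF q(1)] ca by (simp add: density_local_def)
  qed
  then have cd: "coord_deriv A p u (density_local A 1 ?c ?f)
      = ?g ?x * fder (sig ?c) ?y u + g' ?a * \<sigma> p"
    unfolding coord_deriv_hderiv i1 by (simp add: frechet_derivative_at[symmetric])
  have cds: "coord_deriv A p u (sig ?c) = fder (sig ?c) ?y u"
    unfolding coord_deriv_hderiv i1 ..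
  obtain T where T: "cov_density A (conn_rho A D \<rho>) 1 p u s = coord_deriv A p u (density_local A 1 ?c s) + T * s p" for s
    unfolding cov_density_def Let_def by blast
  have "cov_density A (conn_rho A D \<rho>) 1 p u ?f = ?g ?x * cov_density A (conn_rho A D \<rho>) 1 p u \<sigma> + g' ?a * \<sigma> p"
    unfolding T cd cds fq[OF U(3)] by (simp add: algebra_simps add_divide_distrib)
  also have "\<dots> = ?dr (at ?x) ?b / ?r ?x * (?dr (at ?x) ?a / ?r ?x * \<sigma> p) + g' ?a * \<sigma> p"
    using c p by (simp add: cs[OF U(3)] df[OF U(3)] lx)
  finally have 1: "cov_density A (conn_rho A D \<rho>) 1 p u ?f = \<dots>" .
  let ?DV = "conn_rho A D \<rho> p u V"
  have "frame_coords A c p ?DV = ?dl ?a + Gam c ?x ?a ?b + (?dr (at ?x) ?a / ?r ?x) *\<^sub>R ?b + (?dr (at ?x) ?b / ?r ?x) *\<^sub>R ?a"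
    using cov_local[OF c U(1,2) V U(3), of u] c p
    by (simp add: conn_rho_def proj_change_def linear_add[OF linear_frame_coords] linear_cmul[OF linear_frame_coords] df[OF U(3)] lx Vp)
  then have 2: "cov_density A (conn_rho A D \<rho>) 1 p ?DV \<sigma>
     = (?dr (at ?x) (?dl ?a) + ?dr (at ?x) (Gam c ?x ?a ?b) + 2 * ?dr (at ?x) ?a * ?dr (at ?x) ?b / ?r ?x) / ?r ?x * \<sigma> p"
    using c p linr[OF W(2)] by (simp add: cs[OF U(3)] df[OF U(3)] linear_add linear_cmul algebra_simps)
  show ?thesis
    unfolding hess_density_def Let_def V_def[symmetric] 1 2 hess_coords_def g'_def lx
    using rx by (simp add: field_simps power2_eq_square)
qed

end

section \<open>Extension across the boundary of the half space\<close>

lemma extends_at_tendsto: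
  assumes "extends_at W x f l" shows "(f \<longlongrightarrow> l) (at x within W)"
proof -
  obtain V g where V: "open V" "x \<in> V" "smooth_on V g" "\<And>y. y \<in> V \<Longrightarrow> y \<in> W \<Longrightarrow> f y = g y" "g x = l"
    using extends_atE[OF assms] by metis
  have "continuous_on V g" using V(3) by (rule smooth_on_imp_continuous_on)
  then have "(g \<longlongrightarrow> l) (at x)" using V(1,2,5) continuous_on_eq_continuous_at isCont_def by blast
  then have g: "(g \<longlongrightarrow> l) (at x within W)" by (rule tendsto_within_subset) simp
  have "eventually (\<lambda>y. y \<in> V) (nhds x)" using V(1,2) by (simp add: eventually_nhds_in_open)
  then have e: "eventually (\<lambda>y. f y = g y) (at x within W)"
    unfolding eventually_at_filter by eventually_elim (use V(4) in auto)
  show ?thesis using g tendsto_cong[OF e] by simp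
qed

lemma extends_at_unique:
  assumes "extends_at W x f l" "extends_at W x f m" "at x within W \<noteq> bot" shows "l = m"
  using tendsto_unique[OF assms(3)] extends_at_tendsto assms(1,2) by blast

lemma extends_at_derivative:
  assumes "extends_at W x f l" "open W"
  shows "\<exists>l'. extends_at W x (\<lambda>y. fder f y v) l'"
proof -
  obtain V g where V: "open V" "x \<in> V" "smooth_on V g" "\<And>y. y \<in> V \<Longrightarrow> y \<in> W \<Longrightarrow> f y = g y" "g x = l"
    using extends_atE[OF assms(1)] by metis
  have "fder f y v = fder g y v" if y: "y \<in> V" "y \<in> W" for y
  proof -
    have "(f has_derivative fder g y) (at y)"
      by (rule has_derivative_transform_within_open[OF smooth_on_has_derivative[OF V(1,3) y(1)], of "V \<inter> W"])
        (use V assms(2) y in auto)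
    then show ?thesis by (metis frechet_derivative_at)
  qed
  then have "extends_at W x (\<lambda>y. fder f y v) (fder g x v)"
    using smooth_on_derivative[OF V(1,3)] by (intro extends_atI[OF V(1,2)]) auto
  then show ?thesis ..
qed

abbreviation e0 :: "'n::finite coords" where "e0 \<equiv> axis None 1"

text \<open>Boxes are stable under sliding points vertically towards a height \<open>t\<close> between \<open>0\<close> and \<open>\<epsilon>\<close>. The height \<open>0\<close> is
  used for \<open>hadamard_boundary\<close>, the positive height \<open>\<epsilon>\<close> for \<open>ode_extends_to_boundary\<close>.\<close>

lemma box_around_boundary_point:
  fixes x :: "'n::finite coords"
  assumes "open T" "x \<in> T" "x $ None = 0"
  obtains B \<epsilon> where "open B" "x \<in> B" "B \<subseteq> T" "0 < \<epsilon>"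
    "\<And>y s t. y \<in> B \<Longrightarrow> 0 \<le> s \<Longrightarrow> s \<le> 1 \<Longrightarrow> 0 \<le> t \<Longrightarrow> t \<le> \<epsilon> \<Longrightarrow> y + (s * (t - y $ None)) *\<^sub>R e0 \<in> B"
proof -
  obtain e where e: "0 < e" "ball x e \<subseteq> T" using assms openE by blast
  obtain a b where ab: "x \<in> box a b" "box a b \<subseteq> ball x e" using rational_boxes[OF e(1), of x] by blast
  have m: "y \<in> box a b \<longleftrightarrow> (\<forall>i. a $ i < y $ i \<and> y $ i < b $ i)" for y by (simp add: mem_box_cart)
  have 0: "a $ None < 0" "0 < b $ None" using ab(1) assms(3) m by metis+
  show ?thesis
  proof
    show "0 < b $ None / 2" using 0 by simp
    fix y and s t :: real assume y: "y \<in> box a b" and s: "0 \<le> s" "s \<le> 1" "0 \<le> t" "t \<le> b $ None / 2"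
    have t: "a $ None < t" "t < b $ None" using 0 s by auto
    have y0: "a $ None < y $ None" "y $ None < b $ None" using y m by auto
    have "a $ None < y $ None + s * (t - y $ None) \<and> y $ None + s * (t - y $ None) < b $ None"
    proof (cases "y $ None \<le> t")
      case True
      then have "0 \<le> s * (t - y $ None)" "s * (t - y $ None) \<le> 1 * (t - y $ None)"
        using s mult_right_mono[of s 1 "t - y $ None"] by simp_all
      then show ?thesis using t y0 by auto
    next
      case False
      then have "0 \<le> s * (y $ None - t)" "s * (y $ None - t) \<le> 1 * (y $ None - t)"
        using s mult_right_mono[of s 1 "y $ None - t"] by simp_all
      then show ?thesis using t y0 by (auto simp: algebra_simps)
    qed
    then show "y + (s * (t - y $ None)) *\<^sub>R e0 \<in> box a b" using y by (auto simp: m axis_def)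
  qed (use ab e in auto)
qed

lemma at_boundary_nontrivial:
  fixes x :: "'n::finite coords"
  assumes "open T" "x \<in> T" "x $ None = 0" "\<And>y. y \<in> T \<Longrightarrow> 0 < y $ None \<Longrightarrow> y \<in> W"
  shows "at x within W \<noteq> bot"
proof -
  have "x islimpt W"
  proof (subst islimpt_approachable, intro allI impI)
    fix e :: real assume e: "0 < e"
    obtain r where r: "0 < r" "ball x r \<subseteq> T" using assms openE by blast
    define d where "d = min e r / 2"
    have d: "0 < d" "d < e" "d < r" using e r by (auto simp: d_def min_def)
    have "x + d *\<^sub>R e0 \<in> T" using r d by (auto simp: dist_norm subset_iff norm_axis_1)
    then have "x + d *\<^sub>R e0 \<in> W" using assms d by (auto simp: axis_def)
    moreover have "x + d *\<^sub>R e0 \<noteq> x" "dist (x + d *\<^sub>R e0) x < e"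
      using d by (auto simp: dist_norm norm_axis_1 axis_eq_0_iff)
    ultimately show "\<exists>x'\<in>W. x' \<noteq> x \<and> dist x' x < e" by blast
  qed
  then show ?thesis by (simp add: trivial_limit_within)
qed

lemma line_derivative:
  fixes x e :: "'b::real_normed_vector"
  assumes "open B" "smooth_on B f" "x + (s * a) *\<^sub>R e \<in> B"
  shows "((\<lambda>s. f (x + (s * a) *\<^sub>R e)) has_derivative (\<lambda>d. (d * a) *\<^sub>R fder f (x + (s * a) *\<^sub>R e) e)) (at s within X)"
proof -
  note D = smooth_on_has_derivative[OF assms]
  interpret bounded_linear "fder f (x + (s * a) *\<^sub>R e)"
    using D by (rule has_derivative_bounded_linear)
  have "((\<lambda>s. x + (s * a) *\<^sub>R e) has_derivative (\<lambda>d. (d * a) *\<^sub>R e)) (at s within X)"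
    by (auto intro!: derivative_eq_intros)
  from has_derivative_compose[OF this D] show ?thesis by (simp add: scaleR)
qed

text \<open>Hadamard's lemma: \<open>g\<close> is \<open>y $ None\<close> times the mean of its vertical derivative over the segment from \<open>y\<close>
  down to the boundary hyperplane, and this mean is smooth across the boundary.\<close>

lemma hadamard_boundary:
  fixes x :: "'n::finite coords"
  assumes x: "x $ None = 0" and V: "open V" "x \<in> V" "smooth_on V g" and 0: "\<And>y. y \<in> V \<Longrightarrow> y $ None = 0 \<Longrightarrow> g y = 0"
  shows "extends_at {y. 0 < y $ None} x (\<lambda>y. g y / y $ None) (fder g x e0)"
proof -
  obtain B \<epsilon> where B: "open B" "x \<in> B" "B \<subseteq> V" "0 < \<epsilon>"
    "\<And>y s t. y \<in> B \<Longrightarrow> 0 \<le> s \<Longrightarrow> s \<le> 1 \<Longrightarrow> 0 \<le> t \<Longrightarrow> t \<le> \<epsilon> \<Longrightarrow> y + (s * (t - y $ None)) *\<^sub>R e0 \<in> B"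
    using box_around_boundary_point[OF V(1,2) x] by metis
  have g: "smooth_on B g" using V(3) B(3) by (rule smooth_on_subset)
  have line: "y + (s * (0 - y \<bullet> e0)) *\<^sub>R e0 \<in> B" if "y \<in> B" "s \<in> {0..1}" for s y
    using B(5)[of y s 0] that B(4) by (simp add: inner_axis)
  let ?h = "\<lambda>y. integral {0..1} (\<lambda>s. fder g (y + (s * (0 - y \<bullet> e0)) *\<^sub>R e0) e0)"
  have h: "smooth_on B ?h"
    by (rule smooth_on_integral_along_line[OF B(1) line smooth_on_derivative[OF B(1) g]])
  have gh: "g y = y $ None * ?h y" if y: "y \<in> B" for y
  proof -
    have "((\<lambda>s. (0 - y \<bullet> e0) *\<^sub>R fder g (y + (s * (0 - y \<bullet> e0)) *\<^sub>R e0) e0) has_integral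
       g (y + (1 * (0 - y \<bullet> e0)) *\<^sub>R e0) - g (y + (0 * (0 - y \<bullet> e0)) *\<^sub>R e0)) {0..1}"
    proof (rule fundamental_theorem_of_calculus)
      fix s :: real assume "s \<in> {0..1}"
      from line_derivative[OF B(1) g line[OF y this]]
      show "((\<lambda>s. g (y + (s * (0 - y \<bullet> e0)) *\<^sub>R e0)) has_vector_derivative
        (0 - y \<bullet> e0) *\<^sub>R fder g (y + (s * (0 - y \<bullet> e0)) *\<^sub>R e0) e0) (at s within {0..1})"
        by (simp add: has_vector_derivative_def mult.assoc)
    qed simp
    from integral_unique[OF this] have "integral {0..1} (\<lambda>s. (0 - y \<bullet> e0) *\<^sub>R fder g (y + (s * (0 - y \<bullet> e0)) *\<^sub>R e0) e0)
       = g (y + (1 * (0 - y \<bullet> e0)) *\<^sub>R e0) - g y" by simp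
    moreover have "g (y + (1 * (0 - y \<bullet> e0)) *\<^sub>R e0) = 0"
    proof (rule 0)
      show "y + (1 * (0 - y \<bullet> e0)) *\<^sub>R e0 \<in> V" using line[OF y, of 1] B(3) by auto
      show "(y + (1 * (0 - y \<bullet> e0)) *\<^sub>R e0) $ None = 0" unfolding inner_axis by (simp add: axis_def)
    qed
    ultimately show ?thesis by (simp add: inner_axis)
  qed
  show ?thesis
    by (rule extends_atI[OF B(1,2) h]) (use gh x in \<open>auto simp: inner_axis\<close>)
qed

text \<open>Solving the equation along vertical lines, started at height \<open>\<epsilon>\<close> inside \<open>W\<close>, expresses \<open>f\<close> by its smooth
  values at that height and the exponential of an integral of the extension of \<open>k\<close>. The expression
  makes sense and is smooth and nonzero in a full neighbourhood of the boundary point.\<close>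

lemma ode_extends_to_boundary:
  fixes x :: "'n::finite coords" and f :: "'n coords \<Rightarrow> real"
  assumes x: "x $ None = 0" and T: "open T" "x \<in> T" "\<And>y. y \<in> T \<Longrightarrow> 0 < y $ None \<Longrightarrow> y \<in> W"
    and W: "open W" "W \<subseteq> {y. 0 < y $ None}" and f: "smooth_on W f" "\<And>y. y \<in> W \<Longrightarrow> f y \<noteq> 0"
    and ode: "\<And>y. y \<in> W \<Longrightarrow> fder f y e0 = k y * f y"
    and k: "extends_at W x k l"
  shows "\<exists>t. t \<noteq> 0 \<and> extends_at W x f t"
proof -
  obtain V g where V: "open V" "x \<in> V" "smooth_on V g" "\<And>y. y \<in> V \<Longrightarrow> y \<in> W \<Longrightarrow> k y = g y" "g x = l"
    using extends_atE[OF k] by metis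
  have VT: "open (V \<inter> T)" "x \<in> V \<inter> T" using V T by auto
  obtain B \<epsilon> where B: "open B" "x \<in> B" "B \<subseteq> V \<inter> T" "0 < \<epsilon>"
    "\<And>y s t. y \<in> B \<Longrightarrow> 0 \<le> s \<Longrightarrow> s \<le> 1 \<Longrightarrow> 0 \<le> t \<Longrightarrow> t \<le> \<epsilon> \<Longrightarrow> y + (s * (t - y $ None)) *\<^sub>R e0 \<in> B"
    using box_around_boundary_point[OF VT x] by metis
  have g: "smooth_on B g" using V(3) by (rule smooth_on_subset) (use B in auto)
  let ?L = "\<lambda>s y. y + (s * (\<epsilon> - y \<bullet> e0)) *\<^sub>R e0"
  have line: "?L s y \<in> B" if "y \<in> B" "s \<in> {0..1}" for s y
    using B(5)[of y s \<epsilon>] that B(4) by (simp add: inner_axis)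
  let ?h = "\<lambda>y. integral {0..1} (\<lambda>s. g (?L s y))"
  have h: "smooth_on B ?h"
    by (rule smooth_on_integral_along_line[OF B(1) line g])
  have L0: "?L s y $ None = y $ None + s * (\<epsilon> - y $ None)" for s y unfolding inner_axis by (simp add: axis_def)
  have 1: "?L 1 y \<in> W" if "y \<in> B" for y
    using line[OF that, of 1] B(3,4) L0[of y 1] by (intro T(3)) auto
  have sL: "smooth_on B (?L 1)"
    by (intro smooth_on_add smooth_on_scaleR smooth_on_mult smooth_on_diff smooth_on_inner smooth_on_const
        smooth_on_bounded_linear bounded_linear_ident)
  let ?F = "\<lambda>y. f (?L 1 y) * exp (- ((\<epsilon> - y \<bullet> e0) * ?h y))"
  have F: "smooth_on B ?F"
    by (intro smooth_on_mult smooth_on_exp smooth_on_minus h smooth_on_compose[OF f(1) sL] smooth_on_diff smooth_on_inner smooth_on_const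
        smooth_on_bounded_linear bounded_linear_ident) (use 1 in auto)
  have fF: "f y = ?F y" if y: "y \<in> B" "y \<in> W" for y
  proof -
    let ?a = "\<epsilon> - y \<bullet> e0"
    have LW: "?L s y \<in> W" if s: "s \<in> {0..1}" for s
    proof (rule T(3))
      have y0: "0 < y $ None" using y W by auto
      have "0 < (1 - s) * y $ None + s * \<epsilon>"
      proof (cases "s = 1")
        case False
        then have "0 < (1 - s) * y $ None" using s y0 by simp
        then show ?thesis using s B(4) by (simp add: add_pos_nonneg)
      qed (use B in simp)
      then show "0 < ?L s y $ None" unfolding L0 by (simp add: algebra_simps)
    qed (use line[OF y(1) s] B in auto)
    have cg: "continuous_on {0..1} (\<lambda>s. g (?L s y))"
      by (rule continuous_on_compose2[OF smooth_on_imp_continuous_on[OF g]])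
        (use line[OF y(1)] in \<open>auto intro!: continuous_intros\<close>)
    let ?G = "\<lambda>s. integral {0..s} (\<lambda>s. g (?L s y))"
    \<comment> \<open>The solution divided by the exponential factor is constant along the line.\<close>
    let ?P = "\<lambda>s. f (?L s y) * exp (- (?a * ?G s))"
    have "(?P has_derivative (\<lambda>d. 0)) (at s within {0..1})" if s: "s \<in> {0..1}" for s
    proof -
      have DG: "(?G has_derivative (\<lambda>d. d * g (?L s y))) (at s within {0..1})"
        using integral_has_real_derivative[OF cg s]
        by (auto simp: has_field_derivative_def mult.commute[of _ "g (?L s y)"] intro: has_derivative_eq_rhs)
      have kg: "k (?L s y) = g (?L s y)" using V(4) LW[OF s] line[OF y(1) s] B(3) by blast
      have Df: "((\<lambda>s. f (?L s y)) has_derivative (\<lambda>d. (d * ?a) *\<^sub>R (g (?L s y) * f (?L s y)))) (at s within {0..1})"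
        using line_derivative[OF W(1) f(1) LW[OF s], of "{0..1}"] ode[OF LW[OF s]] kg by simp
      have De: "((\<lambda>s. exp (- (?a * ?G s))) has_derivative (\<lambda>d. exp (- (?a * ?G s)) * (- (?a * (d * g (?L s y)))))) (at s within {0..1})"
        using DERIV_exp[unfolded has_field_derivative_def] has_derivative_minus[OF has_derivative_mult_right[OF DG]]
        by (rule has_derivative_compose[rotated])
      show ?thesis
        by (rule has_derivative_eq_rhs[OF has_derivative_mult[OF Df De]]) (auto simp: algebra_simps)
    qed
    then have "\<exists>C. \<forall>s\<in>{0..1}. ?P s = C"
      by (rule has_derivative_zero_constant[OF convex_real_interval(5)])
    then obtain C where C: "\<forall>s\<in>{0..1}. ?P s = C" ..
    have "?P 0 = ?P 1"
      using bspec[OF C, of 0] bspec[OF C, of 1] by simp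
    then show ?thesis by simp
  qed
  have "?F x \<noteq> 0" using f(2)[OF 1[OF B(2)]] by simp
  then show ?thesis
    using extends_atI[OF B(1,2) F, of W f] fF by blast
qed

section \<open>Christoffel symbols near the boundary\<close>

text \<open>The quadratic part of the Ricci formula under the change \<open>K = G + \<Upsilon> \<otimes> id + id \<otimes> \<Upsilon>\<close> with
  \<open>\<Upsilon>(u) = u0 / z\<close>; here \<open>z\<close> stands for the transversal coordinate. The last term is compensated by the
  derivative of \<open>\<Upsilon>\<close> in \<open>x0_ric\<close>.\<close>

lemma projective_change_quadratic_terms:
  fixes G :: "'n::finite coords \<Rightarrow> 'n coords \<Rightarrow> 'n coords" and z :: real
  assumes lin: "\<And>u. linear (G u)" and sym: "\<And>u v. G u v = G v u" and z: "z \<noteq> 0"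
  defines "K \<equiv> \<lambda>u v. G u v + (u $ None / z) *\<^sub>R v + (v $ None / z) *\<^sub>R u"
  shows "z * ((\<Sum>i\<in>UNIV. G (axis i 1) (G b d) $ i) - (\<Sum>i\<in>UNIV. G b (G (axis i 1) d) $ i))
    = (\<Sum>j\<in>UNIV. (z * K b d $ j) * (\<Sum>i\<in>UNIV. K (axis i 1) (axis j 1) $ i))
      - (\<Sum>i\<in>UNIV. \<Sum>j\<in>UNIV. (z * K b (axis j 1) $ i) * K (axis i 1) d $ j)
      - real CARD('n) * K b d $ None + real CARD('n) * (b $ None * d $ None) / z"
proof -
  let ?e = "\<lambda>i. axis i 1 :: 'n coords"
  let ?n = "real CARD('n)"
  define tK where "tK w = (\<Sum>i\<in>UNIV. K (?e i) w $ i)" for w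
  have Ks: "K u v = K v u" for u v by (simp add: K_def sym add_ac)
  have Kl: "linear (K u)" for u
    unfolding K_def
    by (intro linear_compose_add lin linear_compose_scale_right linear_ident)
      (auto intro!: linearI simp: algebra_simps add_divide_distrib)
  have tKl: "linear tK"
    unfolding tK_def by (intro linear_compose_sum linearI ballI) (simp_all add: linear_add[OF Kl] linear_cmul[OF Kl])
  have tKe: "tK w = (\<Sum>j\<in>UNIV. w $ j * tK (?e j))" for w
    using linear_axis_expansion[OF tKl, of w] by simp
  have d1: "(\<Sum>i\<in>UNIV. (?e i $ None / z) * f i) = f None / z" for f :: "'n option \<Rightarrow> real"
    using sum_axis_component[of None "\<lambda>i. f i / z"] by simp
  have trG: "(\<Sum>i\<in>UNIV. G (?e i) w $ i) = tK w - (?n + 2) * (w $ None / z)" for w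
  proof -
    have "tK w = (\<Sum>i\<in>UNIV. G (?e i) w $ i) + (\<Sum>i\<in>UNIV. (?e i $ None / z) * w $ i) + (\<Sum>i\<in>(UNIV::'n option set). w $ None / z)"
      by (simp add: tK_def K_def sum.distrib)
    then show ?thesis by (simp only: d1) (simp add: algebra_simps add_divide_distrib)
  qed
  have GK: "G u v = K u v - (u $ None / z) *\<^sub>R v - (v $ None / z) *\<^sub>R u" for u v by (simp add: K_def)
  have T3: "(\<Sum>i\<in>UNIV. G (?e i) (G b d) $ i)
     = tK (K b d) - (b $ None / z) * tK d - (d $ None / z) * tK b
       - (?n + 2) * ((K b d $ None - 2 * (b $ None * d $ None) / z) / z)"
  proof -
    have "tK (G b d) = tK (K b d) - (b $ None / z) * tK d - (d $ None / z) * tK b"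
      unfolding GK[of b d] by (simp add: linear_diff[OF tKl] linear_cmul[OF tKl])
    moreover have "G b d $ None = K b d $ None - 2 * (b $ None * d $ None) / z"
      unfolding GK[of b d] by (simp add: mult.commute)
    ultimately show ?thesis by (simp add: trG)
  qed
  have "(\<Sum>i\<in>UNIV. G b (G (?e i) d) $ i)
     = (\<Sum>i\<in>UNIV. K b (G (?e i) d) $ i) - (b $ None / z) * (\<Sum>i\<in>UNIV. G (?e i) d $ i)
       - (\<Sum>i\<in>UNIV. b $ i * G (?e i) d $ None) / z"
    unfolding GK[of b "G (?e i) d" for i]
    by (simp add: sum_subtractf sum_distrib_left sum_divide_distrib mult.commute)
  moreover have "(\<Sum>i\<in>UNIV. b $ i * G (?e i) d $ None) = G b d $ None"
    using linear_axis_expansion[OF lin, of d b] by (simp add: sym[of _ d])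
  moreover have "(\<Sum>i\<in>UNIV. K b (G (?e i) d) $ i) = (\<Sum>i\<in>UNIV. K b (K (?e i) d) $ i)
      - K b d $ None / z - (d $ None / z) * tK b"
  proof -
    have "(\<Sum>i\<in>UNIV. K b (G (?e i) d) $ i) = (\<Sum>i\<in>UNIV. K b (K (?e i) d) $ i)
      - (\<Sum>i\<in>UNIV. (?e i $ None / z) * K b d $ i) - (d $ None / z) * (\<Sum>i\<in>UNIV. K b (?e i) $ i)"
      unfolding GK[of "?e i" d for i]
      by (simp add: linear_diff[OF Kl] linear_cmul[OF Kl] sum_subtractf sum_distrib_left)
    then show ?thesis by (simp only: d1 tK_def Ks[of b])
  qed
  moreover have "(\<Sum>i\<in>UNIV. K b (K (?e i) d) $ i) = (\<Sum>i\<in>UNIV. \<Sum>j\<in>UNIV. K b (?e j) $ i * K (?e i) d $ j)"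
    by (intro sum.cong refl) (subst linear_axis_expansion[OF Kl], simp add: mult.commute)
  moreover have "G b d $ None = K b d $ None - 2 * (b $ None * d $ None) / z"
    unfolding GK[of b d] by (simp add: mult.commute)
  ultimately have T4: "(\<Sum>i\<in>UNIV. G b (G (?e i) d) $ i) = (\<Sum>i\<in>UNIV. \<Sum>j\<in>UNIV. K b (?e j) $ i * K (?e i) d $ j)
      - K b d $ None / z - (d $ None / z) * tK b
      - (b $ None / z) * (tK d - (?n + 2) * (d $ None / z)) - (K b d $ None - 2 * (b $ None * d $ None) / z) / z"
    by (simp only: trG)
  have S: "(\<Sum>i\<in>UNIV. \<Sum>j\<in>UNIV. (z * K b (?e j) $ i) * K (?e i) d $ j) = z * (\<Sum>i\<in>UNIV. \<Sum>j\<in>UNIV. K b (?e j) $ i * K (?e i) d $ j)"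
    by (simp add: sum_distrib_left mult.assoc)
  have S': "(\<Sum>j\<in>UNIV. (z * K b d $ j) * (\<Sum>i\<in>UNIV. K (?e i) (?e j) $ i)) = z * tK (K b d)"
    unfolding tK_def[symmetric] tKe[of "K b d"] by (simp add: sum_distrib_left mult.assoc)
  show ?thesis
    unfolding T3 T4 S S' using z by (simp add: field_simps)
qed

lemma extends_at_mono: "extends_at W x f l \<Longrightarrow> W' \<subseteq> W \<Longrightarrow> extends_at W' x f l"
  unfolding extends_at_def by blast

context mfd begin

lemma nontrivial_interior:
  assumes c: "c \<in> A" and p: "p \<in> cdom c" "p \<in> mboundary A" and U: "open U" "p \<in> U"
  shows "at (cmap c p) within img c (U \<inter> minterior A) \<noteq> bot"
proof -
  obtain T where T: "open T" "img c U = half_space \<inter> T"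
    using hopen_image[OF c U(1)] openin_open by blast
  have pT: "cmap c p \<in> T" using T(2) p U by blast
  have p0: "cmap c p $ None = 0" using mboundary_iff[OF c p(1)] p(2) by simp
  show ?thesis
  proof (rule at_boundary_nontrivial[OF T(1) pT p0])
    fix y assume y: "y \<in> T" "0 < y $ None"
    then have "y \<in> img c U" using T(2) by (auto simp: half_space_def)
    then show "y \<in> img c (U \<inter> minterior A)" using y minterior_iff[OF c] by blast
  qed
qed

end

locale pre_compact_conn = parallel_density_conn +
  assumes pre_compact: "projectively_pre_compact A D"
begin

text \<open>Together with \<open>boundary_invariance\<close> this supplies a defining function near every boundary point,
  so that \<open>\<Phi>\<close> is not vacuously specified.\<close>

lemma coordinate_defining_function:
  assumes c: "c \<in> A" shows "local_defining_function A (cdom c) (\<lambda>q. cmap c q $ None)"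
  unfolding local_defining_function_def
proof (intro conjI ballI)
  have D: "((\<lambda>x. cmap c (cinv c x) $ None) has_derivative (\<lambda>v. v $ None)) (at (cmap c p) within half_space)"
    if p: "p \<in> cdom c" for p
  proof -
    have 1: "((\<lambda>x. x $ None) has_derivative (\<lambda>v. v $ None)) (at (cmap c p) within half_space)"
      by (rule bounded_linear_imp_has_derivative[OF bounded_linear_vec_nth])
    show ?thesis
      by (rule hderiv_local(1)[OF hopen_image[OF c open_UNIV] _ _ 1]) (use c p in auto)
  qed
  show "open (cdom c)" by (rule open_cdom[OF c])
  show "smooth_fun A (cdom c) (\<lambda>q. cmap c q $ None)"
  proof (rule smooth_funI[OF c order_refl])
    have "smooth_on (img c (cdom c)) (\<lambda>x. x $ None)"
      by (rule smooth_on_bounded_linear[OF bounded_linear_vec_nth])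
    then show "smooth_on (img c (cdom c)) ((\<lambda>q. cmap c q $ None) \<circ> cinv c)"
      by (rule smooth_on_cong) (use c in auto)
  qed
  show "(cmap c p $ None = 0) = (p \<in> mboundary A)" if "p \<in> cdom c" for p
    using mboundary_iff[OF c that] by simp
  show "\<exists>v. dfun A (\<lambda>q. cmap c q $ None) p v \<noteq> 0" if "p \<in> cdom c \<inter> mboundary A" for p
    using dfun_chart[OF c _ D, of p "frame_vec A c p e0"] that c
    by (intro exI[of _ "frame_vec A c p e0"]) (simp add: axis_def)
qed

lemma dfun_coordinate:
  assumes c: "c \<in> A" and p: "p \<in> cdom c"
  shows "dfun A (\<lambda>q. cmap c q $ None) p v = frame_coords A c p v $ None"
proof (rule dfun_chart[OF c p])
  have 1: "((\<lambda>x. x $ None) has_derivative (\<lambda>v. v $ None)) (at (cmap c p) within half_space)"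
    by (rule bounded_linear_imp_has_derivative[OF bounded_linear_vec_nth])
  show "((\<lambda>x. cmap c (cinv c x) $ None) has_derivative (\<lambda>v. v $ None)) (at (cmap c p) within half_space)"
    by (rule hderiv_local(1)[OF hopen_image[OF c open_UNIV] _ _ 1]) (use c p in auto)
qed

text \<open>The Christoffel symbols in \<open>c\<close> of \<open>\<nabla> + dx0 / x0\<close>, where \<open>x0\<close> is the transversal coordinate of \<open>c\<close>.\<close>

definition Kc :: "('a, 'b) chart \<Rightarrow> 'b coords \<Rightarrow> 'b coords \<Rightarrow> 'b coords \<Rightarrow> 'b coords" where
  "Kc c x u v = Gam c x u v + (u $ None / x $ None) *\<^sub>R v + (v $ None / x $ None) *\<^sub>R u"

text \<open>The boundary values at \<open>p\<close> of the transversal component of \<open>Kc\<close> (\<open>kN\<close>) and of \<open>Kc\<close> multiplied by the transversal coordinate (\<open>kA\<close>).\<close>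

definition kN :: "('a, 'b) chart \<Rightarrow> 'a \<Rightarrow> 'b coords \<Rightarrow> 'b coords \<Rightarrow> real" where
  "kN c p u v = (SOME l. extends_at (img c M) (cmap c p) (\<lambda>x. Kc c x u v $ None) l)"

definition kA :: "('a, 'b) chart \<Rightarrow> 'a \<Rightarrow> 'b coords \<Rightarrow> 'b coords \<Rightarrow> 'b option \<Rightarrow> real" where
  "kA c p u v i = (SOME l. extends_at (img c M) (cmap c p) (\<lambda>x. x $ None * Kc c x u v $ i) l)"

definition trK :: "('a, 'b) chart \<Rightarrow> 'b coords \<Rightarrow> 'b coords \<Rightarrow> real" where
  "trK c x v = (\<Sum>i\<in>UNIV. Kc c x (axis i 1) v $ i)"

lemma trG_Gam: "c \<in> A \<Longrightarrow> x \<in> img c M \<Longrightarrow> trG c x v = (\<Sum>i\<in>UNIV. Gam c x (axis i 1) v $ i)"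
  by (simp add: trG_def trace_def matrix_def Gam_sym[of c x v])

text \<open>The trace over the first argument of the change is \<open>\<Upsilon>(v)\<close> plus \<open>n + 1\<close> times \<open>\<Upsilon>(v)\<close>.\<close>

lemma trK_trG:
  assumes c: "c \<in> A" and x: "x \<in> img c M"
  shows "trK c x v = trG c x v + (real CARD('b) + 2) * (v $ None / x $ None)"
proof -
  have "(\<Sum>i\<in>UNIV. (axis i (1::real) $ None / x $ None) * v $ i) = v $ None / x $ None"
    using sum_axis_component[of None "\<lambda>i. v $ i / x $ None"] by simp
  moreover have "trK c x v = (\<Sum>i\<in>UNIV. Gam c x (axis i 1) v $ i) + (\<Sum>i\<in>UNIV. (axis i (1::real) $ None / x $ None) * v $ i)
      + (\<Sum>i\<in>(UNIV :: 'b option set). v $ None / x $ None)"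
    by (simp add: trK_def Kc_def sum.distrib)
  ultimately show ?thesis by (simp add: trG_Gam[OF c x] algebra_simps add_divide_distrib)
qed

context
  fixes c p assumes c: "c \<in> A" and p: "p \<in> cdom c" "p \<in> mboundary A"
begin

lemma boundary_coordinate: "cmap c p $ None = 0" using mboundary_iff[OF c p(1)] p by simp

lemma interior_coordinate_pos: "x \<in> img c M \<Longrightarrow> 0 < x $ None" using minterior_iff[OF c] by auto

lemma conn_rho_local:
  assumes x: "q \<in> cdom c" "q \<in> M"
  shows "frame_coords A c q (cov (conn_rho A D (\<lambda>q. cmap c q $ None)) (coord_field A c u) (coord_field A c v) q)
    = Kc c (cmap c q) u v"
  using x c linear_frame_coords[OF c x(1)]
  by (simp add: cov_def conn_rho_def proj_change_def dfun_coordinate coord_field_def linear_add linear_cmul Kc_def Gam_def)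

lemma vf_extends:
  assumes "smooth_vf_to_boundary A (cdom c) X"
  shows "\<exists>l. extends_at (img c M) (cmap c p) (\<lambda>x. vf_local A c X x $ i) l"
proof -
  obtain Z where Z: "Z \<in> vector_fields A (cdom c)" "\<And>p. p \<in> cdom c \<Longrightarrow> p \<in> M \<Longrightarrow> Z p = X p"
    using assms unfolding smooth_vf_to_boundary_def by blast
  have "smooth_on (img c (cdom c)) (\<lambda>x. vf_local A c Z x $ i)"
    by (rule smooth_on_vec_nth[OF smooth_on_vf_local[OF c Z(1)]])
  from extends_at_smooth[OF this, of "cmap c p" "img c M"]
  have "extends_at (img c M) (cmap c p) (\<lambda>x. vf_local A c Z x $ i) (vf_local A c Z (cmap c p) $ i)" using p by auto
  then have "extends_at (img c M) (cmap c p) (\<lambda>x. vf_local A c X x $ i) (vf_local A c Z (cmap c p) $ i)"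
    by (rule extends_at_cong) (use Z(2) c in \<open>auto simp: vf_local_def\<close>)
  then show ?thesis ..
qed

lemma pre_compactD:
  "smooth_fun_to_boundary A (cdom c) (\<lambda>p. dfun A (\<lambda>q. cmap c q $ None) p (cov (conn_rho A D (\<lambda>q. cmap c q $ None)) (coord_field A c u) (coord_field A c v) p))"
  "smooth_vf_to_boundary A (cdom c) (\<lambda>p. cmap c p $ None *\<^sub>R cov (conn_rho A D (\<lambda>q. cmap c q $ None)) (coord_field A c u) (coord_field A c v) p)"
  "coord_field A c u \<in> tangential_fields A (cdom c) \<or> coord_field A c v \<in> tangential_fields A (cdom c) \<Longrightarrow>
    smooth_vf_to_boundary A (cdom c) (cov (conn_rho A D (\<lambda>q. cmap c q $ None)) (coord_field A c u) (coord_field A c v))"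
  using mp[OF spec[OF spec[OF pre_compact[unfolded projectively_pre_compact_def]]] coordinate_defining_function[OF c]]
    coord_field_vector_field[OF c order_refl] by blast+

lemma K_regular:
  assumes "u $ None = 0 \<or> v $ None = 0" shows "\<exists>l. extends_at (img c M) (cmap c p) (\<lambda>x. Kc c x u v $ i) l"
proof -
  have t: "coord_field A c w \<in> tangential_fields A (cdom c)" if "w $ None = 0" for w
    unfolding tangential_fields_def
    using coord_field_vector_field[OF c order_refl] boundary_tangent_iff[OF c] that c
    by (auto simp: coord_field_def)
  have "\<exists>l. extends_at (img c M) (cmap c p) (\<lambda>x. vf_local A c (cov (conn_rho A D (\<lambda>q. cmap c q $ None)) (coord_field A c u) (coord_field A c v)) x $ i) l"
    by (rule vf_extends[OF pre_compactD(3)]) (use assms t in blast)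
  then obtain l where "extends_at (img c M) (cmap c p) (\<lambda>x. vf_local A c (cov (conn_rho A D (\<lambda>q. cmap c q $ None)) (coord_field A c u) (coord_field A c v)) x $ i) l" ..
  then have "extends_at (img c M) (cmap c p) (\<lambda>x. Kc c x u v $ i) l"
    by (rule extends_at_cong) (use c conn_rho_local in \<open>auto simp: vf_local_def\<close>)
  then show ?thesis ..
qed

lemma K_scaled: "\<exists>l. extends_at (img c M) (cmap c p) (\<lambda>x. x $ None * Kc c x u v $ i) l"
proof -
  obtain l where "extends_at (img c M) (cmap c p) (\<lambda>x. vf_local A c (\<lambda>p. cmap c p $ None *\<^sub>R cov (conn_rho A D (\<lambda>q. cmap c q $ None)) (coord_field A c u) (coord_field A c v) p) x $ i) l"
    using vf_extends[OF pre_compactD(2)] by blast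
  then have "extends_at (img c M) (cmap c p) (\<lambda>x. x $ None * Kc c x u v $ i) l"
    by (rule extends_at_cong) (use c conn_rho_local linear_cmul[OF linear_frame_coords[OF c]] in \<open>auto simp: vf_local_def\<close>)
  then show ?thesis ..
qed

lemma K_normal: "\<exists>l. extends_at (img c M) (cmap c p) (\<lambda>x. Kc c x u v $ None) l"
proof -
  obtain g where g: "smooth_fun A (cdom c) g" "\<And>p. p \<in> cdom c \<Longrightarrow> p \<in> M \<Longrightarrow> g p =
      dfun A (\<lambda>q. cmap c q $ None) p (cov (conn_rho A D (\<lambda>q. cmap c q $ None)) (coord_field A c u) (coord_field A c v) p)"
    using pre_compactD(1) unfolding smooth_fun_to_boundary_def by blast
  from extends_at_smooth[OF smooth_on_fun_local[OF c g(1)], of "cmap c p" "img c M"]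
  have "extends_at (img c M) (cmap c p) (\<lambda>x. g (cinv c x)) (g p)" using p c by auto
  then have "extends_at (img c M) (cmap c p) (\<lambda>x. Kc c x u v $ None) (g p)"
    by (rule extends_at_cong) (use g(2) c conn_rho_local dfun_coordinate[OF c] in auto)
  then show ?thesis ..
qed

lemma x0_extends: "extends_at W' (cmap c p) (\<lambda>x. x $ None) 0"
  using extends_at_linear[OF bounded_linear_vec_nth[of None], of W' "cmap c p"] boundary_coordinate by simp

lemma ext_unique: "extends_at (img c M) (cmap c p) f l \<Longrightarrow> extends_at (img c M) (cmap c p) f m \<Longrightarrow> l = m"
  using extends_at_unique nontrivial_interior[OF c p open_UNIV] by auto

lemma kN: "extends_at (img c M) (cmap c p) (\<lambda>x. Kc c x u v $ None) (kN c p u v)"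
  unfolding kN_def using K_normal by (rule someI_ex)

lemma kA: "extends_at (img c M) (cmap c p) (\<lambda>x. x $ None * Kc c x u v $ i) (kA c p u v i)"
  unfolding kA_def using K_scaled by (rule someI_ex)

lemma x0_times_extends: "\<exists>l. extends_at (img c M) (cmap c p) f l \<Longrightarrow> extends_at (img c M) (cmap c p) (\<lambda>x. x $ None * f x) 0"
  using extends_at_mult[OF x0_extends] by fastforce

lemma kA_0: "u $ None = 0 \<or> v $ None = 0 \<or> i = None \<Longrightarrow> kA c p u v i = 0"
  using ext_unique[OF kA x0_times_extends] K_regular K_normal by blast

lemma K_smooth: "smooth_on (img c M) (\<lambda>x. Kc c x u v $ i)"
proof -
  have "smooth_on (img c M) (\<lambda>x. a / x $ None)" for a
    by (intro smooth_on_divide smooth_on_const smooth_on_bounded_linear bounded_linear_vec_nth) (use interior_coordinate_pos in fastforce)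
  then show ?thesis
    unfolding Kc_def by (intro smooth_on_vec_nth smooth_on_add smooth_on_scaleR smooth_on_const Gam_smooth[OF c])
qed

text \<open>The summand for \<open>i = None\<close> is a transversal component, all others have a tangential first argument.\<close>

lemma trK_extends: "\<exists>l. extends_at (img c M) (cmap c p) (\<lambda>x. trK c x v) l"
proof -
  have "\<exists>l. extends_at (img c M) (cmap c p) (\<lambda>x. Kc c x (axis i 1) v $ i) l" for i
    using K_normal K_regular[of "axis i 1" v i] by (cases "i = None") (auto simp: axis_def)
  then obtain l where "\<And>i. extends_at (img c M) (cmap c p) (\<lambda>x. Kc c x (axis i 1) v $ i) (l i)" by metis
  then show ?thesis unfolding trK_def using extends_at_sum[of UNIV "img c M" "cmap c p" "\<lambda>i x. Kc c x (axis i 1) v $ i" l] by blast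
qed

text \<open>The singular parts of the logarithmic derivatives of \<open>\<sigma>\<close> and \<open>x0\<close> cancel: the one of \<open>\<sigma> / x0\<close> in direction
  \<open>e0\<close> is a multiple of the trace of \<open>Kc\<close>, which extends.\<close>

lemma rescaled_density_extends: "\<exists>t. t \<noteq> 0 \<and> extends_at (img c M) (cmap c p) (\<lambda>x. sig c x / x $ None) t"
proof -
  obtain T where T: "open T" "img c UNIV = half_space \<inter> T"
    using hopen_image[OF c open_UNIV] openin_open by blast
  have T': "y \<in> img c M" if "y \<in> T" "0 < y $ None" for y
  proof -
    have "y \<in> img c UNIV" using T(2) that by (auto simp: half_space_def)
    then show ?thesis using that minterior_iff[OF c] by blast
  qed
  have xT: "cmap c p \<in> T" using T(2) p by blast
  obtain l where l: "extends_at (img c M) (cmap c p) (\<lambda>x. trK c x e0) l" using trK_extends by blast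
  define N where "N = real CARD('b) + 2"
  have n: "N \<noteq> 0" unfolding N_def by (smt (verit) of_nat_0_le_iff)
  show ?thesis
  proof (rule ode_extends_to_boundary[OF boundary_coordinate T(1) xT T' open_img_interior[OF c]])
    show "img c M \<subseteq> {y. 0 < y $ None}" using interior_coordinate_pos by blast
    show "smooth_on (img c M) (\<lambda>x. sig c x / x $ None)"
      by (intro smooth_on_divide sig_smooth[OF c] smooth_on_bounded_linear bounded_linear_vec_nth) (use interior_coordinate_pos in fastforce)
    show "sig c y / y $ None \<noteq> 0" if "y \<in> img c M" for y using sig_nonzero[OF c that] interior_coordinate_pos[OF that] by simp
    show "extends_at (img c M) (cmap c p) (\<lambda>x. - 1 / N * trK c x e0) (- 1 / N * l)"
      by (rule extends_at_mult[OF extends_at_const l])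
    fix y assume y: "y \<in> img c M"
    have y0: "y $ None \<noteq> 0" using interior_coordinate_pos[OF y] by simp
    have "((\<lambda>x. sig c x / x $ None) has_derivative
        (\<lambda>v. (fder (sig c) y v * y $ None - sig c y * v $ None) / (y $ None * y $ None))) (at y)"
      by (rule has_derivative_divide'[OF smooth_on_has_derivative[OF open_img_interior[OF c] sig_smooth[OF c] y]
            bounded_linear_imp_has_derivative[OF bounded_linear_vec_nth] y0])
    then have 1: "fder (\<lambda>x. sig c x / x $ None) y e0
       = (fder (sig c) y e0 * y $ None - sig c y * e0 $ None) / (y $ None * y $ None)"
      by (simp add: frechet_derivative_at[symmetric])
    have e: "(e0 :: 'b coords) $ None = 1" by (simp add: axis_def)
    have 2: "fder (sig c) y e0 = - 1 / N * (trK c y e0 - N / y $ None) * sig c y"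
      using sig_derivative[OF c y, of e0] trK_trG[OF c y, of e0] e by (simp add: N_def)
    show "fder (\<lambda>x. sig c x / x $ None) y e0 = - 1 / N * trK c y e0 * (sig c y / y $ None)"
    proof (rule trans[OF 1])
      show "(fder (sig c) y e0 * y $ None - sig c y * e0 $ None) / (y $ None * y $ None)
         = - 1 / N * trK c y e0 * (sig c y / y $ None)"
        unfolding 2 e using n y0 by (simp add: field_simps)
    qed
  qed
qed

end

end

section \<open>The Ricci tensor near the boundary\<close>

context pre_compact_conn begin

text \<open>The Ricci tensor in coordinates, by \<open>Ric_ric\<close>.\<close>

definition ric_coords :: "('a, 'b) chart \<Rightarrow> 'b coords \<Rightarrow> 'b coords \<Rightarrow> 'b coords \<Rightarrow> real" where
  "ric_coords c x b d = (\<Sum>i\<in>UNIV. curv_coords c x (axis i 1) b d $ i)"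

context
  fixes c assumes c: "c \<in> A"
begin

lemma dGam_sym: assumes x: "x \<in> img c M" shows "dGam c x u v w = dGam c x u w v"
proof -
  have "((\<lambda>y. Gam c y w v) has_derivative (\<lambda>u. dGam c x u v w)) (at x)"
    by (rule has_derivative_transform_within_open[OF Gam_has_derivative[OF c x] open_img_interior[OF c] x])
      (rule Gam_sym[OF c])
  from has_derivative_unique[OF this Gam_has_derivative[OF c x]] show ?thesis by meson
qed

lemma linear_ric1: assumes x: "x \<in> img c M" shows "linear (\<lambda>b. ric_coords c x b d)"
proof -
  have L: "linear (\<lambda>b. curv_coords c x v b d)" for v
    unfolding curv_coords_def using linear_compose[OF Gam_linear1[OF c x] Gam_linear2[OF c x], unfolded o_def]
    by (intro linear_compose_add linear_compose_sub Gam_linear1[OF c x] linear_compose[OF Gam_linear1[OF c x] Gam_linear1[OF c x], unfolded o_def] dGam_linear1[OF c x] dGam_linear2[OF c x]) auto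
  show ?thesis
    unfolding ric_coords_def by (intro linear_compose_sum ballI) (auto intro!: linearI simp: linear_add[OF L] linear_cmul[OF L])
qed

lemma trG_derivative:
  assumes x: "x \<in> img c M"
  shows "((\<lambda>y. trG c y d) has_derivative (\<lambda>b. \<Sum>i\<in>UNIV. dGam c x b (axis i 1) d $ i)) (at x)"
  by (rule has_derivative_transform_within_open[OF _ open_img_interior[OF c] x, of "\<lambda>y. \<Sum>i\<in>UNIV. Gam c y (axis i 1) d $ i"])
    (auto intro!: has_derivative_sum bounded_linear.has_derivative[OF bounded_linear_vec_nth] Gam_has_derivative[OF c x] simp: trG_Gam[OF c])

text \<open>The trace of the Christoffel symbols is a constant times the differential of \<open>ln \<bar>\<sigma>\<bar>\<close>, so its
  derivative is symmetric.\<close>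

lemma trG_derivative_sym:
  assumes x: "x \<in> img c M"
  shows "(\<Sum>i\<in>UNIV. dGam c x b (axis i 1) d $ i) = (\<Sum>i\<in>UNIV. dGam c x d (axis i 1) b $ i)"
proof -
  define N where "N = real CARD('b) + 2"
  have n: "N \<noteq> 0" unfolding N_def by (smt (verit) of_nat_0_le_iff)
  note W = open_img_interior[OF c]
  let ?s = "sig c"
  note s = sig_smooth[OF c]
  let ?D2 = "\<lambda>d. fder (\<lambda>y. fder ?s y d) x"
  have sx: "?s x \<noteq> 0" by (rule sig_nonzero[OF c x])
  have *: "(\<Sum>i\<in>UNIV. dGam c x b (axis i 1) d $ i)
     = - N * ((?D2 d b * ?s x - fder ?s x d * fder ?s x b) / (?s x * ?s x))" for b d
  proof -
    have t: "trG c y d = - N * (fder ?s y d / ?s y)" if y: "y \<in> img c M" for y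
    proof -
      have "fder ?s y d = - 1 / N * trG c y d * ?s y"
        using sig_derivative[OF c y] by (simp add: N_def)
      then show ?thesis using n sig_nonzero[OF c y] by simp
    qed
    have 1: "((\<lambda>y. - N * (fder ?s y d / ?s y)) has_derivative
       (\<lambda>b. - N * ((?D2 d b * ?s x - fder ?s x d * fder ?s x b) / (?s x * ?s x)))) (at x)"
      by (intro has_derivative_mult_right has_derivative_divide' smooth_on_has_derivative[OF W smooth_on_derivative[OF W s] x]
          smooth_on_has_derivative[OF W s x] sx)
    have "((\<lambda>y. trG c y d) has_derivative
       (\<lambda>b. - N * ((?D2 d b * ?s x - fder ?s x d * fder ?s x b) / (?s x * ?s x)))) (at x)"
      by (rule has_derivative_transform_within_open[OF 1 W x]) (rule t[symmetric])
    from has_derivative_unique[OF trG_derivative[OF x] this] show ?thesis by meson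
  qed
  show ?thesis unfolding * using second_derivative_symmetric[OF s W x, of d b] by (simp add: mult.commute)
qed

lemma ric_expand:
  assumes x: "x \<in> img c M"
  shows "ric_coords c x b d = (\<Sum>i\<in>UNIV. dGam c x (axis i 1) b d $ i) - (\<Sum>i\<in>UNIV. dGam c x b (axis i 1) d $ i)
      + ((\<Sum>i\<in>UNIV. Gam c x (axis i 1) (Gam c x b d) $ i) - (\<Sum>i\<in>UNIV. Gam c x b (Gam c x (axis i 1) d) $ i))"
  by (simp add: ric_coords_def curv_coords_def sum.distrib sum_subtractf)

lemma ric_sym: assumes x: "x \<in> img c M" shows "ric_coords c x b d = ric_coords c x d b"
proof -
  let ?G = "Gam c x"
  have *: "(\<Sum>i\<in>UNIV. ?G b (?G (axis i 1) d) $ i) = (\<Sum>i\<in>UNIV. \<Sum>j\<in>UNIV. ?G (axis i 1) d $ j * ?G (axis j 1) b $ i)" for b d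
    by (intro sum.cong refl) (subst linear_axis_expansion[OF Gam_linear2[OF c x]], simp add: Gam_sym[OF c x, of b])
  have "(\<Sum>i\<in>UNIV. ?G b (?G (axis i 1) d) $ i) = (\<Sum>i\<in>UNIV. ?G d (?G (axis i 1) b) $ i)"
    unfolding * by (subst sum.swap) (simp add: mult.commute)
  then show ?thesis
    unfolding ric_expand[OF x] using trG_derivative_sym[OF x, of b d] dGam_sym[OF x, of _ b d] Gam_sym[OF c x, of b d] by simp
qed

lemma Ric_ric: "q \<in> cdom c \<Longrightarrow> q \<in> M \<Longrightarrow> Ric A D q u v = ric_coords c (cmap c q) (frame_coords A c q u) (frame_coords A c q v)"
  using Ric_local[OF c] by (simp add: ric_coords_def)

lemma ric_smooth: "smooth_on (img c M) (\<lambda>x. ric_coords c x b d)"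
proof -
  note W = open_img_interior[OF c]
  have G: "smooth_on (img c M) (\<lambda>x. Gam c x u v)" for u v by (rule Gam_smooth[OF c])
  have d: "smooth_on (img c M) (\<lambda>x. dGam c x u v w)" for u v w
    unfolding dGam_def by (rule smooth_on_derivative[OF W G])
  have GG: "smooth_on (img c M) (\<lambda>x. Gam c x u (Gam c x v w))" for u v w
  proof -
    have "smooth_on (img c M) (\<lambda>x. \<Sum>j\<in>UNIV. Gam c x v w $ j *\<^sub>R Gam c x u (axis j 1))"
      by (intro smooth_on_sum smooth_on_scaleR smooth_on_vec_nth G)
    then show ?thesis
      by (rule smooth_on_cong) (rule linear_axis_expansion[OF Gam_linear2[OF c], symmetric])
  qed
  show ?thesis
    unfolding ric_coords_def curv_coords_def
    by (intro smooth_on_sum smooth_on_vec_nth smooth_on_add smooth_on_diff d GG)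
qed

text \<open>The derivative terms are arranged so that only functions known to extend are differentiated:
  \<open>x0 Kc\<close> instead of \<open>Kc\<close>, and the trace of \<open>Kc\<close>.\<close>

lemma x0_ric:
  assumes x: "x \<in> img c M"
  shows "x $ None * ric_coords c x b d =
    ((\<Sum>i\<in>UNIV. fder (\<lambda>y. y $ None * Kc c y b d $ i) x (axis i 1)) - Kc c x b d $ None)
    - x $ None * fder (\<lambda>y. trK c y d) x b
    + (\<Sum>j\<in>UNIV. (x $ None * Kc c x b d $ j) * trK c x (axis j 1))
    - (\<Sum>i\<in>UNIV. \<Sum>j\<in>UNIV. (x $ None * Kc c x b (axis j 1) $ i) * Kc c x (axis i 1) d $ j)
    - real CARD('b) * Kc c x b d $ None"
proof -
  note W = open_img_interior[OF c]
  let ?z = "x $ None" and ?n = "real CARD('b)"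
  have pos: "0 < y $ None" if "y \<in> img c M" for y using that minterior_iff[OF c] by auto
  have z: "?z \<noteq> 0" using pos[OF x] by simp
  have nth: "((\<lambda>y. y $ None) has_derivative (\<lambda>v. v $ None)) (at x)"
    by (rule bounded_linear_imp_has_derivative[OF bounded_linear_vec_nth])
  have D1: "fder (\<lambda>y. y $ None * Kc c y b d $ i) x v = v $ None * Gam c x b d $ i + ?z * dGam c x v b d $ i" for i v
  proof -
    have 1: "((\<lambda>y. y $ None * Gam c y b d $ i + (b $ None * d $ i + d $ None * b $ i)) has_derivative
       (\<lambda>v. (?z * dGam c x v b d $ i + v $ None * Gam c x b d $ i) + 0)) (at x)"
      by (intro has_derivative_add has_derivative_mult nth bounded_linear.has_derivative[OF bounded_linear_vec_nth]
          Gam_has_derivative[OF c x] has_derivative_const)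
    have "((\<lambda>y. y $ None * Kc c y b d $ i) has_derivative
       (\<lambda>v. (?z * dGam c x v b d $ i + v $ None * Gam c x b d $ i) + 0)) (at x)"
      by (rule has_derivative_transform_within_open[OF 1 W x]) (use pos in \<open>force simp: Kc_def field_simps\<close>)
    then show ?thesis by (simp add: frechet_derivative_at[symmetric])
  qed
  have D2: "fder (\<lambda>y. trK c y d) x b = (\<Sum>i\<in>UNIV. dGam c x b (axis i 1) d $ i) - (?n + 2) * (d $ None * b $ None / (?z * ?z))"
  proof -
    have 1: "((\<lambda>y. trG c y d + (?n + 2) * (d $ None / y $ None)) has_derivative
       (\<lambda>b. (\<Sum>i\<in>UNIV. dGam c x b (axis i 1) d $ i) + (?n + 2) * ((0 * ?z - d $ None * b $ None) / (?z * ?z)))) (at x)"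
      by (intro has_derivative_add has_derivative_mult_right has_derivative_divide' nth trG_derivative[OF x] has_derivative_const z)
    have "((\<lambda>y. trK c y d) has_derivative
       (\<lambda>b. (\<Sum>i\<in>UNIV. dGam c x b (axis i 1) d $ i) + (?n + 2) * ((0 * ?z - d $ None * b $ None) / (?z * ?z)))) (at x)"
      by (rule has_derivative_transform_within_open[OF 1 W x]) (rule trK_trG[OF c, symmetric])
    then have "fder (\<lambda>y. trK c y d) x b = (\<Sum>i\<in>UNIV. dGam c x b (axis i 1) d $ i) + (?n + 2) * ((0 * ?z - d $ None * b $ None) / (?z * ?z))"
      by (simp only: frechet_derivative_at[symmetric])
    then show ?thesis by (simp add: algebra_simps)
  qed
  have S1: "(\<Sum>i\<in>UNIV. fder (\<lambda>y. y $ None * Kc c y b d $ i) x (axis i 1))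
     = Gam c x b d $ None + ?z * (\<Sum>i\<in>UNIV. dGam c x (axis i 1) b d $ i)"
    by (simp add: D1 sum.distrib sum_distrib_left sum_axis_component)
  have G0: "Gam c x b d $ None = Kc c x b d $ None - 2 * (b $ None * d $ None) / ?z"
    by (simp add: Kc_def mult.commute)
  note Q = projective_change_quadratic_terms[of "Gam c x" ?z b d, OF Gam_linear2[OF c x] Gam_sym[OF c x] z,
      folded Kc_def, folded trK_def]
  have "?z * ric_coords c x b d = ?z * (\<Sum>i\<in>UNIV. dGam c x (axis i 1) b d $ i) - ?z * (\<Sum>i\<in>UNIV. dGam c x b (axis i 1) d $ i)
      + ?z * ((\<Sum>i\<in>UNIV. Gam c x (axis i 1) (Gam c x b d) $ i) - (\<Sum>i\<in>UNIV. Gam c x b (Gam c x (axis i 1) d) $ i))"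
    unfolding ric_expand[OF x] by (simp add: algebra_simps)
  then show ?thesis
    unfolding Q S1 D2 G0 by (rule trans) (use z in \<open>simp add: field_simps\<close>)
qed

end

context
  fixes c p assumes c: "c \<in> A" and p: "p \<in> cdom c" "p \<in> mboundary A"
begin

text \<open>The double sum in \<open>x0_ric\<close> decides. In a summand the factors \<open>Kc(b, e\<^sub>j)\<close> and \<open>Kc(e\<^sub>i, d)\<close>
  are never both singular: the first extends unless \<open>j = None\<close>, and in that case the second one is a transversal
  component. For tangential \<open>b\<close> the first factor always extends, and a summand survives on the boundary only for \<open>i = None\<close>
  and \<open>j \<noteq> None\<close>, with the value \<open>kN(b, e\<^sub>j)\<close> times \<open>kA(e0, d)\<close>; the hypotheses on \<open>b\<close> and \<open>d\<close> make it zero.\<close>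

lemma ric_extends:
  "\<exists>l. extends_at (img c M) (cmap c p) (\<lambda>x. x $ None * ric_coords c x b d) l \<and>
    (b $ None = 0 \<and> (d $ None = 0 \<or> (\<forall>u. u $ None = 0 \<longrightarrow> kN c p b u = 0)) \<longrightarrow> l = - real CARD('b) * kN c p b d)"
proof -
  note kN = kN[OF c p] and kA = kA[OF c p] and x0_extends = x0_extends[OF c p]
  note W = open_img_interior[OF c]
  let ?W = "img c M" and ?x = "cmap c p" and ?n = "real CARD('b)"
  have "\<exists>l. extends_at ?W ?x (\<lambda>x. (\<Sum>i\<in>UNIV. fder (\<lambda>y. y $ None * Kc c y b d $ i) x (axis i 1)) - Kc c x b d $ None) l
    \<and> (b $ None = 0 \<longrightarrow> l = 0)"
  proof -
    obtain l where l: "\<And>i. extends_at ?W ?x (\<lambda>x. fder (\<lambda>y. y $ None * Kc c y b d $ i) x (axis i 1)) (l i)"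
      using choice[of "\<lambda>i l. extends_at ?W ?x (\<lambda>x. fder (\<lambda>y. y $ None * Kc c y b d $ i) x (axis i 1)) l"]
        extends_at_derivative[OF kA W] by blast
    have E: "extends_at ?W ?x (\<lambda>x. (\<Sum>i\<in>UNIV. fder (\<lambda>y. y $ None * Kc c y b d $ i) x (axis i 1)) - Kc c x b d $ None)
       ((\<Sum>i\<in>UNIV. l i) - kN c p b d)"
      by (intro extends_at_diff extends_at_sum l kN)
    moreover have "(\<Sum>i\<in>UNIV. l i) - kN c p b d = 0" if b: "b $ None = 0"
    proof -
      have "\<exists>m. extends_at ?W ?x (\<lambda>x. fder (\<lambda>y. Kc c y b d $ i) x (axis i 1)) m" for i
        using K_regular[OF c p, of b d i] b extends_at_derivative[OF _ W] by blast
      then obtain m where m: "\<And>i. extends_at ?W ?x (\<lambda>x. fder (\<lambda>y. Kc c y b d $ i) x (axis i 1)) (m i)"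
        using choice[of "\<lambda>i m. extends_at ?W ?x (\<lambda>x. fder (\<lambda>y. Kc c y b d $ i) x (axis i 1)) m"] by blast
      have "extends_at ?W ?x (\<lambda>x. x $ None * (\<Sum>i\<in>UNIV. fder (\<lambda>y. Kc c y b d $ i) x (axis i 1))) 0"
        using extends_at_mult[OF x0_extends extends_at_sum[of UNIV _ _ "\<lambda>i x. fder (\<lambda>y. Kc c y b d $ i) x (axis i 1)" m, OF m]]
        by simp
      moreover have "x $ None * (\<Sum>i\<in>UNIV. fder (\<lambda>y. Kc c y b d $ i) x (axis i 1))
         = (\<Sum>i\<in>UNIV. fder (\<lambda>y. y $ None * Kc c y b d $ i) x (axis i 1)) - Kc c x b d $ None"
        if x: "x \<in> ?W" for x
      proof -
        have nth: "((\<lambda>y. y $ None) has_derivative (\<lambda>v. v $ None)) (at x)"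
          by (rule bounded_linear_imp_has_derivative[OF bounded_linear_vec_nth])
        have DK: "((\<lambda>y. y $ None * Kc c y b d $ i) has_derivative
           (\<lambda>v. x $ None * fder (\<lambda>y. Kc c y b d $ i) x v + v $ None * Kc c x b d $ i)) (at x)" for i
          by (rule has_derivative_mult[OF nth smooth_on_has_derivative[OF W K_smooth[OF c p] x]])
        have "fder (\<lambda>y. y $ None * Kc c y b d $ i) x (axis i 1)
           = x $ None * fder (\<lambda>y. Kc c y b d $ i) x (axis i 1) + axis i 1 $ None * Kc c x b d $ i" for i
          unfolding frechet_derivative_at[OF DK, symmetric] ..
        then show ?thesis by (simp add: sum.distrib sum_distrib_left sum_axis_component)
      qed
      ultimately have "extends_at ?W ?x (\<lambda>x. (\<Sum>i\<in>UNIV. fder (\<lambda>y. y $ None * Kc c y b d $ i) x (axis i 1)) - Kc c x b d $ None) 0"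
        by (rule extends_at_cong)
      from ext_unique[OF c p E this] show ?thesis .
    qed
    ultimately show ?thesis by blast
  qed
  then obtain l1 where l1: "extends_at ?W ?x (\<lambda>x. (\<Sum>i\<in>UNIV. fder (\<lambda>y. y $ None * Kc c y b d $ i) x (axis i 1)) - Kc c x b d $ None) l1"
    "b $ None = 0 \<Longrightarrow> l1 = 0" by blast
  have l2: "extends_at ?W ?x (\<lambda>x. x $ None * fder (\<lambda>y. trK c y d) x b) 0"
  proof -
    obtain l where "extends_at ?W ?x (\<lambda>x. trK c x d) l" using trK_extends[OF c p] by blast
    from x0_times_extends[OF c p extends_at_derivative[OF this W]] show ?thesis .
  qed
  obtain t where t: "\<And>v. extends_at ?W ?x (\<lambda>x. trK c x v) (t v)"
    using choice[of "\<lambda>v t. extends_at ?W ?x (\<lambda>x. trK c x v) t"] trK_extends[OF c p] by blast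
  have l3: "extends_at ?W ?x (\<lambda>x. \<Sum>j\<in>UNIV. (x $ None * Kc c x b d $ j) * trK c x (axis j 1)) (\<Sum>j\<in>UNIV. kA c p b d j * t (axis j 1))"
    by (intro extends_at_sum extends_at_mult kA t)
  have "\<exists>m. extends_at ?W ?x (\<lambda>x. (x $ None * Kc c x b (axis j 1) $ i) * Kc c x (axis i 1) d $ j) m
     \<and> (b $ None = 0 \<and> (d $ None = 0 \<or> (\<forall>u. u $ None = 0 \<longrightarrow> kN c p b u = 0)) \<longrightarrow> m = 0)" for i j
  proof (cases "b $ None = 0")
    case b: True
    obtain r where r: "extends_at ?W ?x (\<lambda>x. Kc c x b (axis j 1) $ i) r" using K_regular[OF c p, of b] b by blast
    have E: "extends_at ?W ?x (\<lambda>x. Kc c x b (axis j 1) $ i * (x $ None * Kc c x (axis i 1) d $ j)) (r * kA c p (axis i 1) d j)"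
      by (rule extends_at_mult[OF r kA])
    have "extends_at ?W ?x (\<lambda>x. (x $ None * Kc c x b (axis j 1) $ i) * Kc c x (axis i 1) d $ j) (r * kA c p (axis i 1) d j)"
      by (rule extends_at_cong[OF E]) (simp add: mult_ac)
    moreover have "r * kA c p (axis i 1) d j = 0" if *: "d $ None = 0 \<or> (\<forall>u. u $ None = 0 \<longrightarrow> kN c p b u = 0)"
    proof (cases "i = None \<and> j \<noteq> None \<and> d $ None \<noteq> 0")
      case True
      then have "kN c p b (axis j 1) = 0" using * by (auto simp: axis_def)
      moreover have "r = kN c p b (axis j 1)" using ext_unique[OF c p r] kN True by blast
      ultimately show ?thesis by simp
    next
      case False
      then show ?thesis using kA_0[OF c p, of "axis i 1" d j] by (auto simp: axis_def)
    qed
    ultimately show ?thesis using b by blast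
  next
    case b: False
    show ?thesis
    proof (cases "j = None")
      case True
      obtain r where r: "extends_at ?W ?x (\<lambda>x. Kc c x (axis i 1) d $ j) r" using K_normal[OF c p] True by blast
      show ?thesis using extends_at_mult[OF kA r] b by blast
    next
      case False
      obtain r where r: "extends_at ?W ?x (\<lambda>x. Kc c x b (axis j 1) $ i) r"
        using K_regular[OF c p, of b "axis j 1" i] False by (auto simp: axis_def)
      have E: "extends_at ?W ?x (\<lambda>x. Kc c x b (axis j 1) $ i * (x $ None * Kc c x (axis i 1) d $ j)) (r * kA c p (axis i 1) d j)"
        by (rule extends_at_mult[OF r kA])
      have "extends_at ?W ?x (\<lambda>x. (x $ None * Kc c x b (axis j 1) $ i) * Kc c x (axis i 1) d $ j) (r * kA c p (axis i 1) d j)"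
        by (rule extends_at_cong[OF E]) (simp add: mult_ac)
      then show ?thesis using b by blast
    qed
  qed
  then have "\<forall>ij. \<exists>m. extends_at ?W ?x (\<lambda>x. (x $ None * Kc c x b (axis (snd ij) 1) $ fst ij) * Kc c x (axis (fst ij) 1) d $ snd ij) m
     \<and> (b $ None = 0 \<and> (d $ None = 0 \<or> (\<forall>u. u $ None = 0 \<longrightarrow> kN c p b u = 0)) \<longrightarrow> m = 0)" by blast
  from choice[OF this] obtain m' where m': "\<And>ij. extends_at ?W ?x (\<lambda>x. (x $ None * Kc c x b (axis (snd ij) 1) $ fst ij) * Kc c x (axis (fst ij) 1) d $ snd ij) (m' ij)"
     "\<And>ij. (b $ None = 0 \<and> (d $ None = 0 \<or> (\<forall>u. u $ None = 0 \<longrightarrow> kN c p b u = 0)) \<longrightarrow> m' ij = 0)" by blast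
  define m where "m i j = m' (i, j)" for i j
  have m: "\<And>i j. extends_at ?W ?x (\<lambda>x. (x $ None * Kc c x b (axis j 1) $ i) * Kc c x (axis i 1) d $ j) (m i j)"
    "\<And>i j. b $ None = 0 \<Longrightarrow> d $ None = 0 \<or> (\<forall>u. u $ None = 0 \<longrightarrow> kN c p b u = 0) \<Longrightarrow> m i j = 0"
    using m'[of "(_, _)"] by (auto simp: m_def)
  have E: "extends_at ?W ?x (\<lambda>x. ((\<Sum>i\<in>UNIV. fder (\<lambda>y. y $ None * Kc c y b d $ i) x (axis i 1)) - Kc c x b d $ None)
    - x $ None * fder (\<lambda>y. trK c y d) x b
    + (\<Sum>j\<in>UNIV. (x $ None * Kc c x b d $ j) * trK c x (axis j 1))
    - (\<Sum>i\<in>UNIV. \<Sum>j\<in>UNIV. (x $ None * Kc c x b (axis j 1) $ i) * Kc c x (axis i 1) d $ j)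
    - ?n * Kc c x b d $ None) (l1 - 0 + (\<Sum>j\<in>UNIV. kA c p b d j * t (axis j 1)) - (\<Sum>i\<in>UNIV. \<Sum>j\<in>UNIV. m i j) - ?n * kN c p b d)"
    by (rule extends_at_diff[OF extends_at_diff[OF extends_at_add[OF extends_at_diff[OF l1(1) l2] l3]
       extends_at_sum[OF extends_at_sum[OF m(1)]]] extends_at_mult[OF extends_at_const kN]])
  have "extends_at ?W ?x (\<lambda>x. x $ None * ric_coords c x b d) (l1 - 0 + (\<Sum>j\<in>UNIV. kA c p b d j * t (axis j 1)) - (\<Sum>i\<in>UNIV. \<Sum>j\<in>UNIV. m i j) - ?n * kN c p b d)"
    by (rule extends_at_cong[OF E]) (simp add: x0_ric[OF c])
  moreover have "l1 - 0 + (\<Sum>j\<in>UNIV. kA c p b d j * t (axis j 1)) - (\<Sum>i\<in>UNIV. \<Sum>j\<in>UNIV. m i j) - ?n * kN c p b d = - ?n * kN c p b d"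
    if "b $ None = 0" "d $ None = 0 \<or> (\<forall>u. u $ None = 0 \<longrightarrow> kN c p b u = 0)"
    using l1(2)[OF that(1)] m(2)[OF that] kA_0[OF c p, of b d] that(1) by simp
  ultimately show ?thesis by blast
qed

end

end

section \<open>The Hessian near the boundary\<close>

lemma extends_at_cong_local:
  assumes "extends_at W x f l" "open N" "x \<in> N" "\<And>y. y \<in> N \<Longrightarrow> y \<in> W' \<Longrightarrow> f y = g y \<and> y \<in> W"
  shows "extends_at W' x g l"
proof -
  obtain V h where V: "open V" "x \<in> V" "smooth_on V h" "\<And>y. y \<in> V \<Longrightarrow> y \<in> W \<Longrightarrow> f y = h y" "h x = l"
    using extends_atE[OF assms(1)] by metis
  show ?thesis
  proof (rule extends_atI[of "V \<inter> N" _ h])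
    show "smooth_on (V \<inter> N) h" using V(3) by (rule smooth_on_subset) auto
    show "g y = h y" if "y \<in> V \<inter> N" "y \<in> W'" for y using V(4)[of y] assms(4)[of y] that by auto
  qed (use V assms in auto)
qed

context pre_compact_conn begin

context
  fixes c p U \<rho> assumes c: "c \<in> A" and p: "p \<in> cdom c" and \<rho>: "local_defining_function A U \<rho>" and pU: "p \<in> U"
begin

lemma defining_function_smooth: "smooth_on (img c U) (\<lambda>x. \<rho> (cinv c x))"
  by (rule smooth_on_fun_local[OF c local_defining_functionD(2)[OF \<rho>]])

text \<open>The boundary value of the quotient is the derivative of \<open>\<rho>\<close> in direction \<open>e0\<close>. It is nonzero because
  \<open>d\<rho>\<close> is nonzero on the boundary but vanishes on tangential vectors.\<close>

lemma defining_function_quotient_extends: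
  assumes pb: "p \<in> mboundary A"
  shows "\<exists>m. m \<noteq> 0 \<and> extends_at (img c (U \<inter> M)) (cmap c p) (\<lambda>x. \<rho> (cinv c x) / x $ None) m"
proof -
  note \<rho>D = local_defining_functionD[OF \<rho>]
  let ?r = "\<lambda>x. \<rho> (cinv c x)" and ?x = "cmap c p"
  have x0: "?x $ None = 0" by (rule boundary_coordinate[OF c p pb])
  have xi: "?x \<in> img c U" using p pU by blast
  obtain T where T: "open T" "img c U = half_space \<inter> T"
    using hopen_image[OF c \<rho>D(1)] openin_open by blast
  obtain V g where V: "open V" "?x \<in> V" "smooth_on V g" "\<And>y. y \<in> img c U \<Longrightarrow> y \<in> V \<Longrightarrow> ?r y = g y"
    using smooth_onE[OF defining_function_smooth xi] by blast
  have V': "open (V \<inter> T)" "?x \<in> V \<inter> T" using V T xi by auto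
  have gs: "smooth_on (V \<inter> T) g" using V(3) by (rule smooth_on_subset) auto
  have g0: "g y = 0" if y: "y \<in> V \<inter> T" "y $ None = 0" for y
  proof -
    have yi: "y \<in> img c U" using T(2) y by (auto simp: half_space_def)
    then obtain q where q: "q \<in> cdom c" "q \<in> U" "y = cmap c q" by blast
    then have "q \<in> mboundary A" using mboundary_iff[OF c q(1)] y by simp
    then have "?r y = 0" using \<rho>D(4) q c by simp
    then show ?thesis using V(4)[OF yi] y by simp
  qed
  let ?m = "fder g ?x e0"
  note H = hadamard_boundary[OF x0 V' gs g0]
  have "extends_at (img c (U \<inter> M)) ?x (\<lambda>x. ?r x / x $ None) ?m"
  proof (rule extends_at_cong_local[OF H V'])
    fix y assume y: "y \<in> V \<inter> T" "y \<in> img c (U \<inter> M)"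
    then show "g y / y $ None = ?r y / y $ None \<and> y \<in> {y. 0 < y $ None}"
      using V(4)[of y] minterior_iff[OF c] by auto
  qed auto
  moreover have "?m \<noteq> 0"
  proof
    assume m0: "?m = 0"
    note Dg = smooth_on_has_derivative[OF V' (1) gs V'(2)]
    interpret L: bounded_linear "fder g ?x" using Dg by (rule has_derivative_bounded_linear)
    have tan: "fder g ?x w = 0" if w: "w $ None = 0" for w
    proof -
      let ?L = "\<lambda>t. ?x + t *\<^sub>R w"
      have 1: "((\<lambda>t. g (?L t)) has_derivative (\<lambda>t. t * fder g ?x w)) (at 0)"
        using line_derivative[OF V'(1) gs, of ?x 0 1 w UNIV] V'(2) by simp
      have o: "open (?L -` (V \<inter> T))" by (rule open_vimage[OF V'(1)]) (intro continuous_intros)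
      have "((\<lambda>t. 0) has_derivative (\<lambda>t. t * fder g ?x w)) (at 0)"
        by (rule has_derivative_transform_within_open[OF 1 o]) (use V' g0 x0 w in auto)
      from has_derivative_unique[OF this has_derivative_const]
      have "1 * fder g ?x w = 0" by meson
      then show ?thesis by simp
    qed
    have "fder g ?x v = 0" for v
    proof -
      have "fder g ?x v = fder g ?x ((v - v $ None *\<^sub>R e0) + v $ None *\<^sub>R e0)" by simp
      also have "\<dots> = 0" by (simp only: L.add L.scale m0) (simp add: tan axis_def)
      finally show ?thesis .
    qed
    moreover have "hderiv ?r ?x = fder g ?x"
      by (rule smooth_on_local_hderiv(2)[OF hopen_image[OF c \<rho>D(1)] V(1,3,4) xi V(2)])
    ultimately have "dfun A \<rho> p v = 0" for v
      using dfun_smooth[OF c \<rho>D(1,2) pU p] by simp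
    then show False using \<rho> pb pU unfolding local_defining_function_def by blast
  qed
  ultimately show ?thesis by blast
qed

lemma hess_coords_smooth: "smooth_on (img c (U \<inter> M)) (\<lambda>x. sig c x * hess_coords c (\<lambda>x. \<rho> (cinv c x)) x a b)"
proof -
  note \<rho>D = local_defining_functionD[OF \<rho>]
  let ?r = "\<lambda>x. \<rho> (cinv c x)" and ?W = "img c (U \<inter> M)"
  have W: "open ?W" by (rule open_image_interior[OF c \<rho>D(1)])
  have sub: "?W \<subseteq> img c M" by auto
  have r: "smooth_on ?W ?r" by (rule smooth_on_subset[OF defining_function_smooth]) auto
  note dr = smooth_on_derivative[OF W r]
  have rn: "?r x \<noteq> 0" if "x \<in> ?W" for x using that \<rho>D(3) c by auto
  have G: "smooth_on ?W (\<lambda>x. fder ?r x (Gam c x a b))"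
  proof -
    have "smooth_on ?W (\<lambda>x. \<Sum>i\<in>UNIV. Gam c x a b $ i * fder ?r x (axis i 1))"
      by (intro smooth_on_sum smooth_on_mult smooth_on_vec_nth smooth_on_subset[OF Gam_smooth[OF c] sub] dr)
    then show ?thesis
    proof (rule smooth_on_cong)
      fix x assume x: "x \<in> ?W"
      have "linear (fder ?r x)"
        using has_derivative_bounded_linear[OF smooth_on_has_derivative[OF W r x]] bounded_linear.linear by blast
      from linear_axis_expansion[OF this, of "Gam c x a b"]
      show "(\<Sum>i\<in>UNIV. Gam c x a b $ i * fder ?r x (axis i 1)) = fder ?r x (Gam c x a b)"
        by simp
    qed
  qed
  show ?thesis
    unfolding hess_coords_def power2_eq_square
    by (intro smooth_on_mult smooth_on_diff smooth_on_divide smooth_on_const smooth_on_subset[OF sig_smooth[OF c] sub]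
        smooth_on_derivative[OF W dr] dr G r) (use rn in auto)
qed

text \<open>Substituting \<open>\<rho> = x0 q\<close> and \<open>Gam = Kc - \<Upsilon> \<otimes> id - id \<otimes> \<Upsilon>\<close>, \<open>\<Upsilon> = dx0 / x0\<close>, into \<open>hess_coords\<close>, the
  terms of order \<open>1 / x0\<^sup>2\<close> cancel, and what remains is \<open>1 / x0\<close> times functions that extend. This is
  the equation \<open>F\<close> of the proof. For tangential \<open>b\<close> the only term that
  survives on the boundary is the one with \<open>kN\<close>.\<close>

lemma hess_extends:
  assumes pb: "p \<in> mboundary A" and t: "extends_at (img c M) (cmap c p) (\<lambda>x. sig c x / x $ None) t"
  shows "\<exists>l. extends_at (img c (U \<inter> M)) (cmap c p) (\<lambda>x. sig c x * hess_coords c (\<lambda>x. \<rho> (cinv c x)) x a b) l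
    \<and> (b $ None = 0 \<longrightarrow> l = - t * kN c p a b)"
proof -
  note \<rho>D = local_defining_functionD[OF \<rho>]
  let ?r = "\<lambda>x. \<rho> (cinv c x)" and ?x = "cmap c p" and ?W = "img c (U \<inter> M)"
  define q where "q x = ?r x / x $ None" for x
  have W: "open ?W" by (rule open_image_interior[OF c \<rho>D(1)])
  have sub: "?W \<subseteq> img c M" by auto
  have pos: "0 < y $ None" if "y \<in> ?W" for y using that minterior_iff[OF c] by auto
  have rn: "?r x \<noteq> 0" if "x \<in> ?W" for x using that \<rho>D(3) c by auto
  have qn: "q x \<noteq> 0" if "x \<in> ?W" for x using rn[OF that] pos[OF that] by (simp add: q_def)
  obtain m where m: "m \<noteq> 0" "extends_at ?W ?x q m"
    using defining_function_quotient_extends[OF pb] unfolding q_def by blast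
  have qs: "smooth_on ?W q"
    unfolding q_def
    by (intro smooth_on_divide smooth_on_subset[OF defining_function_smooth] smooth_on_bounded_linear bounded_linear_vec_nth) (use pos in fastforce)+
  let ?dq = "\<lambda>v y. fder q y v"
  let ?ddq = "\<lambda>a b y. fder (\<lambda>y. ?dq b y) y a"
  obtain lq where lq: "\<And>v. extends_at ?W ?x (?dq v) (lq v)"
    using choice[of "\<lambda>v l. extends_at ?W ?x (?dq v) l"] extends_at_derivative[OF m(2) W] by blast
  obtain lab where lab: "extends_at ?W ?x (?ddq a b) lab"
    using extends_at_derivative[OF lq W] by blast
  have rq: "?r y = y $ None * q y" if "y \<in> ?W" for y using pos[OF that] by (simp add: q_def)
  have nth: "((\<lambda>y. y $ None) has_derivative (\<lambda>v. v $ None)) (at x)" for x :: "'b coords"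
    by (rule bounded_linear_imp_has_derivative[OF bounded_linear_vec_nth])
  have dr: "fder ?r y v = v $ None * q y + y $ None * ?dq v y" if y: "y \<in> ?W" for y v
  proof -
    have "(?r has_derivative (\<lambda>v. y $ None * ?dq v y + v $ None * q y)) (at y)"
      by (rule has_derivative_transform_within_open[OF has_derivative_mult[OF nth smooth_on_has_derivative[OF W qs y]] W y])
        (rule rq[symmetric])
    from frechet_derivative_at[OF this, symmetric] show ?thesis by simp
  qed
  have ddr: "fder (\<lambda>y. fder ?r y b) x a
      = b $ None * ?dq a x + (a $ None * ?dq b x + x $ None * ?ddq a b x)" if x: "x \<in> ?W" for x
  proof -
    have 1: "((\<lambda>y. b $ None * q y + y $ None * ?dq b y) has_derivative
       (\<lambda>a. b $ None * ?dq a x + (x $ None * ?ddq a b x + a $ None * ?dq b x))) (at x)"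
      by (intro has_derivative_add has_derivative_mult_right has_derivative_mult nth
          smooth_on_has_derivative[OF W qs x] smooth_on_has_derivative[OF W smooth_on_derivative[OF W qs] x])
    have "((\<lambda>y. fder ?r y b) has_derivative
       (\<lambda>a. b $ None * ?dq a x + (x $ None * ?ddq a b x + a $ None * ?dq b x))) (at x)"
      by (rule has_derivative_transform_within_open[OF 1 W x]) (rule dr[symmetric])
    from frechet_derivative_at[OF this, symmetric] show ?thesis by simp
  qed
  have arith: "s * (((B * qa + (A' * qb + z * qab)) - ((k - 2 * (A' * B) / z) * h + (S - A' * qb - B * qa))) / (z * h)
      - 2 * (A' * h + z * qa) * (B * h + z * qb) / (z * h)\<^sup>2)
      = (s / z) * (z * qab / h - k - S / h - 2 * (z * (qa * qb)) / (h * h))"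
    if "z \<noteq> 0" "h \<noteq> 0" for s z h A' B qa qb qab k S :: real
    using that by (simp add: field_simps power2_eq_square)
  have F: "sig c x * hess_coords c ?r x a b = (sig c x / x $ None) * (x $ None * ?ddq a b x / q x - Kc c x a b $ None
      - (\<Sum>i\<in>UNIV. (x $ None * Kc c x a b $ i) * ?dq (axis i 1) x) / q x - 2 * (x $ None * (?dq a x * ?dq b x)) / (q x * q x))"
    if x: "x \<in> ?W" for x
  proof -
    have z: "x $ None \<noteq> 0" using pos[OF x] by simp
    interpret L: bounded_linear "fder q x"
      using smooth_on_has_derivative[OF W qs x] by (rule has_derivative_bounded_linear)
    have ex: "?dq w x = (\<Sum>i\<in>UNIV. w $ i * ?dq (axis i 1) x)" for w
      using linear_axis_expansion[OF L.linear, of w] by simp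
    have G: "x $ None *\<^sub>R Gam c x a b = x $ None *\<^sub>R Kc c x a b - a $ None *\<^sub>R b - b $ None *\<^sub>R a"
      using z by (simp add: Kc_def algebra_simps)
    have "x $ None * ?dq (Gam c x a b) x = ?dq (x $ None *\<^sub>R Gam c x a b) x" by (simp add: L.scale)
    also have "\<dots> = ?dq (x $ None *\<^sub>R Kc c x a b) x - a $ None * ?dq b x - b $ None * ?dq a x"
      unfolding G by (simp add: L.diff L.scale)
    also have "?dq (x $ None *\<^sub>R Kc c x a b) x = (\<Sum>i\<in>UNIV. (x $ None * Kc c x a b $ i) * ?dq (axis i 1) x)"
      by (subst ex) simp
    finally have dG: "x $ None * ?dq (Gam c x a b) x = (\<Sum>i\<in>UNIV. (x $ None * Kc c x a b $ i) * ?dq (axis i 1) x) - a $ None * ?dq b x - b $ None * ?dq a x" .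
    have G0: "Gam c x a b $ None = Kc c x a b $ None - 2 * (a $ None * b $ None) / x $ None"
      by (simp add: Kc_def mult.commute)
    show ?thesis
      unfolding hess_coords_def ddr[OF x] dr[OF x] rq[OF x] dG G0 by (rule arith[OF z qn[OF x]])
  qed
  note x0e = x0_extends[OF c p pb, of ?W] and mono = extends_at_mono[OF _ sub]
  have E: "extends_at ?W ?x (\<lambda>x. (sig c x / x $ None) * (x $ None * ?ddq a b x / q x - Kc c x a b $ None
      - (\<Sum>i\<in>UNIV. (x $ None * Kc c x a b $ i) * ?dq (axis i 1) x) / q x - 2 * (x $ None * (?dq a x * ?dq b x)) / (q x * q x)))
      (t * (0 * lab / m - kN c p a b - (\<Sum>i\<in>UNIV. kA c p a b i * lq (axis i 1)) / m - 2 * (0 * (lq a * lq b)) / (m * m)))"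
    by (intro extends_at_mult[OF mono[OF t]] extends_at_diff extends_at_divide extends_at_mult[OF x0e] extends_at_sum
        extends_at_mult[OF mono[OF kA[OF c p pb]]] extends_at_mult[OF extends_at_const] extends_at_mult[OF m(2) m(2)]
        extends_at_mult[OF lq lq] lab m(2) lq mono[OF kN[OF c p pb]])
      (use m(1) in auto)
  have "extends_at ?W ?x (\<lambda>x. sig c x * hess_coords c ?r x a b)
      (t * (0 * lab / m - kN c p a b - (\<Sum>i\<in>UNIV. kA c p a b i * lq (axis i 1)) / m - 2 * (0 * (lq a * lq b)) / (m * m)))"
    by (rule extends_at_cong[OF E]) (rule F[symmetric])
  moreover have "t * (0 * lab / m - kN c p a b - (\<Sum>i\<in>UNIV. kA c p a b i * lq (axis i 1)) / m - 2 * (0 * (lq a * lq b)) / (m * m))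
      = - t * kN c p a b" if "b $ None = 0"
    using kA_0[OF c p pb, of a b] that by simp
  ultimately show ?thesis by blast
qed

end

lemma hess_coords_sym_linear:
  assumes c: "c \<in> A" and \<rho>: "local_defining_function A U \<rho>" and x: "x \<in> img c (U \<inter> M)"
  shows "hess_coords c (\<lambda>x. \<rho> (cinv c x)) x a b = hess_coords c (\<lambda>x. \<rho> (cinv c x)) x b a"
    "linear (\<lambda>a. hess_coords c (\<lambda>x. \<rho> (cinv c x)) x a b)"
proof -
  note \<rho>D = local_defining_functionD[OF \<rho>]
  let ?r = "\<lambda>x. \<rho> (cinv c x)" and ?W = "img c (U \<inter> M)"
  have W: "open ?W" by (rule open_image_interior[OF c \<rho>D(1)])
  have xM: "x \<in> img c M" using x by auto
  have r: "smooth_on ?W ?r"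
    by (rule smooth_on_subset[OF smooth_on_fun_local[OF c \<rho>D(2)]]) auto
  interpret L: bounded_linear "fder ?r x"
    using smooth_on_has_derivative[OF W r x] by (rule has_derivative_bounded_linear)
  interpret L2: bounded_linear "\<lambda>a. fder (\<lambda>y. fder ?r y b) x a"
    using smooth_on_has_derivative[OF W smooth_on_derivative[OF W r] x] by (rule has_derivative_bounded_linear)
  show "hess_coords c ?r x a b = hess_coords c ?r x b a"
    unfolding hess_coords_def using second_derivative_symmetric[OF r W x, of b a] Gam_sym[OF c xM, of a b] by simp
  show "linear (\<lambda>a. hess_coords c ?r x a b)"
    unfolding hess_coords_def using Gam_linear1[OF c xM]
    by (intro linearI) (simp_all add: linear_add[OF Gam_linear1[OF c xM]] linear_cmul[OF Gam_linear1[OF c xM]]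
        L.add L.scale L2.add L2.scale add_divide_distrib diff_divide_distrib algebra_simps)
qed

end

section \<open>Gluing local extensions\<close>

lemma tendsto_det:
  fixes M :: "'b \<Rightarrow> real ^ 'k ^ 'k::finite"
  assumes "\<And>i j. ((\<lambda>y. M y $ i $ j) \<longlongrightarrow> N $ i $ j) F"
  shows "((\<lambda>y. det (M y)) \<longlongrightarrow> det N) F"
  unfolding det_def by (intro tendsto_sum tendsto_mult tendsto_prod tendsto_const assms)

context mfd begin

abbreviation S2_component :: "real \<Rightarrow> ('a, 'n) chart \<Rightarrow> ('a \<Rightarrow> 'n coords \<Rightarrow> 'n coords \<Rightarrow> real) \<Rightarrow> 'n coords \<Rightarrow> 'n coords \<Rightarrow> 'n coords \<Rightarrow> real" where
  "S2_component w c T a b \<equiv> density_local A w c (\<lambda>q. T q (coord_field A c a q) (coord_field A c b q))"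

lemma extends_at_change_chart:
  assumes c: "c \<in> A" and c': "c' \<in> A" and p: "p \<in> cdom c" "p \<in> cdom c'"
    and U: "open U" and F: "extends_at (img c' (U \<inter> minterior A)) (cmap c' p) F l"
  shows "extends_at (img c (cdom c' \<inter> (U \<inter> minterior A))) (cmap c p) (\<lambda>x. F (cmap c' (cinv c x))) l"
proof -
  obtain V g where V: "open V" "cmap c' p \<in> V" "smooth_on V g" "\<And>y. y \<in> V \<Longrightarrow> y \<in> img c' (U \<inter> minterior A) \<Longrightarrow> F y = g y" "g (cmap c' p) = l"
    using extends_atE[OF F] by metis
  have xi: "cmap c p \<in> img c (cdom c')" using p by blast
  obtain N h where N: "open N" "cmap c p \<in> N" "smooth_on N h" "\<And>y. y \<in> img c (cdom c') \<Longrightarrow> y \<in> N \<Longrightarrow> cmap c' (cinv c y) = h y"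
    using smooth_onE[OF smooth_transition_on[OF c' c] xi] by blast
  have hx: "h (cmap c p) = cmap c' p" using N(4)[OF xi N(2)] c p by simp
  let ?N = "h -` V \<inter> N"
  have o: "open ?N"
    by (rule continuous_on_open_vimage[THEN iffD1, rule_format, OF N(1) smooth_on_imp_continuous_on[OF N(3)] V(1)])
  have s: "smooth_on ?N (\<lambda>y. g (h y))"
    by (rule smooth_on_compose[OF V(3) smooth_on_subset[OF N(3)]]) auto
  show ?thesis
  proof (rule extends_atI[OF o _ s])
    show "cmap c p \<in> ?N" using hx V(2) N(2) by simp
    show "g (h (cmap c p)) = l" using hx V(5) by simp
    fix y assume y: "y \<in> ?N" "y \<in> img c (cdom c' \<inter> (U \<inter> minterior A))"
    then obtain q where q: "q \<in> cdom c" "q \<in> cdom c'" "q \<in> U" "q \<in> minterior A" "y = cmap c q" by blast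
    have e: "cmap c' (cinv c y) = h y" using N(4)[of y] y by blast
    have "cmap c' (cinv c y) \<in> img c' (U \<inter> minterior A)" using q c by simp
    then show "F (cmap c' (cinv c y)) = g (h y)" using V(4)[of "h y"] y(1) e by simp
  qed
qed

lemma S2_component_change:
  assumes c: "c \<in> A" and c': "c' \<in> A" and q: "q \<in> cdom c" "q \<in> cdom c'" and bil: "bilinear (T q)"
  shows "S2_component w c T a b (cmap c q) = \<bar>det (matrix (trans_deriv c c' q))\<bar> powr (- w / (real CARD('n) + 2)) *
     (\<Sum>i\<in>UNIV. \<Sum>j\<in>UNIV. (trans_deriv c c' q a $ i * trans_deriv c c' q b $ j) * S2_component w c' T (axis i 1) (axis j 1) (cmap c' q))"
proof -
  have fv: "frame_vec A c q a = (\<Sum>i\<in>UNIV. trans_deriv c c' q a $ i *\<^sub>R frame_vec A c' q (axis i 1))" for a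
  proof -
    have "frame_vec A c q a = frame_vec A c' q (trans_deriv c c' q a)"
      using c c' q by (simp add: frame_vec_def trans_deriv_trans chart_at)
    then show ?thesis by (simp only: linear_axis_expansion[OF linear_frame_vec[OF c' q(2)], symmetric])
  qed
  note l1 = bil[unfolded bilinear_def, THEN conjunct1, rule_format] and l2 = bil[unfolded bilinear_def, THEN conjunct2, rule_format]
  have "T q (frame_vec A c q a) (frame_vec A c q b) =
    (\<Sum>i\<in>UNIV. \<Sum>j\<in>UNIV. (trans_deriv c c' q a $ i * trans_deriv c c' q b $ j) * T q (frame_vec A c' q (axis i 1)) (frame_vec A c' q (axis j 1)))"
    unfolding fv by (simp add: linear_sum[OF l1] linear_cmul[OF l1] linear_sum[OF l2] linear_cmul[OF l2] sum_distrib_left sum_distrib_right mult_ac)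
      (subst sum.swap, rule refl)
  then show ?thesis
    using c c' q by (simp add: density_local_def coord_field_def density_factor_change[OF c c' q] sum_distrib_left mult_ac)
qed

text \<open>Values on the boundary are defined as boundary values in the chart selected at each point. They fit
  together with the local extensions given in any other chart \<open>c\<close> because the transformation rule of the
  components holds on the interior and passes to the limit.\<close>

lemma glue_S2_extension:
  assumes U: "open U"
    and T: "\<And>p. p \<in> U \<Longrightarrow> p \<in> minterior A \<Longrightarrow> bilinear (T p) \<and> (\<forall>u v. T p u v = T p v u)"
    and local_ext: "\<And>c p a b. c \<in> A \<Longrightarrow> p \<in> U \<Longrightarrow> p \<in> cdom c \<Longrightarrow>
       \<exists>l. extends_at (img c (U \<inter> minterior A)) (cmap c p) (S2_component w c T a b) l"
  obtains S where "smooth_S2_extension A w U T S"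
    and "\<And>c p a b l. c \<in> A \<Longrightarrow> p \<in> U \<Longrightarrow> p \<in> cdom c \<Longrightarrow> p \<in> mboundary A \<Longrightarrow>
       extends_at (img c (U \<inter> minterior A)) (cmap c p) (S2_component w c T a b) l \<Longrightarrow>
       S2_component w c S a b (cmap c p) = l"
proof
  define E where "E c p a b l \<longleftrightarrow> extends_at (img c (U \<inter> minterior A)) (cmap c p) (S2_component w c T a b) l" for c p a b l
  define S where "S p u v = (if p \<in> minterior A then T p u v else SOME l. E (chart_at A p) p u v l)" for p u v
  have notM: "p \<notin> minterior A" if "p \<in> mboundary A" for p using that by (auto simp: minterior_def)
  have Euniq: "l = l'" if "c \<in> A" "p \<in> cdom c" "p \<in> mboundary A" "p \<in> U" "E c p a b l" "E c p a b l'" for c p a b l l'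
    using extends_at_unique[OF _ _ nontrivial_interior[OF that(1-3) U that(4)]] that(5,6) unfolding E_def by blast
  have E0: "E (chart_at A p) p u v (S p u v)" if "p \<in> U" "p \<in> mboundary A" for p u v
    using someI_ex[OF local_ext[OF chart_at(1) that(1) chart_at(2), of u v, folded E_def]] notM[OF that(2)] by (simp add: S_def)
  have S0: "S p u v = l" if "p \<in> U" "p \<in> mboundary A" "E (chart_at A p) p u v l" for p u v l
    using Euniq[OF chart_at that(2,1) E0[OF that(1,2)] that(3)] .
  have comp: "S2_component w c T u v (cmap c q) = density_factor A w c q * T q (frame_vec A c q u) (frame_vec A c q v)"
    if "c \<in> A" "q \<in> cdom c" for c q u v using that by (simp add: density_local_def coord_field_def)
  have bil: "bilinear (S p) \<and> (\<forall>u v. S p u v = S p v u)" if p: "p \<in> U" for p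
  proof (cases "p \<in> minterior A")
    case True
    then have "S p = T p" by (simp add: S_def fun_eq_iff)
    then show ?thesis using T[OF p True] by simp
  next
    case False
    then have pb: "p \<in> mboundary A" by (simp add: minterior_def)
    let ?c = "chart_at A p"
    note ca = chart_at[of p]
    have sy: "S p u v = S p v u" for u v
    proof (rule S0[OF p pb], unfold E_def)
      show "extends_at (img ?c (U \<inter> minterior A)) (cmap ?c p) (S2_component w ?c T u v) (S p v u)"
      proof (rule extends_at_cong[OF E0[OF p pb, of v u, unfolded E_def]])
        fix y assume "y \<in> img ?c (U \<inter> minterior A)"
        then obtain q where q: "q \<in> cdom ?c" "q \<in> U" "q \<in> minterior A" "y = cmap ?c q" by blast
        have "T q (frame_vec A ?c q v) (frame_vec A ?c q u) = T q (frame_vec A ?c q u) (frame_vec A ?c q v)"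
          using T[OF q(2,3)] by blast
        then show "S2_component w ?c T v u y = S2_component w ?c T u v y"
          unfolding q(4) comp[OF ca(1) q(1)] by simp
      qed
    qed
    have add: "S p (u + u') v = S p u v + S p u' v" for u u' v
    proof (rule S0[OF p pb], unfold E_def)
      show "extends_at (img ?c (U \<inter> minterior A)) (cmap ?c p) (S2_component w ?c T (u + u') v) (S p u v + S p u' v)"
      proof (rule extends_at_cong[OF extends_at_add[OF E0[OF p pb, of u v, unfolded E_def] E0[OF p pb, of u' v, unfolded E_def]]])
        fix y assume "y \<in> img ?c (U \<inter> minterior A)"
        then obtain q where q: "q \<in> cdom ?c" "q \<in> U" "q \<in> minterior A" "y = cmap ?c q" by blast
        then show "S2_component w ?c T u v y + S2_component w ?c T u' v y = S2_component w ?c T (u + u') v y"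
          using T[OF q(2,3)] comp[OF ca(1) q(1)] linear_add[OF linear_frame_vec[OF ca(1) q(1)]] bilinear_ladd[of "T q"] by (simp add: algebra_simps)
      qed
    qed
    have scl: "S p (r *\<^sub>R u) v = r * S p u v" for r u v
    proof (rule S0[OF p pb], unfold E_def)
      show "extends_at (img ?c (U \<inter> minterior A)) (cmap ?c p) (S2_component w ?c T (r *\<^sub>R u) v) (r * S p u v)"
      proof (rule extends_at_cong[OF extends_at_mult[OF extends_at_const E0[OF p pb, of u v, unfolded E_def]]])
        fix y assume "y \<in> img ?c (U \<inter> minterior A)"
        then obtain q where q: "q \<in> cdom ?c" "q \<in> U" "q \<in> minterior A" "y = cmap ?c q" by blast
        then show "r * S2_component w ?c T u v y = S2_component w ?c T (r *\<^sub>R u) v y"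
          using T[OF q(2,3)] comp[OF ca(1) q(1)] linear_cmul[OF linear_frame_vec[OF ca(1) q(1)]] bilinear_lmul[of "T q"] by simp
      qed
    qed
    have l1: "linear (\<lambda>u. S p u v)" for v by (rule linearI) (simp_all add: add scl)
    have "S p u = (\<lambda>v. S p v u)" for u by (rule ext) (rule sy)
    then have l2: "linear (S p u)" for u using l1[of u] by metis
    show ?thesis unfolding bilinear_def by (intro conjI allI l1 l2 sy)
  qed
  have val: "S2_component w c S a b (cmap c p) = l"
    if c: "c \<in> A" and p: "p \<in> U" "p \<in> cdom c" "p \<in> mboundary A" and l: "E c p a b l" for c p a b l
  proof -
    let ?c = "chart_at A p"
    note ca = chart_at[of p]
    define \<alpha> where "\<alpha> = - w / (real CARD('n) + 2)"
    let ?U = "cdom ?c \<inter> (U \<inter> minterior A)"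
    let ?J = "\<lambda>x. trans_deriv c ?c (cinv c x)"
    let ?F = "\<lambda>x. \<bar>det (matrix (?J x))\<bar> powr \<alpha> * (\<Sum>i\<in>UNIV. \<Sum>j\<in>UNIV. (?J x a $ i * ?J x b $ j) * S2_component w ?c T (axis i 1) (axis j 1) (cmap ?c (cinv c x)))"
    have oU: "open (cdom ?c \<inter> U)" using U open_cdom[OF ca(1)] by auto
    have imeq: "img c ?U = img c ((cdom ?c \<inter> U) \<inter> minterior A)" by (simp add: Int_assoc)
    have nt: "at (cmap c p) within img c ?U \<noteq> bot"
      unfolding imeq by (rule nontrivial_interior[OF c p(2,3) oU]) (use p ca in auto)
    have Jt: "((\<lambda>x. ?J x a $ i) \<longlongrightarrow> trans_deriv c ?c p a $ i) (at (cmap c p) within img c ?U)" for a i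
    proof -
      have "extends_at (img c ?U) (cmap c p) (\<lambda>x. ?J x a $ i) (?J (cmap c p) a $ i)"
        by (rule extends_at_smooth[OF smooth_on_vec_nth[OF smooth_on_trans_deriv[OF c ca(1)]]]) (use p ca in auto)
      from extends_at_tendsto[OF this] show ?thesis using c p by simp
    qed
    have d0: "det (matrix (trans_deriv c ?c p)) \<noteq> 0" by (rule det_trans_deriv_nonzero[OF c ca(1) p(2) ca(2)])
    have dt: "((\<lambda>x. \<bar>det (matrix (?J x))\<bar> powr \<alpha>) \<longlongrightarrow> \<bar>det (matrix (trans_deriv c ?c p))\<bar> powr \<alpha>) (at (cmap c p) within img c ?U)"
      by (intro tendsto_powr tendsto_rabs tendsto_det tendsto_const) (use d0 Jt in \<open>auto simp: matrix_def\<close>)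
    have Tt: "((\<lambda>x. S2_component w ?c T u v (cmap ?c (cinv c x))) \<longlongrightarrow> S p u v) (at (cmap c p) within img c ?U)" for u v
      by (rule extends_at_tendsto[OF extends_at_change_chart[OF c ca(1) p(2) ca(2) U E0[OF p(1,3), unfolded E_def]]])
    have "(?F
       \<longlongrightarrow> \<bar>det (matrix (trans_deriv c ?c p))\<bar> powr \<alpha> * (\<Sum>i\<in>UNIV. \<Sum>j\<in>UNIV. (trans_deriv c ?c p a $ i * trans_deriv c ?c p b $ j) * S p (axis i 1) (axis j 1)))
      (at (cmap c p) within img c ?U)"
      by (intro tendsto_mult dt tendsto_sum Jt Tt)
    moreover have "(\<Sum>i\<in>UNIV. \<Sum>j\<in>UNIV. (trans_deriv c ?c p a $ i * trans_deriv c ?c p b $ j) * S p (axis i 1) (axis j 1))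
       = (\<Sum>i\<in>UNIV. \<Sum>j\<in>UNIV. (trans_deriv c ?c p a $ i * trans_deriv c ?c p b $ j) * S2_component w ?c S (axis i 1) (axis j 1) (cmap ?c p))"
      using ca by (simp add: density_local_def coord_field_def)
    moreover have "\<bar>det (matrix (trans_deriv c ?c p))\<bar> powr \<alpha> * \<dots> = S2_component w c S a b (cmap c p)"
      unfolding \<alpha>_def using S2_component_change[OF c ca(1) p(2) ca(2), of S w a b] bil[OF p(1)] by simp
    ultimately have 1: "(?F
       \<longlongrightarrow> S2_component w c S a b (cmap c p)) (at (cmap c p) within img c ?U)" by simp
    have "((S2_component w c T a b) \<longlongrightarrow> l) (at (cmap c p) within img c ?U)"
      by (rule tendsto_within_subset[OF extends_at_tendsto[OF l[unfolded E_def]]]) auto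
    moreover have "\<forall>\<^sub>F x in at (cmap c p) within img c ?U. S2_component w c T a b x =
       ?F x"
      unfolding eventually_at_filter
    proof (rule always_eventually, intro allI impI)
      fix x assume "x \<in> img c ?U"
      then obtain q where q: "q \<in> cdom c" "q \<in> cdom ?c" "q \<in> U" "q \<in> minterior A" "x = cmap c q" by blast
      then show "S2_component w c T a b x =
       ?F x"
        using S2_component_change[OF c ca(1) q(1,2), of T w a b] T[OF q(3,4)] c by (simp add: \<alpha>_def)
    qed
    ultimately have 2: "(?F
       \<longlongrightarrow> l) (at (cmap c p) within img c ?U)"
      by (rule Lim_transform_eventually)
    show ?thesis by (rule tendsto_unique[OF nt 1 2])
  qed
  show "S2_component w c S a b (cmap c p) = l"
    if "c \<in> A" "p \<in> U" "p \<in> cdom c" "p \<in> mboundary A"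
      "extends_at (img c (U \<inter> minterior A)) (cmap c p) (S2_component w c T a b) l" for c p a b l
    using val[OF that(1-4), unfolded E_def, OF that(5)] .
  show "smooth_S2_extension A w U T S"
    unfolding smooth_S2_extension_def smooth_S2_def
  proof (intro conjI ballI allI)
    show "bilinear (S p)" "S p u v = S p v u" if "p \<in> U" for p u v using bil[OF that] by auto
    show "S p u v = T p u v" if "p \<in> U \<inter> minterior A" for p u v using that by (simp add: S_def)
    fix c a b assume c: "c \<in> A"
    show "smooth_on (img c U) (S2_component w c S a b)"
    proof (rule smooth_onI)
      fix x assume "x \<in> img c U"
      then obtain p where p: "p \<in> U" "p \<in> cdom c" "x = cmap c p" by blast
      obtain l where E: "extends_at (img c (U \<inter> minterior A)) (cmap c p) (S2_component w c T a b) l"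
        using local_ext[OF c p(1,2), of a b] ..
      obtain V g where V': "open V" "cmap c p \<in> V" "smooth_on V g"
        "\<And>y. y \<in> V \<Longrightarrow> y \<in> img c (U \<inter> minterior A) \<Longrightarrow> S2_component w c T a b y = g y" "g (cmap c p) = l"
        by (rule extends_atE[OF E]) (rule that)
      note V = V'(1) V'(2)[folded p(3)] V'(3,4)
      have "\<forall>y\<in>img c U \<inter> V. S2_component w c S a b y = g y"
      proof
        fix y assume y: "y \<in> img c U \<inter> V"
        then obtain q where q: "q \<in> U" "q \<in> cdom c" "y = cmap c q" by blast
        show "S2_component w c S a b y = g y"
        proof (cases "q \<in> minterior A")
          case True
          then have "S2_component w c S a b y = S2_component w c T a b y"
            using q c by (simp add: density_local_def S_def)
          then show ?thesis using V(4)[of y] y True q by auto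
        next
          case False
          then have "q \<in> mboundary A" by (simp add: minterior_def)
          moreover have "E c q a b (g y)"
            unfolding E_def by (rule extends_atI[OF V(1) _ V(3,4)]) (use y q in auto)
          ultimately show ?thesis using val[OF c q(1,2)] q(3) by blast
        qed
      qed
      then show "\<exists>V h. open V \<and> x \<in> V \<and> smooth_on V h \<and> (\<forall>y\<in>img c U \<inter> V. S2_component w c S a b y = h y)"
        using V(1-3) by blast
    qed
  qed
qed

end

section \<open>The Schouten tensor and the form \<open>\<Phi>\<close>\<close>

context pre_compact_conn begin

lemma Kc_sym: "c \<in> A \<Longrightarrow> x \<in> img c M \<Longrightarrow> Kc c x u v = Kc c x v u"
  by (simp add: Kc_def Gam_sym add_ac)

lemma kN_sym:
  assumes c: "c \<in> A" "p \<in> cdom c" "p \<in> mboundary A"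
  shows "kN c p u v = kN c p v u"
proof (rule ext_unique[OF c kN[OF c]])
  show "extends_at (img c M) (cmap c p) (\<lambda>x. Kc c x u v $ None) (kN c p v u)"
    by (rule extends_at_cong[OF kN[OF c]]) (simp add: Kc_sym[OF c(1), of _ u v])
qed

lemma hess_symmetric_bilinear:
  assumes \<rho>: "local_defining_function A U \<rho>" and p: "p \<in> U" "p \<in> M"
  shows "bilinear (hess \<rho> p) \<and>
    (\<forall>u v. hess \<rho> p u v = hess \<rho> p v u)"
proof -
  let ?c = "chart_at A p"
  note ca = chart_at[of p]
  have x: "cmap ?c p \<in> img ?c (U \<inter> M)" using ca p by auto
  let ?h = "hess \<rho> p"
  have h: "?h u v = \<sigma> p * hess_coords ?c (\<lambda>x. \<rho> (cinv ?c x)) (cmap ?c p) u v" for u v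
    using hess_local[OF \<rho> ca(1) p(1) ca(2) p(2), of u v] by simp
  have sym: "?h u v = ?h v u" for u v
    unfolding h using hess_coords_sym_linear(1)[OF ca(1) \<rho> x, of u v] by simp
  have l: "linear (\<lambda>u. ?h u v)" for v
    unfolding h using linear_add[OF hess_coords_sym_linear(2)[OF ca(1) \<rho> x, of v]] linear_cmul[OF hess_coords_sym_linear(2)[OF ca(1) \<rho> x, of v]]
    by (intro linearI) (simp_all add: algebra_simps)
  show ?thesis using bilinear_symI[of ?h, OF sym l] sym by blast
qed

lemma hess_component:
  assumes \<rho>: "local_defining_function A U \<rho>" and c: "c \<in> A" and x: "x \<in> img c (U \<inter> M)"
  shows "S2_component 1 c (hess \<rho>) a b x = sig c x * hess_coords c (\<lambda>x. \<rho> (cinv c x)) x a b"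
proof -
  obtain q where q: "q \<in> cdom c" "q \<in> U" "q \<in> M" "x = cmap c q" using x by blast
  then show ?thesis
    using hess_local[OF \<rho> c q(2,1,3)] c by (simp add: density_local_def coord_field_def)
qed

lemma hess_component_extends:
  assumes \<rho>: "local_defining_function A U \<rho>" and c: "c \<in> A" and p: "p \<in> U" "p \<in> cdom c"
  shows "\<exists>l. extends_at (img c (U \<inter> M)) (cmap c p) (S2_component 1 c (hess \<rho>) a b) l"
proof -
  let ?h = "\<lambda>x. sig c x * hess_coords c (\<lambda>x. \<rho> (cinv c x)) x a b"
  have "\<exists>l. extends_at (img c (U \<inter> M)) (cmap c p) ?h l"
  proof (cases "p \<in> M")
    case True
    have "extends_at (img c (U \<inter> M)) (cmap c p) ?h (?h (cmap c p))"
      by (rule extends_at_smooth[OF hess_coords_smooth[OF c p(2) \<rho> p(1)]]) (use p True in auto)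
    then show ?thesis ..
  next
    case False
    then have pb: "p \<in> mboundary A" by (simp add: minterior_def)
    obtain t where "extends_at (img c M) (cmap c p) (\<lambda>x. sig c x / x $ None) t"
      using rescaled_density_extends[OF c p(2) pb] by blast
    from hess_extends[OF c p(2) \<rho> p(1) pb this] show ?thesis by blast
  qed
  then obtain l where l: "extends_at (img c (U \<inter> M)) (cmap c p) ?h l" ..
  have "extends_at (img c (U \<inter> M)) (cmap c p) (S2_component 1 c (hess \<rho>) a b) l"
    by (rule extends_at_cong[OF l]) (rule hess_component[OF \<rho> c, symmetric])
  then show ?thesis ..
qed

text \<open>The boundary value is the same for all \<open>\<rho>\<close> by \<open>hess_extends\<close>, so it satisfies the description of \<open>\<Phi>\<close>.
  It is the only such value: the transversal coordinate is one admissible \<open>\<rho>\<close>, and its smooth extension is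
  determined on the boundary by continuity.\<close>

lemma Phi_boundary_value:
  assumes p: "p \<in> mboundary A" and v: "v \<in> boundary_tangent A p"
    and t: "extends_at (img (chart_at A p) M) (cmap (chart_at A p) p) (\<lambda>x. sig (chart_at A p) x / x $ None) t"
  shows "Phi A D \<sigma> p u v = - t * kN (chart_at A p) p u v"
  unfolding Phi_def
proof (rule the_equality)
  let ?c = "chart_at A p"
  note ca = chart_at[of p]
  have v0: "v $ None = 0" using boundary_tangent_iff[OF ca p, of v] v by simp
  have hv: "extends_at (img ?c (U \<inter> M)) (cmap ?c p) (S2_component 1 ?c (hess \<rho>) u v) (- t * kN ?c p u v)"
    if \<rho>: "local_defining_function A U \<rho>" "p \<in> U" for U \<rho>
  proof -
    obtain l where l: "extends_at (img ?c (U \<inter> M)) (cmap ?c p) (\<lambda>x. sig ?c x * hess_coords ?c (\<lambda>x. \<rho> (cinv ?c x)) x u v) l"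
      "l = - t * kN ?c p u v"
      using hess_extends[OF ca \<rho> p t, of u v] v0 by blast
    show ?thesis
      by (rule extends_at_cong[OF l(1)[unfolded l(2)]]) (rule hess_component[OF \<rho>(1) ca(1), symmetric])
  qed
  have comp: "S2_component 1 ?c S u v (cmap ?c p) = S p u v" for S
    using ca by (simp add: density_local_def coord_field_def)
  show "\<forall>U \<rho>. local_defining_function A U \<rho> \<and> p \<in> U \<longrightarrow>
    (\<exists>S. smooth_S2_extension A 1 U (hess \<rho>) S \<and> S p u v = - t * kN ?c p u v)"
  proof (intro allI impI, elim conjE)
    fix U \<rho> assume \<rho>: "local_defining_function A U \<rho>" and pU: "p \<in> U"
    obtain S where S: "smooth_S2_extension A 1 U (hess \<rho>) S"
      "\<And>c p a b l. c \<in> A \<Longrightarrow> p \<in> U \<Longrightarrow> p \<in> cdom c \<Longrightarrow> p \<in> mboundary A \<Longrightarrow>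
       extends_at (img c (U \<inter> M)) (cmap c p) (S2_component 1 c (hess \<rho>) a b) l \<Longrightarrow>
       S2_component 1 c S a b (cmap c p) = l"
      by (rule glue_S2_extension[OF local_defining_functionD(1)[OF \<rho>] hess_symmetric_bilinear[OF \<rho>] hess_component_extends[OF \<rho>]]) (assumption | rule that | blast)+
    have "S p u v = - t * kN ?c p u v"
      using S(2)[OF ca(1) pU ca(2) p hv[OF \<rho> pU]] by (simp only: comp)
    then show "\<exists>S. smooth_S2_extension A 1 U (hess \<rho>) S \<and> S p u v = - t * kN ?c p u v"
      using S(1) by blast
  qed
  fix t' assume t': "\<forall>U \<rho>. local_defining_function A U \<rho> \<and> p \<in> U \<longrightarrow>
    (\<exists>S. smooth_S2_extension A 1 U (hess \<rho>) S \<and> S p u v = t')"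
  define \<rho> where "\<rho> = (\<lambda>q. cmap ?c q $ None)"
  have \<rho>: "local_defining_function A (cdom ?c) \<rho>" unfolding \<rho>_def by (rule coordinate_defining_function[OF ca(1)])
  obtain S where S: "smooth_S2_extension A 1 (cdom ?c) (hess \<rho>) S" "S p u v = t'"
    using t' \<rho> ca(2) by blast
  have sm: "smooth_on (img ?c (cdom ?c)) (S2_component 1 ?c S u v)"
    using S(1) ca(1) unfolding smooth_S2_extension_def smooth_S2_def by blast
  have "extends_at (img ?c (cdom ?c \<inter> M)) (cmap ?c p) (S2_component 1 ?c S u v) (S2_component 1 ?c S u v (cmap ?c p))"
    by (rule extends_at_smooth[OF sm]) (use ca in auto)
  then have e: "extends_at (img ?c (cdom ?c \<inter> M)) (cmap ?c p) (S2_component 1 ?c S u v) t'"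
    by (simp only: comp S(2))
  have "extends_at (img ?c (cdom ?c \<inter> M)) (cmap ?c p) (S2_component 1 ?c (hess \<rho>) u v) t'"
  proof (rule extends_at_cong[OF e])
    fix y assume "y \<in> img ?c (cdom ?c \<inter> M)"
    then obtain q where q: "q \<in> cdom ?c" "q \<in> M" "y = cmap ?c q" by blast
    have "S q a b = hess \<rho> q a b" for a b
      using S(1) q unfolding smooth_S2_extension_def by blast
    then show "S2_component 1 ?c S u v y = S2_component 1 ?c (hess \<rho>) u v y"
      using q ca by (simp add: density_local_def)
  qed
  from extends_at_unique[OF this hv[OF \<rho> ca(2)] nontrivial_interior[OF ca p open_cdom[OF ca(1)] ca(2)]]
  show "t' = - t * kN ?c p u v" .
qed

lemma Schouten_symmetric_bilinear:
  assumes p: "p \<in> M"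
  shows "bilinear (\<lambda>u v. \<sigma> p * Schouten A D p u v) \<and> (\<forall>u v. \<sigma> p * Schouten A D p u v = \<sigma> p * Schouten A D p v u)"
proof -
  let ?c = "chart_at A p"
  note ca = chart_at[of p]
  have x: "cmap ?c p \<in> img ?c M" using ca p by auto
  let ?h = "\<lambda>u v. \<sigma> p * Schouten A D p u v"
  have h: "?h u v = \<sigma> p * (ric_coords ?c (cmap ?c p) u v / real CARD('b))" for u v
    using Ric_ric[OF ca p, of u v] by (simp add: Schouten_def)
  have sym: "?h u v = ?h v u" for u v
    unfolding h using ric_sym[OF ca(1) x, of u v] by simp
  have l: "linear (\<lambda>u. ?h u v)" for v
    unfolding h using linear_add[OF linear_ric1[OF ca(1) x, of v]] linear_cmul[OF linear_ric1[OF ca(1) x, of v]]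
    by (intro linearI) (simp_all add: algebra_simps add_divide_distrib)
  show ?thesis using bilinear_symI[of ?h, OF sym l] sym by blast
qed

lemma Schouten_component:
  assumes c: "c \<in> A" and x: "x \<in> img c M"
  shows "S2_component 1 c (\<lambda>p u v. \<sigma> p * Schouten A D p u v) a b x = sig c x * (ric_coords c x a b / real CARD('b))"
proof -
  obtain q where q: "q \<in> cdom c" "q \<in> M" "x = cmap c q" using x by blast
  then show ?thesis
    using Ric_ric[OF c q(1,2)] c by (simp add: density_local_def coord_field_def Schouten_def)
qed

lemma Schouten_component_boundary:
  assumes c: "c \<in> A" and p: "p \<in> cdom c" "p \<in> mboundary A"
    and t: "extends_at (img c M) (cmap c p) (\<lambda>x. sig c x / x $ None) t"
  shows "\<exists>l. extends_at (img c M) (cmap c p) (S2_component 1 c (\<lambda>p u v. \<sigma> p * Schouten A D p u v) b d) l \<and>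
    (b $ None = 0 \<and> (d $ None = 0 \<or> (\<forall>u. u $ None = 0 \<longrightarrow> kN c p b u = 0)) \<longrightarrow> l = - t * kN c p b d)"
proof -
  let ?n = "real CARD('b)"
  obtain l where l: "extends_at (img c M) (cmap c p) (\<lambda>x. x $ None * ric_coords c x b d) l"
    "b $ None = 0 \<and> (d $ None = 0 \<or> (\<forall>u. u $ None = 0 \<longrightarrow> kN c p b u = 0)) \<longrightarrow> l = - ?n * kN c p b d"
    using ric_extends[OF c p, of b d] by blast
  have E: "extends_at (img c M) (cmap c p) (\<lambda>x. (sig c x / x $ None) * ((x $ None * ric_coords c x b d) * (1 / ?n))) (t * (l * (1 / ?n)))"
    by (intro extends_at_mult t l(1) extends_at_const)
  have "extends_at (img c M) (cmap c p) (S2_component 1 c (\<lambda>p u v. \<sigma> p * Schouten A D p u v) b d) (t * (l * (1 / ?n)))"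
  proof (rule extends_at_cong[OF E])
    fix x assume x: "x \<in> img c M"
    then have "x $ None \<noteq> 0" using minterior_iff[OF c] by force
    then show "(sig c x / x $ None) * ((x $ None * ric_coords c x b d) * (1 / ?n)) = S2_component 1 c (\<lambda>p u v. \<sigma> p * Schouten A D p u v) b d x"
      unfolding Schouten_component[OF c x] by simp
  qed
  moreover have "b $ None = 0 \<and> (d $ None = 0 \<or> (\<forall>u. u $ None = 0 \<longrightarrow> kN c p b u = 0)) \<longrightarrow> t * (l * (1 / ?n)) = - t * kN c p b d"
    using l(2) by simp
  ultimately show ?thesis by blast
qed

lemma Schouten_component_extends:
  assumes c: "c \<in> A" and p: "p \<in> cdom c"
  shows "\<exists>l. extends_at (img c M) (cmap c p) (S2_component 1 c (\<lambda>p u v. \<sigma> p * Schouten A D p u v) a b) l"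
proof (cases "p \<in> M")
  case True
  have s: "smooth_on (img c M) (\<lambda>x. sig c x * (ric_coords c x a b * (1 / real CARD('b))))"
    by (intro smooth_on_mult sig_smooth[OF c] ric_smooth[OF c] smooth_on_const)
  have "extends_at (img c M) (cmap c p) (\<lambda>x. sig c x * (ric_coords c x a b * (1 / real CARD('b)))) (sig c (cmap c p) * (ric_coords c (cmap c p) a b * (1 / real CARD('b))))"
    by (rule extends_at_smooth[OF s]) (use p True in auto)
  then have "extends_at (img c M) (cmap c p) (S2_component 1 c (\<lambda>p u v. \<sigma> p * Schouten A D p u v) a b) (sig c (cmap c p) * (ric_coords c (cmap c p) a b * (1 / real CARD('b))))"
    by (rule extends_at_cong) (simp add: Schouten_component[OF c])
  then show ?thesis ..
next
  case False
  then have pb: "p \<in> mboundary A" by (simp add: minterior_def)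
  obtain t where "extends_at (img c M) (cmap c p) (\<lambda>x. sig c x / x $ None) t"
    using rescaled_density_extends[OF c p pb] by blast
  from Schouten_component_boundary[OF c p pb this] show ?thesis by blast
qed

text \<open>In the frame of the chart selected at \<open>p\<close>, both forms are \<open>- t\<close> times \<open>kN\<close> with \<open>t \<noteq> 0\<close>: for \<open>\<Phi>\<close> if the
  second argument is tangential, for \<open>\<sigma> P\<close> if the first argument \<open>v\<close> is tangential and in addition the
  second one is tangential or \<open>kN(v, w) = 0\<close> for all tangential \<open>w\<close>. Moreover \<open>\<sigma> P\<close> and \<open>kN\<close> are symmetric. Either vanishing condition first gives
  \<open>kN = 0\<close> on tangential pairs, and then the two forms agree.\<close>

lemma Schouten_extension:
  "\<exists>S. smooth_S2_extension A 1 UNIV (\<lambda>p u v. \<sigma> p * Schouten A D p u v) S \<and>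
     (\<forall>p\<in>mboundary A. \<forall>u\<in>boundary_tangent A p. \<forall>v\<in>boundary_tangent A p. S p u v = Phi A D \<sigma> p u v) \<and>
     ((\<forall>p\<in>mboundary A. \<forall>u. \<forall>v\<in>boundary_tangent A p. Phi A D \<sigma> p u v = 0) \<longleftrightarrow>
      (\<forall>p\<in>mboundary A. \<forall>u. \<forall>v\<in>boundary_tangent A p. S p u v = 0))"
proof -
  let ?T = "\<lambda>p u v. \<sigma> p * Schouten A D p u v"
  obtain S where S: "smooth_S2_extension A 1 UNIV ?T S"
    "\<And>c p a b l. c \<in> A \<Longrightarrow> p \<in> UNIV \<Longrightarrow> p \<in> cdom c \<Longrightarrow> p \<in> mboundary A \<Longrightarrow>
       extends_at (img c (UNIV \<inter> M)) (cmap c p) (S2_component 1 c ?T a b) l \<Longrightarrow> S2_component 1 c S a b (cmap c p) = l"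
  proof (rule glue_S2_extension[of UNIV ?T 1])
    show "\<exists>l. extends_at (img c (UNIV \<inter> M)) (cmap c p) (S2_component 1 c ?T a b) l" if "c \<in> A" "p \<in> cdom c" for c p a b
      using Schouten_component_extends[OF that] by simp
  qed (use Schouten_symmetric_bilinear in auto)
  have sym: "S p u v = S p v u" for p u v
    using S(1) unfolding smooth_S2_extension_def smooth_S2_def by blast
  define k where "k p = kN (chart_at A p) p" for p
  have ksym: "k p u v = k p v u" if "p \<in> mboundary A" for p u v
    unfolding k_def by (rule kN_sym[OF chart_at that])
  have tan: "v $ None = 0 \<longleftrightarrow> v \<in> boundary_tangent A p" if "p \<in> mboundary A" for p v
    using boundary_tangent_iff[OF chart_at that, of v] by simp
  have "\<exists>t. t \<noteq> 0 \<and> (\<forall>u. \<forall>v\<in>boundary_tangent A p. Phi A D \<sigma> p u v = - t * k p u v) \<and>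
      (\<forall>v\<in>boundary_tangent A p. \<forall>u. (u \<in> boundary_tangent A p \<or> (\<forall>w\<in>boundary_tangent A p. k p v w = 0)) \<longrightarrow> S p v u = - t * k p v u)"
    if p: "p \<in> mboundary A" for p
  proof -
    let ?c = "chart_at A p"
    note ca = chart_at[of p]
    obtain t where t: "t \<noteq> 0" "extends_at (img ?c M) (cmap ?c p) (\<lambda>x. sig ?c x / x $ None) t"
      using rescaled_density_extends[OF ca p] by blast
    have "S p v u = - t * k p v u"
      if v: "v \<in> boundary_tangent A p" and u: "u \<in> boundary_tangent A p \<or> (\<forall>w\<in>boundary_tangent A p. k p v w = 0)" for u v
    proof -
      obtain l where l: "extends_at (img ?c M) (cmap ?c p) (S2_component 1 ?c ?T v u) l" "l = - t * k p v u"
        using Schouten_component_boundary[OF ca p t(2), of v u] u v unfolding k_def tan[OF p] by blast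
      have "S2_component 1 ?c S v u (cmap ?c p) = l"
        by (rule S(2)[OF ca(1) UNIV_I ca(2) p]) (use l(1) in simp)
      then show ?thesis using ca l(2) by (simp add: density_local_def coord_field_def)
    qed
    then show ?thesis
      using t(1) Phi_boundary_value[OF p _ t(2)] unfolding k_def by blast
  qed
  then obtain t where t: "\<And>p. p \<in> mboundary A \<Longrightarrow> t p \<noteq> 0"
    and \<Phi>: "\<And>p u v. p \<in> mboundary A \<Longrightarrow> v \<in> boundary_tangent A p \<Longrightarrow> Phi A D \<sigma> p u v = - t p * k p u v"
    and Sv: "\<And>p u v. p \<in> mboundary A \<Longrightarrow> v \<in> boundary_tangent A p \<Longrightarrow>
       u \<in> boundary_tangent A p \<or> (\<forall>w\<in>boundary_tangent A p. k p v w = 0) \<Longrightarrow> S p v u = - t p * k p v u"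
    by metis
  have "(\<forall>u. \<forall>v\<in>boundary_tangent A p. Phi A D \<sigma> p u v = 0) \<longleftrightarrow> (\<forall>u. \<forall>v\<in>boundary_tangent A p. S p u v = 0)"
    if p: "p \<in> mboundary A" for p
  proof
    assume "\<forall>u. \<forall>v\<in>boundary_tangent A p. Phi A D \<sigma> p u v = 0"
    then have k0: "k p u v = 0" if "v \<in> boundary_tangent A p" for u v
      using \<Phi>[OF p that] t[OF p] that by fastforce
    show "\<forall>u. \<forall>v\<in>boundary_tangent A p. S p u v = 0"
    proof (intro allI ballI)
      fix u v assume v: "v \<in> boundary_tangent A p"
      have "S p v u = - t p * k p v u" using Sv[OF p v] k0 by blast
      then show "S p u v = 0" using sym[of p u v] ksym[OF p, of v u] k0[OF v] by simp
    qed
  next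
    assume S0: "\<forall>u. \<forall>v\<in>boundary_tangent A p. S p u v = 0"
    have k1: "k p v w = 0" if "v \<in> boundary_tangent A p" "w \<in> boundary_tangent A p" for v w
      using Sv[OF p that(1)] S0 t[OF p] that by fastforce
    show "\<forall>u. \<forall>v\<in>boundary_tangent A p. Phi A D \<sigma> p u v = 0"
    proof (intro allI ballI)
      fix u v assume v: "v \<in> boundary_tangent A p"
      have "S p v u = - t p * k p v u" using Sv[OF p v] k1[OF v] by blast
      then have "k p v u = 0" using S0 v sym[of p v u] t[OF p] by simp
      then show "Phi A D \<sigma> p u v = 0" using \<Phi>[OF p v] ksym[OF p, of u v] by simp
    qed
  qed
  moreover have "S p u v = Phi A D \<sigma> p u v"
    if "p \<in> mboundary A" "u \<in> boundary_tangent A p" "v \<in> boundary_tangent A p" for p u v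
    using Sv[of p u v] \<Phi>[of p v u] that by simp
  ultimately show ?thesis using S(1) by blast
qed

end

theorem theorem2p9:
  fixes A :: "('a::{t2_space, second_countable_topology}, 'n::finite) chart set"
    and D :: "('a, 'n) conn"
    and \<sigma> :: "'a \<Rightarrow> real"
  assumes "smooth_manifold_with_boundary A"
    and "special_connection A (minterior A) D"
    and "projectively_pre_compact A D"
    and "smooth_density A 1 (minterior A) \<sigma>"
    and "\<forall>p\<in>minterior A. \<sigma> p \<noteq> 0"
    and "parallel_density A (minterior A) D 1 \<sigma>"
  shows "\<exists>S. smooth_S2_extension A 1 UNIV (\<lambda>p u v. \<sigma> p * Schouten A D p u v) S \<and>
           (\<forall>p\<in>mboundary A. \<forall>u\<in>boundary_tangent A p. \<forall>v\<in>boundary_tangent A p.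
              S p u v = Phi A D \<sigma> p u v) \<and>
           ((\<forall>p\<in>mboundary A. \<forall>u. \<forall>v\<in>boundary_tangent A p. Phi A D \<sigma> p u v = 0) \<longleftrightarrow>
            (\<forall>p\<in>mboundary A. \<forall>u. \<forall>v\<in>boundary_tangent A p. S p u v = 0))"
proof -
  interpret pre_compact_conn A D \<sigma>
    by unfold_locales (use assms in \<open>auto simp: special_connection_def\<close>)
  show ?thesis by (rule Schouten_extension)
qed

end
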